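(* Let $Q$ be the continuous quiver of type $\mathbb A$ with straight descending orientation, and let $\Phi:\mathcal L\to\mathcal S(Q)$ be the map sending a measured lamination $(L,\mathcal M)$ to the equivalence class of the red-blue function pair $(F,0)$, where $F$ is the useful function associated with $(L,\mathcal M)$ (see context). Then $\Phi$ is a bijection $\mathcal L\to\mathcal S_{\mathrm{fpc}}(Q)$. Furthermore, for a measured lamination $L$ and stability condition $\Phi(L)$, there is a bijection $\phi_L$ from $L$ to the set of $\Phi(L)$-semistable indecomposable modules.
   Context: **The quiver.** $\overline{\mathbb R}=\mathbb R\cup\{-\infty,+\infty\}$. The straight descending continuous quiver of type $\mathbb A$ is $Q=(\mathbb R,\le)$ with the usual order $\preceq\,=\,\le$ on $\overline{\mathbb R}$; as a category, there is exactly one morphism $x\to y$ if $y\le x$ and none otherwise. Its only sink is $-\infty$, its only source is $+\infty$, and all of $\mathbb R$ is red. Fix a field $\Bbbk$. For an interval $I\subseteq\mathbb R$, $M_I$ is the functor $Q\to\mathrm{vec}(\Bbbk)$ equal to $\Bbbk$ on $I$ and $0$ elsewhere, with identity maps inside $I$; $P_a=M_{(-\infty,a]}$. A module is representable if it is the cokernel of a monomorphism between finite direct sums of modules $P_a$, $a\in\mathbb R$. The indecomposable representable modules $\mathrm{Ind}^{\mathrm r}(Q)$ are the $M_{(a,b]}$ with $-\infty\le a<b<+\infty$. Put $\widehat Q=\{-\infty_+\}\cup\mathbb R$, with $-\infty_+$ the minimum. For $I=(a,b]$, $\widehat I=[a,b]\subseteq\widehat Q$ (with $-\infty_+$ in place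 of $a$ if $a=-\infty$). **Useful functions.** For $x\in\mathbb R$ let $\Delta_x^-(z)=0$ for $z<x$, $1$ for $z\ge x$; $\Delta_x^+(z)=0$ for $z\le x$, $1$ for $z>x$; on $\mathbb R$, $\Delta^-_{+\infty}=0$ and $\Delta^+_{-\infty}=1$. A useful function is $F:\mathbb R\to\mathbb R$ with a decomposition $F=f+\sum_{x\in\mathbb R\cup\{+\infty\}}u_x^-\Delta_x^-+\sum_{x\in\mathbb R\cup\{-\infty\}}u_x^+\Delta_x^+$, $f$ continuous of bounded variation, $u_x^\pm\in\mathbb R$, $\sum|u_x^-|<\infty$, $\sum|u_x^+|<\infty$. One-sided limits exist; put $F(-\infty)=\lim_{x\to-\infty}F(x)-u_{-\infty}^+$, $F(+\infty)=\lim_{x\to+\infty}F(x)+u_{+\infty}^-$. For $a\in\overline{\mathbb R}$, $F_{\min}(a)$ and $F_{\max}(a)$ are the minimum and maximum of $F(a)$ and those of $\lim_{x\to a^-}F(x)$, $\lim_{x\to a^+}F(x)$ that make sense. $\mathcal G(F)=\{(x,y):x\in\mathbb R,\ F_{\min}(x)\le y\le F_{\max}(x)\}$ and $\overline{\mathcal G(F)}$ is defined the same way with $x\in\overline{\mathbb R}$. **Stability conditions on this $Q$.** A red-blue function pair $(R,B)$ consists of useful functions $R$ (with data $r,u_x^\pm$) and $B$ (with data $b,v_x^\pm$) such that: (1) $R_{\max}(x)=R(x)$ and $B_{\min}(x)=B(x)$ for all $x\in\mathbb R$; (2) $u_{+\infty}^-=v_{+\infty}^-=0$ (no half-delta at a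 source); (3) for all $x\in\overline{\mathbb R}$, $R(x)\le B_{\max}(x)$ and $R_{\min}(x)\le B(x)$; (4) $R(-\infty)=B(-\infty)$ and $R(+\infty)=B(+\infty)$; (5) $B$ is constant ($b$ is constant on $\mathbb R$ and $v_x^\pm=0$ for $x\in\mathbb R$, and $v_{-\infty}^+=0$). Two pairs are equivalent if for some $\mathfrak c\in\mathbb R$ translation by $\mathfrak c$ in the second coordinate carries $\overline{\mathcal G(R)}$ onto $\overline{\mathcal G(R')}$ and $\overline{\mathcal G(B)}$ onto $\overline{\mathcal G(B')}$. $\mathcal S(Q)$ is the set of equivalence classes, called stability conditions. The modified graph is $\widehat{\mathcal G}(R,B)=\mathcal G(R)\cup\{(-\infty_+,y):(-\infty,y)\in\overline{\mathcal G(R)}\}\subseteq\widehat Q\times\mathbb R$. With $(R,B)$ representing $\sigma$, $M_I\in\mathrm{Ind}^{\mathrm r}(Q)$ is $\sigma$-semistable if there is $h\in\mathbb R$ with $(\min\widehat I,h),(\max\widehat I,h)\in\widehat{\mathcal G}(R,B)$ and $R_{\max}(x)\le h\le B_{\min}(x)$ for all $x\in\widehat I$ other than the endpoints. $\sigma$ satisfies the four point condition if for every $\sigma$-semistable $M_I$ and every such $h$, $|(\widehat I\times\{h\})\cap\widehat{\mathcal G}(R,B)|\le3$; $\mathcal S_{\mathrm{fpc}}(Q)$ is the set of such $\sigma$. **Measured laminations.** $\mathfrak h^2$ is the Poincaré disk with boundary circle $\partial\mathfrak h^2\subset\mathbb C$; a geodesic is determined by its two distinct endpoints on $\partial\mathfrak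 h^2$. A lamination is a maximal set $L$ of pairwise noncrossing geodesics. For open intervals $A,B\subseteq\partial\mathfrak h^2$ (each possibly empty or all of $\partial\mathfrak h^2$), $O_{A,B}\subseteq L$ is the set of geodesics of $L$ with one endpoint in $A$ and the other in $B$; these generate a topology on $L$. A measured lamination is a pair $(L,\mathcal M)$ with $\mathcal M$ a (Borel) measure on $L$ such that $0<\mathcal M(O_{A,B})<\infty$ for every $O_{A,B}\ne\emptyset$. $\mathcal L$ is the set of measured laminations. **The useful function of $(L,\mathcal M)$.** Index $\partial\mathfrak h^2$ by $\mathbb R\cup\{-\infty\}$ via $x\mapsto e^{2i\arctan x}$. For $\gamma\in L$ let $\gamma_a<\gamma_b$ be its endpoints in $\mathbb R\cup\{-\infty\}$. For $x\in\mathbb R$ put $\frac Lx=\{\gamma\in L:\gamma_a<x<\gamma_b\}$, $L\cdot x=\{\gamma:\gamma_b=x\}$, $x\cdot L=\{\gamma:\gamma_a=x\}$; $(-\infty)\cdot L=\{\gamma:\gamma_a=-\infty\}$. Define $u_{-\infty}^+=-\mathcal M((-\infty)\cdot L)$, $u_{+\infty}^-=0$, $F(\pm\infty)=0$, $f(\pm\infty)=0$, and for $a\in\mathbb R$: $u_a^-=\mathcal M(L\cdot a)$, $u_a^+=-\mathcal M(a\cdot L)$, $F(a)=-\mathcal M(\frac La)$, $f(a)=F(a)-\sum_{x\le a}u_x^--\sum_{x<a}u_x^+$ (sums including $x=-\infty$, with $u_{-\infty}^-=0$). Then $(F,0)$ is a red-blue function pair for $Q$ (with $F$ as $R$, $0$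 as $B$). *)

theory Defs
  imports "HOL-Analysis.Analysis"
begin

section \<open>Representations of the straight descending quiver\<close>

text \<open>
  The category of finite-dimensional vector spaces over the field \<open>'k\<close> is modelled by the
  linear subspaces of \<open>k^n\<close>, for all \<open>n\<close>, where a vector of \<open>k^n\<close> is a sequence \<open>nat \<Rightarrow> 'k\<close>
  that vanishes from index \<open>n\<close> on.
\<close>

definition vec_subspace :: "(nat \<Rightarrow> 'k::field) set \<Rightarrow> bool" where
  "vec_subspace V \<longleftrightarrow> (\<lambda>_. 0) \<in> V \<and> (\<forall>u\<in>V. \<forall>v\<in>V. \<forall>c. (\<lambda>i. c * u i + v i) \<in> V)"

definition vec_space :: "(nat \<Rightarrow> 'k::field) set \<Rightarrow> bool" where
  "vec_space V \<longleftrightarrow> vec_subspace V \<and> (\<exists>n. \<forall>v\<in>V. \<forall>i\<ge>n. v i = 0)"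

definition lin_map ::
    "(nat \<Rightarrow> 'k::field) set \<Rightarrow> (nat \<Rightarrow> 'k) set \<Rightarrow> ((nat \<Rightarrow> 'k) \<Rightarrow> nat \<Rightarrow> 'k) \<Rightarrow> bool" where
  "lin_map V W g \<longleftrightarrow> g \<in> V \<rightarrow> W \<and>
     (\<forall>u\<in>V. \<forall>v\<in>V. \<forall>c. g (\<lambda>i. c * u i + v i) = (\<lambda>i. c * g u i + g v i))"

text \<open>\<open>tr N x y\<close> is the structure map along the morphism \<open>x \<rightarrow> y\<close>, which exists iff \<open>y \<le> x\<close>.\<close>

record 'k qmod =
  fib :: "real \<Rightarrow> (nat \<Rightarrow> 'k) set"
  tr :: "real \<Rightarrow> real \<Rightarrow> (nat \<Rightarrow> 'k) \<Rightarrow> nat \<Rightarrow> 'k"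

definition is_qmod :: "'k::field qmod \<Rightarrow> bool" where
  "is_qmod N \<longleftrightarrow>
     (\<forall>x. vec_space (fib N x)) \<and>
     (\<forall>x y. y \<le> x \<longrightarrow> lin_map (fib N x) (fib N y) (tr N x y)) \<and>
     (\<forall>x. \<forall>v\<in>fib N x. tr N x x v = v) \<and>
     (\<forall>x y z. z \<le> y \<longrightarrow> y \<le> x \<longrightarrow> (\<forall>v\<in>fib N x. tr N y z (tr N x y v) = tr N x z v))"

definition qmod_hom ::
    "'k::field qmod \<Rightarrow> 'k qmod \<Rightarrow> (real \<Rightarrow> (nat \<Rightarrow> 'k) \<Rightarrow> nat \<Rightarrow> 'k) \<Rightarrow> bool" where
  "qmod_hom N N' g \<longleftrightarrow>
     (\<forall>x. lin_map (fib N x) (fib N' x) (g x)) \<and>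
     (\<forall>x y. y \<le> x \<longrightarrow> (\<forall>v\<in>fib N x. g y (tr N x y v) = tr N' x y (g x v)))"

text \<open>
  The direct sum of the modules \<open>M_{I i}\<close> over \<open>i < n\<close>; coordinate \<open>i\<close> carries the
  \<open>i\<close>-th summand.
\<close>

definition interval_sum :: "nat \<Rightarrow> (nat \<Rightarrow> real set) \<Rightarrow> 'k::field qmod" where
  "interval_sum n I =
     \<lparr> fib = (\<lambda>x. {v. \<forall>i. v i \<noteq> 0 \<longrightarrow> i < n \<and> x \<in> I i}),
       tr = (\<lambda>x y v i. if i < n \<and> x \<in> I i \<and> y \<in> I i \<and> y \<le> x then v i else 0) \<rparr>"

definition M_mod :: "real set \<Rightarrow> 'k::field qmod" where
  "M_mod I = interval_sum 1 (\<lambda>_. I)"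

definition P_sum :: "nat \<Rightarrow> (nat \<Rightarrow> real) \<Rightarrow> 'k::field qmod" where
  "P_sum n a = interval_sum n (\<lambda>i. {..a i})"

text \<open>Monomorphisms and cokernels of representations are the pointwise ones.\<close>

definition representable :: "'k::field qmod \<Rightarrow> bool" where
  "representable N \<longleftrightarrow> is_qmod N \<and>
     (\<exists>m a n b g q.
        qmod_hom (P_sum m a) (P_sum n b) g \<and>
        (\<forall>x. inj_on (g x) (fib (P_sum m a :: 'k qmod) x)) \<and>
        qmod_hom (P_sum n b) N q \<and>
        (\<forall>x. q x ` fib (P_sum n b) x = fib N x) \<and>
        (\<forall>x. {v \<in> fib (P_sum n b) x. q x v = (\<lambda>_. 0)} = g x ` fib (P_sum m a) x))"

definition submodule :: "'k::field qmod \<Rightarrow> (real \<Rightarrow> (nat \<Rightarrow> 'k) set) \<Rightarrow> bool" where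
  "submodule N U \<longleftrightarrow>
     (\<forall>x. vec_subspace (U x) \<and> U x \<subseteq> fib N x) \<and>
     (\<forall>x y. y \<le> x \<longrightarrow> tr N x y ` U x \<subseteq> U y)"

definition indecomposable :: "'k::field qmod \<Rightarrow> bool" where
  "indecomposable N \<longleftrightarrow> (\<exists>x. fib N x \<noteq> {\<lambda>_. 0}) \<and>
     (\<forall>U W. submodule N U \<and> submodule N W \<and>
        (\<forall>x. fib N x = {\<lambda>i. u i + w i | u w. u \<in> U x \<and> w \<in> W x} \<and> U x \<inter> W x = {\<lambda>_. 0})
        \<longrightarrow> (\<forall>x. U x = {\<lambda>_. 0}) \<or> (\<forall>x. W x = {\<lambda>_. 0}))"

definition ivl :: "ereal \<Rightarrow> ereal \<Rightarrow> real set" where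
  "ivl a b = {x. a < ereal x \<and> ereal x \<le> b}"

text \<open>One representative \<open>M_I\<close>, with \<open>I = (a,b]\<close>, per isomorphism class.\<close>

definition Ind_r :: "'k::field qmod set" where
  "Ind_r = {N. representable N \<and> indecomposable N \<and>
              (\<exists>a b. a < b \<and> b < \<infinity> \<and> N = M_mod (ivl a b))}"

lemma M_mod_in_Ind_r:
  assumes "a < b" "b < \<infinity>"
  shows "(M_mod (ivl a b) :: 'k::field qmod) \<in> Ind_r"
proof -
  let ?I = "ivl a b"
  let ?N = "M_mod ?I :: 'k qmod"
  obtain b' where b: "b = ereal b'" using assms by (cases b) auto
  have fibN: "fib ?N x = {v. \<forall>i. v i \<noteq> 0 \<longrightarrow> i = 0 \<and> x \<in> ?I}" for x
    by (simp add: M_mod_def interval_sum_def)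
  have trN: "tr ?N x y v = (\<lambda>i. if i = 0 \<and> x \<in> ?I \<and> y \<in> ?I \<and> y \<le> x then v i else 0)" for x y v
    by (simp add: M_mod_def interval_sum_def fun_eq_iff)
  have conv: "y \<in> ?I" if "z \<in> ?I" "x \<in> ?I" "z \<le> y" "y \<le> x" for x y z
    using that by (auto simp: ivl_def) (meson ereal_less_eq(3) less_le_trans order_trans)+
  have lc: "s \<noteq> 0 \<or> t \<noteq> 0" if "c * s + t \<noteq> 0" for c s t :: 'k
    using that by auto
  have mod: "is_qmod ?N"
    unfolding is_qmod_def vec_space_def vec_subspace_def lin_map_def
  proof (intro conjI allI ballI impI)
    fix x show "\<exists>n. \<forall>v\<in>fib ?N x. \<forall>i\<ge>n. v i = 0" by (rule exI[of _ 1]) (auto simp: fibN)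
  next
    fix x y z v assume "z \<le> y" "y \<le> x" "v \<in> fib ?N x"
    then show "tr ?N y z (tr ?N x y v) = tr ?N x z v"
      using conv[of z x y] by (auto simp: trN fun_eq_iff)
  qed (auto simp: fibN trN fun_eq_iff dest!: lc)
  have rep: "representable ?N"
  proof -
    note One_nat_def[simp del]
    define m where "m = (if a = -\<infinity> then 0 else 1::nat)"
    define a' where "a' = real_of_ereal a"
    have I: "x \<in> ?I \<longleftrightarrow> x \<le> b' \<and> \<not> (m = 1 \<and> x \<le> a')" for x
      using assms b by (cases a) (auto simp: ivl_def m_def a'_def)
    have m: "m = 0 \<or> m = 1" by (auto simp: m_def)
    have ab: "m = 1 \<Longrightarrow> a' < b'" using assms b by (cases a) (auto simp: m_def a'_def)
    have fm: "fib (P_sum m (\<lambda>_. a') :: 'k qmod) x = {v. \<forall>i. v i \<noteq> 0 \<longrightarrow> i < m \<and> x \<le> a'}" for x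
      by (simp add: P_sum_def interval_sum_def)
    have fb: "fib (P_sum 1 (\<lambda>_. b') :: 'k qmod) x = {v. \<forall>i. v i \<noteq> 0 \<longrightarrow> i = 0 \<and> x \<le> b'}" for x
      by (simp add: P_sum_def interval_sum_def)
    have tm: "tr (P_sum m (\<lambda>_. a') :: 'k qmod) x y v =
        (\<lambda>i. if i < m \<and> x \<le> a' \<and> y \<le> a' \<and> y \<le> x then v i else 0)" for x y v
      by (simp add: P_sum_def interval_sum_def)
    have tb: "tr (P_sum 1 (\<lambda>_. b') :: 'k qmod) x y v =
        (\<lambda>i. if i = 0 \<and> x \<le> b' \<and> y \<le> b' \<and> y \<le> x then v i else 0)" for x y v
      by (simp add: P_sum_def interval_sum_def fun_eq_iff)
    define q where "q = (\<lambda>x (v::nat\<Rightarrow>'k) i. if x \<in> ?I then v i else 0)"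
    have sub: "v i \<noteq> 0 \<longrightarrow> i = 0 \<and> x \<le> b'" if "\<forall>i. v i \<noteq> 0 \<longrightarrow> i < m \<and> x \<le> a'" for v :: "nat\<Rightarrow>'k" and i x
      using that m ab by force
    have 1: "qmod_hom (P_sum m (\<lambda>_. a')) (P_sum 1 (\<lambda>_. b')) (\<lambda>x v. (v :: nat\<Rightarrow>'k))"
      unfolding qmod_hom_def lin_map_def
    proof (intro conjI allI ballI impI)
      fix x y and v :: "nat\<Rightarrow>'k" assume yx: "y \<le> x" and v: "v \<in> fib (P_sum m (\<lambda>_. a')) x"
      have "v i = 0 \<or> i < m \<and> x \<le> a' \<and> i = 0 \<and> x \<le> b'" for i using v sub[of v x i] by (auto simp: fm)
      then show "tr (P_sum m (\<lambda>_. a')) x y v = tr (P_sum 1 (\<lambda>_. b')) x y v"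
        using yx unfolding tm tb fun_eq_iff by (smt (verit))
    qed (use sub in \<open>auto simp: fm fb dest!: lc\<close>)
    have 2: "qmod_hom (P_sum 1 (\<lambda>_. b')) ?N q"
      unfolding qmod_hom_def lin_map_def
    proof (intro conjI allI ballI impI)
      fix x y and v :: "nat\<Rightarrow>'k" assume yx: "y \<le> x" and v: "v \<in> fib (P_sum 1 (\<lambda>_. b')) x"
      show "q y (tr (P_sum 1 (\<lambda>_. b')) x y v) = tr ?N x y (q x v)"
        using yx v by (auto simp: tb trN q_def fun_eq_iff I fb)
    qed (auto simp: fibN fb q_def)
    have 3: "q x ` fib (P_sum 1 (\<lambda>_. b')) x = fib ?N x" for x
    proof
      show "fib ?N x \<subseteq> q x ` fib (P_sum 1 (\<lambda>_. b')) x"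
      proof
        fix v assume v: "v \<in> fib ?N x"
        then have "v = q x v" "v \<in> fib (P_sum 1 (\<lambda>_. b')) x"
          using I by (auto simp: fibN fb q_def fun_eq_iff)
        then show "v \<in> q x ` fib (P_sum 1 (\<lambda>_. b')) x" by blast
      qed
    qed (auto simp: fibN fb q_def split: if_splits)
    have 4: "{v \<in> fib (P_sum 1 (\<lambda>_. b')) x. q x v = (\<lambda>_. 0)}
        = (\<lambda>v. v) ` fib (P_sum m (\<lambda>_. a') :: 'k qmod) x" for x
    proof -
      have "v \<in> fib (P_sum 1 (\<lambda>_. b')) x \<and> q x v = (\<lambda>_. 0) \<longleftrightarrow> v \<in> fib (P_sum m (\<lambda>_. a') :: 'k qmod) x" for v
      proof (cases "x \<in> ?I")
        case True
        then have "\<not> (m = 1 \<and> x \<le> a')" using I by blast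
        with m True show ?thesis by (auto simp: fb fm q_def fun_eq_iff)
      next
        case False
        then have "x \<le> b' \<Longrightarrow> m = 1 \<and> x \<le> a'" using I by blast
        with m ab False show ?thesis by (auto simp: fb fm q_def fun_eq_iff) 
      qed
      then show ?thesis by auto
    qed
    show ?thesis unfolding representable_def
      by (intro conjI mod exI[of _ m] exI[of _ "\<lambda>_. a'"] exI[of _ "1::nat"] exI[of _ "\<lambda>_. b'"]
           exI[of _ "\<lambda>x v. v"] exI[of _ q] allI 1 2 3 4) (auto simp: inj_on_def)
  qed
  have ind: "indecomposable ?N" unfolding indecomposable_def
  proof (intro conjI allI impI)
    have "b' \<in> ?I" using assms b by (simp add: ivl_def)
    then have "(\<lambda>i. if i = 0 then 1 else 0) \<in> fib ?N b'" by (simp add: fibN)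
    moreover have "(\<lambda>i::nat. if i = 0 then 1 else 0::'k) \<noteq> (\<lambda>_. 0)" by (metis one_neq_zero)
    ultimately show "\<exists>x. fib ?N x \<noteq> {\<lambda>_. 0}" by blast
  next
    fix U W :: "real \<Rightarrow> (nat \<Rightarrow> 'k) set"
    assume H: "submodule ?N U \<and> submodule ?N W \<and>
      (\<forall>x. fib ?N x = {\<lambda>i. u i + w i |u w. u \<in> U x \<and> w \<in> W x} \<and> U x \<inter> W x = {\<lambda>_. 0})"
    have full: "S x = fib ?N x \<and> x \<in> ?I" if S: "submodule ?N S" and v: "v \<in> S x" "v \<noteq> (\<lambda>_. 0)" for S x v
    proof -
      have vs: "vec_subspace (S x)" and sub: "S x \<subseteq> fib ?N x" using S by (auto simp: submodule_def)
      obtain i where "v i \<noteq> 0" using v by auto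
      moreover have vf: "v \<in> fib ?N x" using v sub by auto
      ultimately have x: "x \<in> ?I" and v0: "v 0 \<noteq> 0" by (auto simp: fibN)
      have "w \<in> S x" if w: "w \<in> fib ?N x" for w
      proof -
        have S: "(\<lambda>i. (w 0 / v 0) * v i + 0) \<in> S x"
          using vs[unfolded vec_subspace_def, THEN conjunct2, rule_format,
            of v "\<lambda>_. 0" "w 0 / v 0"] vs v(1) by (simp add: vec_subspace_def)
        have "w i = (w 0 / v 0) * v i + 0" for i
        proof (cases "i = 0")
          case False
          then have "w i = 0" "v i = 0" using w vf by (auto simp: fibN)
          then show ?thesis by simp
        qed (use v0 in simp)
        then have "w = (\<lambda>i. (w 0 / v 0) * v i + 0)" by (rule ext)
        then show ?thesis by (rule ssubst) (rule S)
      qed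
      with sub x show ?thesis by blast
    qed
    have key: False if S: "submodule ?N S" and T: "submodule ?N T"
        and int: "\<And>x. S x \<inter> T x = {\<lambda>_. 0}" and le: "x \<le> y"
        and u: "u \<in> S x" "u \<noteq> (\<lambda>_. 0)" and w: "w \<in> T y" "w \<noteq> (\<lambda>_. 0)" for S T x y u w
    proof -
      have x: "S x = fib ?N x" "x \<in> ?I" and y: "T y = fib ?N y" "y \<in> ?I" using full S T u w by metis+
      have uf: "u \<in> fib ?N x" using x u by simp
      then have uy: "u \<in> T y" using y x by (auto simp: fibN)
      have "tr ?N y x u \<in> T x" using T le uy unfolding submodule_def by blast
      moreover have "tr ?N y x u = u" using uf x y le by (auto simp: trN fibN fun_eq_iff)
      ultimately show False using int[of x] u by auto
    qed
    show "(\<forall>x. U x = {\<lambda>_. 0}) \<or> (\<forall>x. W x = {\<lambda>_. 0})"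
    proof (rule ccontr)
      assume "\<not> ?thesis"
      then obtain x y where xy: "U x \<noteq> {\<lambda>_. 0}" "W y \<noteq> {\<lambda>_. 0}" by blast
      have "(\<lambda>_. 0) \<in> U x" "(\<lambda>_. 0) \<in> W y" using H by (auto simp: submodule_def vec_subspace_def)
      then obtain u w where u: "u \<in> U x" "u \<noteq> (\<lambda>_. 0)" and w: "w \<in> W y" "w \<noteq> (\<lambda>_. 0)" using xy by blast
      show False
      proof (cases "x \<le> y")
        case True show False by (rule key[of U W, OF _ _ _ True u w]) (use H in auto)
      next
        case False then have "y \<le> x" by simp
        show False by (rule key[of W U, OF _ _ _ \<open>y \<le> x\<close> w u]) (use H in auto)
      qed
    qed
  qed
  show ?thesis unfolding Ind_r_def using rep ind assms by blast
qed


section \<open>Useful functions\<close>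

text \<open>
  A useful function is given by the data of its decomposition; \<open>up D (-\<infinity>)\<close> is not determined
  by the function on \<open>\<real>\<close> alone.  The coefficients that do not exist, \<open>um D (-\<infinity>)\<close>
  and \<open>up D \<infinity>\<close>, are set to 0.
\<close>

record useful_data =
  cpart :: "real \<Rightarrow> real"
  um :: "ereal \<Rightarrow> real"
  up :: "ereal \<Rightarrow> real"

definition delta_minus :: "ereal \<Rightarrow> real \<Rightarrow> real" where
  "delta_minus x z = (if ereal z < x then 0 else 1)"

definition delta_plus :: "ereal \<Rightarrow> real \<Rightarrow> real" where
  "delta_plus x z = (if ereal z \<le> x then 0 else 1)"

definition bounded_variation :: "(real \<Rightarrow> real) \<Rightarrow> bool" where
  "bounded_variation f \<longleftrightarrow>
     (\<exists>C. \<forall>t :: nat \<Rightarrow> real. \<forall>n. mono t \<longrightarrow> (\<Sum>i<n. \<bar>f (t (Suc i)) - f (t i)\<bar>) \<le> C)"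

definition useful :: "useful_data \<Rightarrow> bool" where
  "useful D \<longleftrightarrow>
     continuous_on UNIV (cpart D) \<and> bounded_variation (cpart D) \<and>
     um D (-\<infinity>) = 0 \<and> up D \<infinity> = 0 \<and>
     (\<lambda>x. \<bar>um D x\<bar>) summable_on {x. x \<noteq> -\<infinity>} \<and>
     (\<lambda>x. \<bar>up D x\<bar>) summable_on {x. x \<noteq> \<infinity>}"

definition uf_val :: "useful_data \<Rightarrow> real \<Rightarrow> real" where
  "uf_val D z = cpart D z
     + (\<Sum>\<^sub>\<infinity>x\<in>{x. x \<noteq> -\<infinity>}. um D x * delta_minus x z)
     + (\<Sum>\<^sub>\<infinity>x\<in>{x. x \<noteq> \<infinity>}. up D x * delta_plus x z)"

definition uf_ext :: "useful_data \<Rightarrow> ereal \<Rightarrow> real" where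
  "uf_ext D x =
     (if x = -\<infinity> then Lim at_bot (uf_val D) - up D (-\<infinity>)
      else if x = \<infinity> then Lim at_top (uf_val D) + um D \<infinity>
      else uf_val D (real_of_ereal x))"

definition side_values :: "useful_data \<Rightarrow> ereal \<Rightarrow> real set" where
  "side_values D x =
     (if x = -\<infinity> then {uf_ext D x, Lim at_bot (uf_val D)}
      else if x = \<infinity> then {uf_ext D x, Lim at_top (uf_val D)}
      else {uf_ext D x, Lim (at_left (real_of_ereal x)) (uf_val D),
            Lim (at_right (real_of_ereal x)) (uf_val D)})"

definition uf_min :: "useful_data \<Rightarrow> ereal \<Rightarrow> real" where
  "uf_min D x = Min (side_values D x)"

definition uf_max :: "useful_data \<Rightarrow> ereal \<Rightarrow> real" where
  "uf_max D x = Max (side_values D x)"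

definition graph_bar :: "useful_data \<Rightarrow> (ereal \<times> real) set" where
  "graph_bar D = {(x, y). uf_min D x \<le> y \<and> y \<le> uf_max D x}"

definition graph :: "useful_data \<Rightarrow> (ereal \<times> real) set" where
  "graph D = {(ereal x, y) | x y. uf_min D (ereal x) \<le> y \<and> y \<le> uf_max D (ereal x)}"


section \<open>Stability conditions\<close>

definition red_blue_pair :: "useful_data \<times> useful_data \<Rightarrow> bool" where
  "red_blue_pair = (\<lambda>(R, B).
     useful R \<and> useful B \<and>
     (\<forall>x::real. uf_max R (ereal x) = uf_val R x \<and> uf_min B (ereal x) = uf_val B x) \<and>
     um R \<infinity> = 0 \<and> um B \<infinity> = 0 \<and>
     (\<forall>x::ereal. uf_ext R x \<le> uf_max B x \<and> uf_min R x \<le> uf_ext B x) \<and>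
     uf_ext R (-\<infinity>) = uf_ext B (-\<infinity>) \<and> uf_ext R \<infinity> = uf_ext B \<infinity> \<and>
     (\<exists>c. \<forall>x. cpart B x = c) \<and>
     (\<forall>x::real. um B (ereal x) = 0 \<and> up B (ereal x) = 0) \<and> up B (-\<infinity>) = 0)"

definition vtrans :: "real \<Rightarrow> ereal \<times> real \<Rightarrow> ereal \<times> real" where
  "vtrans c = (\<lambda>(x, y). (x, y + c))"

definition rb_rel :: "((useful_data \<times> useful_data) \<times> (useful_data \<times> useful_data)) set" where
  "rb_rel = {((R, B), (R', B')). red_blue_pair (R, B) \<and> red_blue_pair (R', B') \<and>
     (\<exists>c. vtrans c ` graph_bar R = graph_bar R' \<and> vtrans c ` graph_bar B = graph_bar B')}"

definition stability_conditions :: "(useful_data \<times> useful_data) set set" where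
  "stability_conditions = {p. red_blue_pair p} // rb_rel"

text \<open>
  \<open>Q^ = {-\<infinity>_+} \<union> \<real>\<close> is encoded as \<open>{x :: ereal. x \<noteq> \<infinity>}\<close>, with \<open>-\<infinity>\<close> in the role
  of \<open>-\<infinity>_+\<close>.  So for \<open>I = (a,b]\<close> the set \<open>I^\<close> is \<open>{a..b}\<close>.
\<close>

definition mod_graph :: "useful_data \<times> useful_data \<Rightarrow> (ereal \<times> real) set" where
  "mod_graph = (\<lambda>(R, B). graph R \<union> {(-\<infinity>, y) | y. (-\<infinity>, y) \<in> graph_bar R})"

definition semistable_at :: "useful_data \<times> useful_data \<Rightarrow> ereal \<Rightarrow> ereal \<Rightarrow> real \<Rightarrow> bool" where
  "semistable_at p a b h \<longleftrightarrow>
     (a, h) \<in> mod_graph p \<and> (b, h) \<in> mod_graph p \<and>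
     (\<forall>x\<in>{a..b} - {a, b}. uf_max (fst p) x \<le> h \<and> h \<le> uf_min (snd p) x)"

text \<open>Semistability is invariant under \<open>rb_rel\<close>, so any representative may be used.\<close>

definition semistable_modules :: "(useful_data \<times> useful_data) set \<Rightarrow> 'k::field qmod set" where
  "semistable_modules \<sigma> =
     {N \<in> Ind_r. \<exists>a b. a < b \<and> b < \<infinity> \<and> N = M_mod (ivl a b) \<and>
                   (\<exists>p\<in>\<sigma>. \<exists>h. semistable_at p a b h)}"

text \<open>
  All \<open>M_mod (ivl a b)\<close> with \<open>a < b < \<infinity>\<close> lie in \<open>Ind_r\<close> by \<open>M_mod_in_Ind_r\<close>, so the quantification
  over semistable modules is written over \<open>a\<close> and \<open>b\<close>, which avoids a dependence on \<open>'k\<close>.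
\<close>

definition four_point_condition :: "(useful_data \<times> useful_data) set \<Rightarrow> bool" where
  "four_point_condition \<sigma> \<longleftrightarrow>
     (\<forall>p\<in>\<sigma>. \<forall>a b h. a < b \<and> b < \<infinity> \<and> semistable_at p a b h \<longrightarrow>
        finite (({a..b} \<times> {h}) \<inter> mod_graph p) \<and> card (({a..b} \<times> {h}) \<inter> mod_graph p) \<le> 3)"

definition stability_fpc :: "(useful_data \<times> useful_data) set set" where
  "stability_fpc = {\<sigma> \<in> stability_conditions. four_point_condition \<sigma>}"


section \<open>Measured laminations\<close>

text \<open>A geodesic of the Poincare disk is represented by its pair of endpoints.\<close>

definition geodesics :: "complex set set" where
  "geodesics = {{p, q} | p q. norm p = 1 \<and> norm q = 1 \<and> p \<noteq> q}"

text \<open>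
  The points of a geodesic: the part inside the disk of the circle through \<open>p\<close> and \<open>q\<close> which is
  orthogonal to the unit circle.  For \<open>n\<close> normal to \<open>p - q\<close> and \<open>p \<bullet> n \<noteq> 0\<close> this circle has
  centre \<open>n / (p \<bullet> n)\<close>; for \<open>q = - p\<close> it degenerates to a diameter.
\<close>

definition geodesic_points :: "complex set \<Rightarrow> complex set" where
  "geodesic_points \<gamma> = {z. norm z < 1 \<and>
     (\<exists>p q. \<gamma> = {p, q} \<and> p \<noteq> q \<and>
        (1 + (norm z)\<^sup>2) * (p \<bullet> (\<i> * (p - q))) = 2 * (z \<bullet> (\<i> * (p - q))))}"

definition crossing :: "complex set \<Rightarrow> complex set \<Rightarrow> bool" where
  "crossing \<gamma> \<delta> \<longleftrightarrow> \<gamma> \<noteq> \<delta> \<and> geodesic_points \<gamma> \<inter> geodesic_points \<delta> \<noteq> {}"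

definition noncrossing_set :: "complex set set \<Rightarrow> bool" where
  "noncrossing_set L \<longleftrightarrow> L \<subseteq> geodesics \<and> (\<forall>\<gamma>\<in>L. \<forall>\<delta>\<in>L. \<not> crossing \<gamma> \<delta>)"

definition lamination :: "complex set set \<Rightarrow> bool" where
  "lamination L \<longleftrightarrow> noncrossing_set L \<and> (\<forall>L'. noncrossing_set L' \<and> L \<subseteq> L' \<longrightarrow> L' = L)"

definition open_arc :: "complex set \<Rightarrow> bool" where
  "open_arc A \<longleftrightarrow> openin (top_of_set (sphere 0 1)) A \<and> connected A"

definition O_set :: "complex set set \<Rightarrow> complex set \<Rightarrow> complex set \<Rightarrow> complex set set" where
  "O_set L A B = {\<gamma>\<in>L. \<exists>p q. \<gamma> = {p, q} \<and> p \<in> A \<and> q \<in> B}"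

definition lam_topology :: "complex set set \<Rightarrow> complex set topology" where
  "lam_topology L = topology_generated_by {O_set L A B | A B. open_arc A \<and> open_arc B}"

definition measured_laminations :: "(complex set set \<times> complex set measure) set" where
  "measured_laminations = {(L, M). lamination L \<and>
     space M = L \<and> sets M = sigma_sets L {U. openin (lam_topology L) U} \<and>
     (\<forall>A B. open_arc A \<and> open_arc B \<and> O_set L A B \<noteq> {} \<longrightarrow>
        0 < emeasure M (O_set L A B) \<and> emeasure M (O_set L A B) < \<infinity>)}"


section \<open>The stability condition of a measured lamination\<close>

text \<open>The index set \<open>\<real> \<union> {-\<infinity>}\<close> of the boundary circle is \<open>{x :: ereal. x \<noteq> \<infinity>}\<close>.\<close>

definition bdry_pt :: "ereal \<Rightarrow> complex" where
  "bdry_pt x = (if x = -\<infinity> then -1 else exp (2 * \<i> * of_real (arctan (real_of_ereal x))))"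

definition bdry_index :: "complex \<Rightarrow> ereal" where
  "bdry_index = inv_into {x. x \<noteq> \<infinity>} bdry_pt"

definition lo :: "complex set \<Rightarrow> ereal" where
  "lo \<gamma> = Min (bdry_index ` \<gamma>)"

definition hi :: "complex set \<Rightarrow> ereal" where
  "hi \<gamma> = Max (bdry_index ` \<gamma>)"

definition lam_fun :: "complex set set \<times> complex set measure \<Rightarrow> real \<Rightarrow> real" where
  "lam_fun = (\<lambda>(L, M) a. - measure M {\<gamma>\<in>L. lo \<gamma> < ereal a \<and> ereal a < hi \<gamma>})"

definition lam_um :: "complex set set \<times> complex set measure \<Rightarrow> ereal \<Rightarrow> real" where
  "lam_um = (\<lambda>(L, M) a. if a = \<infinity> \<or> a = -\<infinity> then 0 else measure M {\<gamma>\<in>L. hi \<gamma> = a})"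

definition lam_up :: "complex set set \<times> complex set measure \<Rightarrow> ereal \<Rightarrow> real" where
  "lam_up = (\<lambda>(L, M) a. if a = \<infinity> then 0 else - measure M {\<gamma>\<in>L. lo \<gamma> = a})"

definition lam_useful :: "complex set set \<times> complex set measure \<Rightarrow> useful_data" where
  "lam_useful \<Lambda> =
     \<lparr> cpart = (\<lambda>a. lam_fun \<Lambda> a - (\<Sum>\<^sub>\<infinity>x\<in>{x. x \<le> ereal a}. lam_um \<Lambda> x)
                               - (\<Sum>\<^sub>\<infinity>x\<in>{x. x < ereal a}. lam_up \<Lambda> x)),
       um = lam_um \<Lambda>, up = lam_up \<Lambda> \<rparr>"

lemma uf_val_lam_useful: "uf_val (lam_useful \<Lambda>) a = lam_fun \<Lambda> a"
proof -
  have um0: "lam_um \<Lambda> (-\<infinity>) = 0" by (simp add: lam_um_def split: prod.splits)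
  have "(\<Sum>\<^sub>\<infinity>x\<in>{x. x \<noteq> -\<infinity>}. lam_um \<Lambda> x * delta_minus x a) = (\<Sum>\<^sub>\<infinity>x\<in>{x. x \<le> ereal a}. lam_um \<Lambda> x)"
    by (rule infsum_cong_neutral) (use um0 in \<open>auto simp: delta_minus_def\<close>)
  moreover have "(\<Sum>\<^sub>\<infinity>x\<in>{x. x \<noteq> \<infinity>}. lam_up \<Lambda> x * delta_plus x a) = (\<Sum>\<^sub>\<infinity>x\<in>{x. x < ereal a}. lam_up \<Lambda> x)"
    by (rule infsum_cong_neutral) (auto simp: delta_plus_def)
  ultimately show ?thesis by (simp add: uf_val_def lam_useful_def)
qed

definition zero_useful :: useful_data where
  "zero_useful = \<lparr> cpart = (\<lambda>_. 0), um = (\<lambda>_. 0), up = (\<lambda>_. 0) \<rparr>"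

definition Phi :: "complex set set \<times> complex set measure \<Rightarrow> (useful_data \<times> useful_data) set" where
  "Phi \<Lambda> = rb_rel `` {(lam_useful \<Lambda>, zero_useful)}"

end

theory Submission
  imports Defs
begin

text \<open>
  Index the boundary circle by \<open>{-\<infinity>} \<union> \<real>\<close>, so that a geodesic becomes a pair \<open>a < b\<close>.  A red-blue
  pair \<open>(R, B)\<close> with constant \<open>B\<close> is turned upside down: the function \<open>g = B - R\<close> is nonnegative,
  lower semicontinuous, of bounded variation and vanishes at \<open>\<infinity>\<close>, and it is a complete invariant
  of the stability condition (\<open>rb_rel_iff\<close>).  A module \<open>M_I\<close> with \<open>I = (a, b]\<close> is semistable exactly
  if some horizontal segment from \<open>a\<close> to \<open>b\<close> fits under the graph of \<open>g\<close> and meets it at the two ends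
  (\<open>semistable_at_iff\<close>).  This is the coding of a tree, and of a lamination of the disk, by an
  excursion \<open>g\<close>: two points are joined if \<open>g\<close>, with its jumps filled in, takes a common value there and
  is not smaller in between.

  From laminations to functions.  For a measured lamination \<open>g(x)\<close> is the mass of the leaves over \<open>x\<close>.
  This equals \<open>M{lo < x} - M{hi \<le> x}\<close>, a difference of two distribution functions of finite measures,
  which gives bounded variation, the jumps and the limits (\<open>red_blue_pair_lam_useful\<close>).  The link
  between leaves and heights is \<open>valley\<close>: the infimum of \<open>g\<close> on \<open>[x, y]\<close> is the mass of
  the leaves that pass over all of \<open>[x, y]\<close>.  It shows that a leaf crossing a semistable chord would
  have a neighbourhood of measure zero; by maximality the semistable chords are therefore exactly the
  leaves (\<open>leaf_iff_fits\<close>).  Four points at one level of a semistable chord would produce two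
  crossing leaves, whence the four point condition.  The function \<open>g\<close> determines the leaves, and by
  \<open>valley\<close> also the mass of the sets of leaves over intervals, which generate the Borel sets:
  the map is injective.

  From functions to laminations.  Given \<open>g\<close>, take as leaves all chords that fit under its graph.  Two
  crossing ones would have the same height and together violate the four point condition; a chord
  that does not fit is crossed by a connected component of some \<open>{g > h}\<close>, so the set is maximal.  The
  measure counts heights: each \<open>h > 0\<close> contributes one leaf for each component of \<open>{g > h}\<close>.  Over
  \<open>x\<close> there is one such component for each \<open>h < g(x)\<close>, so \<open>g\<close> is recovered (\<open>emeasure_straddle\<close>).  The
  total mass is finite because \<open>g\<close> has bounded variation.  Each leaf is a limit of components from the
  inside or, if its chord touches the graph in between, from the outside by the four point condition;
  so every neighbourhood has positive mass (\<open>emeasure_O_set_pos\<close>).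
\<close>

section \<open>The boundary circle\<close>

text \<open>
  The index \<open>-\<infinity>\<close> sits at the cut \<open>-\<pi>\<close>, so the indices other than \<open>\<infinity>\<close> correspond to \<open>[-\<pi>, \<pi>)\<close>.
\<close>

definition angle :: "ereal \<Rightarrow> real" where
  "angle x = (if x = -\<infinity> then - pi else 2 * arctan (real_of_ereal x))"

lemma bdry_pt_eq_cis: "bdry_pt x = cis (angle x)"
proof (cases "x = -\<infinity>")
  case True then show ?thesis by (simp add: bdry_pt_def angle_def cis_conv_exp flip: exp_pi_i)
      (simp add: exp_minus)
qed (simp add: bdry_pt_def angle_def cis_conv_exp mult_ac)

lemma angle_range:
  assumes "x \<noteq> \<infinity>" shows "- pi \<le> angle x" "angle x < pi"
  using arctan_lbound[of "real_of_ereal x"] arctan_ubound[of "real_of_ereal x"]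
  by (auto simp: angle_def)

lemma angle_less_iff:
  assumes "x \<noteq> \<infinity>" "y \<noteq> \<infinity>" shows "angle x < angle y \<longleftrightarrow> x < y"
proof -
  have "- pi < 2 * arctan t" for t using arctan_lbound[of t] by simp
  then show ?thesis using assms
    by (cases x; cases y) (auto simp: angle_def not_less less_imp_le arctan_less_iff)
qed

lemma angle_eq_iff:
  assumes "x \<noteq> \<infinity>" "y \<noteq> \<infinity>" shows "angle x = angle y \<longleftrightarrow> x = y"
  using angle_less_iff[OF assms] angle_less_iff[OF assms(2,1)] by (metis neq_iff)

lemma angle_surj:
  assumes "- pi \<le> t" "t < pi" obtains x where "x \<noteq> \<infinity>" "angle x = t"
proof (cases "t = - pi")
  case True then show ?thesis using that[of "-\<infinity>"] by (simp add: angle_def)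
next
  case False
  then have "arctan (tan (t / 2)) = t / 2" using assms by (intro arctan_tan) auto
  then show ?thesis using that[of "ereal (tan (t / 2))"] by (simp add: angle_def)
qed

lemma cis_eq_iff:
  assumes "\<bar>s - t\<bar> < 2 * pi" shows "cis s = cis t \<longleftrightarrow> s = t"
proof
  assume "cis s = cis t"
  then have "cis (s - t) = 1" by (simp add: cis_divide[symmetric])
  then have "cos (s - t) = 1" by (simp add: complex_eq_iff)
  then obtain n :: int where n: "s - t = n * (2 * pi)" using cos_one_2pi_int[of "s - t"] by auto
  then have "\<bar>real_of_int n\<bar> < 1" using assms by (simp add: abs_mult)
  then have "n = 0" by linarith
  then show "s = t" using n by simp
qed simp

lemma norm_bdry_pt [simp]: "norm (bdry_pt x) = 1" by (simp add: bdry_pt_eq_cis)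

lemma inj_on_bdry_pt: "inj_on bdry_pt {x. x \<noteq> \<infinity>}"
proof (rule inj_onI, unfold mem_Collect_eq)
  fix x y assume *: "x \<noteq> \<infinity>" "y \<noteq> \<infinity>" "bdry_pt x = bdry_pt y"
  have "\<bar>angle x - angle y\<bar> < 2 * pi" using angle_range * by (smt (verit))
  then show "x = y" using cis_eq_iff *(3) angle_eq_iff[OF *(1,2)] by (simp add: bdry_pt_eq_cis)
qed

lemma bdry_pt_eq_iff: "x \<noteq> \<infinity> \<Longrightarrow> y \<noteq> \<infinity> \<Longrightarrow> bdry_pt x = bdry_pt y \<longleftrightarrow> x = y"
  using inj_on_bdry_pt by (auto simp: inj_on_def)

lemma bdry_pt_surj:
  assumes "norm p = 1" obtains x where "x \<noteq> \<infinity>" "bdry_pt x = p"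
proof -
  obtain t where t: "- pi < t" "t \<le> pi" "p = cis t"
    using Arg_bounded[of p] cis_Arg[of p] assms by (metis norm_zero sgn_eq zero_neq_one div_by_1 of_real_1)
  show ?thesis
  proof (cases "t = pi")
    case True
    then have "bdry_pt (-\<infinity>) = p" using t(3) by (simp add: bdry_pt_def)
    then show ?thesis using that[of "-\<infinity>"] by simp
  next
    case False
    then have "- pi \<le> t" "t < pi" using t by linarith+
    then obtain x where "x \<noteq> \<infinity>" "angle x = t" using angle_surj by metis
    then show ?thesis using that t by (simp add: bdry_pt_eq_cis)
  qed
qed

lemma bdry_index_bdry_pt [simp]: "x \<noteq> \<infinity> \<Longrightarrow> bdry_index (bdry_pt x) = x"
  unfolding bdry_index_def by (simp add: inj_on_bdry_pt)

definition chord :: "ereal \<Rightarrow> ereal \<Rightarrow> complex set" where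
  "chord a b = {bdry_pt a, bdry_pt b}"

lemma lo_chord [simp]: "a < b \<Longrightarrow> b < \<infinity> \<Longrightarrow> lo (chord a b) = a"
  and hi_chord [simp]: "a < b \<Longrightarrow> b < \<infinity> \<Longrightarrow> hi (chord a b) = b"
proof -
  assume *: "a < b" "b < \<infinity>"
  then have "a \<noteq> \<infinity>" "b \<noteq> \<infinity>" by auto
  with * show "lo (chord a b) = a" "hi (chord a b) = b"
    by (auto simp: lo_def hi_def chord_def min_def max_def)
qed

lemma chord_in_geodesics:
  assumes "a < b" "b < \<infinity>" shows "chord a b \<in> geodesics"
proof -
  have "a \<noteq> \<infinity>" "b \<noteq> \<infinity>" using assms by auto
  then have "bdry_pt a \<noteq> bdry_pt b" using assms by (auto simp: bdry_pt_eq_iff)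
  then show ?thesis unfolding geodesics_def chord_def mem_Collect_eq
    by (intro exI[of _ "bdry_pt a"] exI[of _ "bdry_pt b"]) simp
qed

lemma geodesic_cases:
  assumes "\<gamma> \<in> geodesics"
  obtains a b where "a < b" "b < \<infinity>" "\<gamma> = chord a b"
proof -
  obtain p q where pq: "\<gamma> = {p, q}" "norm p = 1" "norm q = 1" "p \<noteq> q"
    using assms by (auto simp: geodesics_def)
  obtain x y where xy: "x \<noteq> \<infinity>" "bdry_pt x = p" "y \<noteq> \<infinity>" "bdry_pt y = q"
    using bdry_pt_surj pq by metis
  then have "x \<noteq> y" using pq by auto
  show ?thesis
  proof (cases "x < y")
    case True then show ?thesis using that[of x y] xy pq by (simp add: chord_def)
  next
    case False then show ?thesis using that[of y x] xy pq \<open>x \<noteq> y\<close> by (auto simp: chord_def insert_commute)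
  qed
qed

lemma geodesic_lo_hi:
  assumes "\<gamma> \<in> geodesics"
  shows "lo \<gamma> < hi \<gamma>" "hi \<gamma> < \<infinity>" "chord (lo \<gamma>) (hi \<gamma>) = \<gamma>"
proof -
  obtain a b where "a < b" "b < \<infinity>" "\<gamma> = chord a b" using geodesic_cases[OF assms] by metis
  then show "lo \<gamma> < hi \<gamma>" "hi \<gamma> < \<infinity>" "chord (lo \<gamma>) (hi \<gamma>) = \<gamma>" by simp_all
qed

text \<open>
  The complement of the arc in the circle is the image of the compact interval \<open>{t - 2\<pi>..s}\<close>.
\<close>

lemma open_arc_cis:
  assumes "s < t" "t \<le> s + 2 * pi" shows "open_arc (cis ` {s<..<t})"
proof -
  have surj: "\<exists>v. t - 2 * pi \<le> v \<and> v < t \<and> z = cis v" if z: "norm z = 1" for z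
  proof -
    obtain u where u: "z = cis u" using z cis_Arg[of z] by (metis norm_zero sgn_eq zero_neq_one div_by_1 of_real_1)
    define k where "k = \<lfloor>(t - u) / (2 * pi)\<rfloor>"
    have "k \<le> (t - u) / (2 * pi)" "(t - u) / (2 * pi) < k + 1" unfolding k_def by linarith+
    then have k: "k * (2 * pi) \<le> t - u" "t - u < (k + 1) * (2 * pi)" by (simp_all add: field_simps)
    define v where "v = u + k * (2 * pi)"
    have v: "t - 2 * pi < v" "v \<le> t" using k by (auto simp: v_def algebra_simps)
    have "cis v = z" using u using cis_multiple_2pi[of "of_int k"] by (simp add: v_def cis_mult[symmetric] mult.commute)
    moreover have "cis (t - 2 * pi) = cis t" by (simp add: cis_divide[symmetric])
    ultimately show ?thesis using v
      by (cases "v = t") (auto intro: exI[of _ "t - 2 * pi"] exI[of _ v])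
  qed
  have eq: "cis ` {s<..<t} = sphere 0 1 - cis ` {t - 2 * pi..s}"
  proof (intro equalityI subsetI)
    fix z assume "z \<in> cis ` {s<..<t}"
    then obtain u where u: "s < u" "u < t" "z = cis u" by auto
    have "z \<notin> cis ` {t - 2 * pi..s}"
    proof
      assume "z \<in> cis ` {t - 2 * pi..s}"
      then obtain v where v: "v \<in> {t - 2 * pi..s}" "z = cis v" by (rule imageE)
      have "\<bar>u - v\<bar> < 2 * pi" "u \<noteq> v" using u v by (auto simp: abs_less_iff)
      then show False using cis_eq_iff[of u v] u v by simp
    qed
    then show "z \<in> sphere 0 1 - cis ` {t - 2 * pi..s}" using u(3) by simp
  next
    fix z assume z: "z \<in> sphere 0 1 - cis ` {t - 2 * pi..s}"
    then have "norm z = 1" by simp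
    then obtain v where v: "t - 2 * pi \<le> v" "v < t" "z = cis v" using surj by blast
    have "\<not> v \<le> s" using z v by auto
    then show "z \<in> cis ` {s<..<t}" using v by auto
  qed
  have "compact (cis ` {t - 2 * pi..s})" by (intro compact_continuous_image continuous_on_cis continuous_on_id compact_Icc)
  then have "open (- (cis ` {t - 2 * pi..s}))" by (simp add: compact_imp_closed open_Compl)
  moreover have "cis ` {s<..<t} = sphere 0 1 \<inter> - (cis ` {t - 2 * pi..s})" using eq by auto
  ultimately have "openin (top_of_set (sphere 0 1)) (cis ` {s<..<t})" by (metis openin_open_Int)
  moreover have "connected (cis ` {s<..<t})" by (intro connected_continuous_image continuous_on_cis continuous_on_id) simp
  ultimately show ?thesis by (simp add: open_arc_def)
qed

lemma open_arc_sphere: "open_arc (sphere 0 1)"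
  unfolding open_arc_def using connected_sphere[of "0::complex" 1] openin_subtopology_self by auto

lemma bdry_pt_image_interval:
  assumes "-\<infinity> \<le> a" "a < b" "b \<le> \<infinity>"
  defines "t \<equiv> (if b = \<infinity> then pi else angle b)"
  shows "bdry_pt ` {x. a < x \<and> x < b} = cis ` {angle a<..<t}"
proof -
  have a: "a \<noteq> \<infinity>" using assms by auto
  show ?thesis
  proof (intro equalityI subsetI)
    fix z assume "z \<in> bdry_pt ` {x. a < x \<and> x < b}"
    then obtain x where x: "a < x" "x < b" "z = bdry_pt x" by auto
    moreover from x have "x \<noteq> \<infinity>" by auto
    ultimately have "angle a < angle x" "angle x < t"
      using a angle_less_iff[of a x] angle_less_iff[of x b] angle_range[of x] by (auto simp: t_def)
    then show "z \<in> cis ` {angle a<..<t}" using x by (auto simp: bdry_pt_eq_cis)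
  next
    fix z assume "z \<in> cis ` {angle a<..<t}"
    then obtain u where u: "angle a < u" "u < t" "z = cis u" by auto
    have "t \<le> pi" using angle_range[of b] by (auto simp: t_def)
    moreover from u angle_range(1)[OF a] have "- pi \<le> u" by linarith
    ultimately have "- pi \<le> u" "u < pi" using u by linarith+
    then obtain x where x: "x \<noteq> \<infinity>" "angle x = u"
      using angle_surj by metis
    then have "a < x" "x < b" using a u angle_less_iff[of a x] angle_less_iff[of x b]
      by (auto simp: t_def split: if_splits)
    then show "z \<in> bdry_pt ` {x. a < x \<and> x < b}" using u x by (auto simp: bdry_pt_eq_cis)
  qed
qed

lemma open_arc_inside:
  assumes "a < b" shows "open_arc (bdry_pt ` {x. a < x \<and> x < b})"
proof -
  have "a \<noteq> \<infinity>" using assms by auto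
  then have "angle a < (if b = \<infinity> then pi else angle b)" "(if b = \<infinity> then pi else angle b) \<le> angle a + 2 * pi"
    using assms angle_range[of a] angle_range[of b] angle_less_iff[of a b] by (auto intro: less_imp_le)
  then show ?thesis using open_arc_cis bdry_pt_image_interval[of a b] assms by auto
qed

text \<open>
  The arc passes through the boundary point of index \<open>-\<infinity>\<close>, so as an interval of angles it runs
  beyond \<open>\<pi>\<close>.
\<close>

lemma open_arc_outside:
  assumes "a < b" "b < \<infinity>" shows "open_arc (bdry_pt ` {x. x \<noteq> \<infinity> \<and> (x < a \<or> b < x)})"
proof -
  have n: "a \<noteq> \<infinity>" "b \<noteq> \<infinity>" using assms by auto
  have ab: "angle a < angle b" "angle b < pi" "-pi \<le> angle a"
    using angle_less_iff[OF n] assms angle_range[OF n(1)] angle_range[OF n(2)] by simp_all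
  have "cis ` {angle b<..<angle a + 2 * pi} = bdry_pt ` {x. x \<noteq> \<infinity> \<and> (x < a \<or> b < x)}"
  proof (intro equalityI subsetI)
    fix z assume "z \<in> bdry_pt ` {x. x \<noteq> \<infinity> \<and> (x < a \<or> b < x)}"
    then obtain x where x: "x \<noteq> \<infinity>" "x < a \<or> b < x" "z = bdry_pt x" by auto
    have "cis (angle x + 2 * pi) = cis (angle x)" by (simp add: cis_mult[symmetric])
    moreover have "angle x + 2 * pi \<in> {angle b<..<angle a + 2 * pi} \<or> angle x \<in> {angle b<..<angle a + 2 * pi}"
    proof (cases "x < a")
      case True
      then have "angle x < angle a" using angle_less_iff[OF x(1) n(1)] by simp
      then show ?thesis using ab angle_range[OF x(1)] by simp
    next
      case False
      then have "angle b < angle x" using angle_less_iff[OF n(2) x(1)] x(2) by simp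
      then show ?thesis using ab angle_range[OF x(1)] by simp
    qed
    ultimately show "z \<in> cis ` {angle b<..<angle a + 2 * pi}" using x by (metis bdry_pt_eq_cis imageI)
  next
    fix z assume "z \<in> cis ` {angle b<..<angle a + 2 * pi}"
    then obtain u where u: "angle b < u" "u < angle a + 2 * pi" "z = cis u" by auto
    show "z \<in> bdry_pt ` {x. x \<noteq> \<infinity> \<and> (x < a \<or> b < x)}"
    proof (cases "u < pi")
      case True
      have "- pi \<le> u" using u ab by linarith
      then obtain x where x: "x \<noteq> \<infinity>" "angle x = u" using angle_surj[OF _ True] by metis
      then have "b < x" using angle_less_iff[of b x] n u by auto
      then show ?thesis using u x by (auto simp: bdry_pt_eq_cis)
    next
      case False
      have "- pi \<le> u - 2 * pi" "u - 2 * pi < pi" using False u ab by linarith+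
      then obtain x where x: "x \<noteq> \<infinity>" "angle x = u - 2 * pi" using angle_surj by metis
      then have "x < a" using angle_less_iff[of x a] n u by auto
      moreover have "z = bdry_pt x" using x u by (simp add: bdry_pt_eq_cis cis_divide[symmetric])
      ultimately show ?thesis using x by auto
    qed
  qed
  then show ?thesis using open_arc_cis[of "angle b" "angle a + 2 * pi"] ab by auto
qed

section \<open>Crossing geodesics\<close>

text \<open>
  Up to a sign, twice the signed area of the triangle \<open>p q r\<close>: it vanishes on the line through \<open>p\<close>
  and \<open>q\<close> and separates its two sides.
\<close>

definition side :: "complex \<Rightarrow> complex \<Rightarrow> complex \<Rightarrow> real" where
  "side p q r = (r - p) \<bullet> (\<i> * (p - q))"

lemma side_commute: "side q p r = - side p q r"
  by (simp add: side_def inner_complex_def algebra_simps)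

lemma side_affine: "side p q (r + t *\<^sub>R (s - r)) = (1 - t) * side p q r + t * side p q s"
  by (simp add: side_def inner_complex_def algebra_simps)

text \<open>
  The half angles make the sign visible: each sine has the sign of the difference of two angles in
  \<open>[-\<pi>, \<pi>)\<close>.
\<close>

lemma side_cis:
  "side (cis a) (cis b) (cis c) = - 4 * sin ((b - a) / 2) * sin ((c - b) / 2) * sin ((c - a) / 2)"
proof -

  have 1: "side (cis a) (cis b) (cis c) = sin (b - a) * (cos (c - a) - 1) + sin (c - a) * (1 - cos (b - a))"
  proof -
    have *: "(cc - ca) * (sb - sa) + (sc - sa) * (ca - cb) =
      (sb * ca - cb * sa) * (cc * ca + sc * sa - 1) + (sc * ca - cc * sa) * (1 - (cb * ca + sb * sa))"
      if "sa\<^sup>2 + ca\<^sup>2 = 1" for sa ca sb cb sc cc :: real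
    proof -
      have "(sb * ca - cb * sa) * (cc * ca + sc * sa - 1) + (sc * ca - cc * sa) * (1 - (cb * ca + sb * sa))
        = (sa\<^sup>2 + ca\<^sup>2) * (sb * cc - cb * sc) - sb * ca + cb * sa + sc * ca - cc * sa"
        by (simp add: power2_eq_square algebra_simps)
      also have "\<dots> = (cc - ca) * (sb - sa) + (sc - sa) * (ca - cb)"
        unfolding that by (simp add: algebra_simps)
      finally show ?thesis by simp
    qed
    show ?thesis
      unfolding side_def inner_complex_def sin_diff cos_diff
      using *[of "sin a" "cos a" "cos c" "sin b" "sin c" "cos b", OF sin_cos_squared_add]
      by (simp del: right_diff_distrib)
  qed
  define u v where "u = (b - a) / 2" and "v = (c - a) / 2"
  have uv: "b - a = 2 * u" "c - a = 2 * v" "(c - b) / 2 = v - u" by (auto simp: u_def v_def field_simps)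
  have "sin (2 * u) * (cos (2 * v) - 1) + sin (2 * v) * (1 - cos (2 * u))
      = - 4 * sin u * sin (v - u) * sin v"
    unfolding sin_double cos_double_sin sin_diff by (simp add: algebra_simps power2_eq_square)
  then show ?thesis unfolding 1 uv by simp
qed

lemma side_bdry_pt:
  assumes "a < b" "b < \<infinity>" "c \<noteq> \<infinity>"
  shows "side (bdry_pt a) (bdry_pt b) (bdry_pt c) < 0 \<longleftrightarrow> c < a \<or> b < c"
    and "side (bdry_pt a) (bdry_pt b) (bdry_pt c) > 0 \<longleftrightarrow> a < c \<and> c < b"
proof -
  have *: "sin ((angle y - angle x) / 2) > 0 \<longleftrightarrow> x < y" "sin ((angle y - angle x) / 2) < 0 \<longleftrightarrow> y < x"
    if "x \<noteq> \<infinity>" "y \<noteq> \<infinity>" for x y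
  proof -
    have r: "\<bar>(angle y - angle x) / 2\<bar> < pi" using angle_range[OF that(1)] angle_range[OF that(2)] by (simp add: abs_less_iff)
    have "sin ((angle y - angle x) / 2) > 0" if "x < y"
      using angle_less_iff[OF \<open>x \<noteq> \<infinity>\<close> \<open>y \<noteq> \<infinity>\<close>] that r by (intro sin_gt_zero) (auto simp: abs_less_iff)
    moreover have "sin ((angle y - angle x) / 2) < 0" if "y < x"
    proof -
      have "sin ((angle x - angle y) / 2) > 0"
        using angle_less_iff[OF \<open>y \<noteq> \<infinity>\<close> \<open>x \<noteq> \<infinity>\<close>] that r by (intro sin_gt_zero) (auto simp: abs_less_iff)
      moreover have "sin ((angle x - angle y) / 2) = - sin ((angle y - angle x) / 2)"
        by (simp flip: sin_minus add: minus_divide_left)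
      ultimately show ?thesis by linarith
    qed
    ultimately show "sin ((angle y - angle x) / 2) > 0 \<longleftrightarrow> x < y" "sin ((angle y - angle x) / 2) < 0 \<longleftrightarrow> y < x"
      by (cases x y rule: linorder_cases; simp add: less_imp_not_less not_less_iff_gr_or_eq)+
  qed
  have "a \<noteq> \<infinity>" "b \<noteq> \<infinity>" using assms by auto
  note s = *[OF this] *[OF this(1) assms(3)] *[OF this(2) assms(3)]
  show "side (bdry_pt a) (bdry_pt b) (bdry_pt c) < 0 \<longleftrightarrow> c < a \<or> b < c"
       "side (bdry_pt a) (bdry_pt b) (bdry_pt c) > 0 \<longleftrightarrow> a < c \<and> c < b"
    unfolding bdry_pt_eq_cis side_cis using s assms(1)
    by (auto simp: mult_less_0_iff zero_less_mult_iff)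
qed

text \<open>
  The map from the Poincare disk to the Klein disk, which straightens geodesics to chords.
\<close>

definition klein :: "complex \<Rightarrow> complex" where
  "klein z = (2 / (1 + (norm z)\<^sup>2)) *\<^sub>R z"

lemma geodesic_points_klein:
  assumes "p \<noteq> q"
  shows "geodesic_points {p, q} = {z. norm z < 1 \<and> side p q (klein z) = 0}"
proof -
  have 0: "1 + (norm z)\<^sup>2 > 0" for z :: complex by (smt (verit) zero_le_power2)
  have 1: "side p q (klein z) = 0 \<longleftrightarrow>
      (1 + (norm z)\<^sup>2) * (p \<bullet> (\<i> * (p - q))) = 2 * (z \<bullet> (\<i> * (p - q)))" for p q z
    using 0[of z] by (simp add: side_def klein_def inner_diff_left field_simps) auto
  have "geodesic_points {p, q} =
     {z. norm z < 1 \<and> (\<exists>p' q'. {p, q} = {p', q'} \<and> p' \<noteq> q' \<and> side p' q' (klein z) = 0)}"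
    unfolding geodesic_points_def 1 by simp
  also have "\<dots> = {z. norm z < 1 \<and> side p q (klein z) = 0}"
    using assms side_commute[of p q] by (auto simp: doubleton_eq_iff)
  finally show ?thesis .
qed

lemma norm_klein_less_1:
  assumes "norm z < 1" shows "norm (klein z) < 1"
proof -
  have "0 < (1 - norm z)\<^sup>2" using assms by simp
  then have "2 * norm z < 1 + (norm z)\<^sup>2" by (simp add: power2_eq_square algebra_simps)
  moreover have "1 + (norm z)\<^sup>2 > 0" by (smt (verit) zero_le_power2)
  ultimately show ?thesis by (simp add: klein_def)
qed

lemma klein_surj:
  assumes "norm w < 1" obtains z where "norm z < 1" "klein z = w"
proof -
  define s where "s = sqrt (1 - (norm w)\<^sup>2)"
  have s: "s > 0" "s\<^sup>2 = 1 - (norm w)\<^sup>2" using assms by (auto simp: s_def power_less_one_iff abs_square_less_1 less_imp_le)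
  define z where "z = (1 / (1 + s)) *\<^sub>R w"
  have nz: "norm z = norm w / (1 + s)" using s by (simp add: z_def)
  have "norm w < 1 + s" using assms s by simp
  then have "norm z < 1" using s nz by simp
  moreover have "1 + (norm z)\<^sup>2 = 2 / (1 + s)"
  proof -
    have "1 + (norm z)\<^sup>2 = ((1 + s)\<^sup>2 + (norm w)\<^sup>2) / (1 + s)\<^sup>2"
      using s by (simp add: nz power_divide field_simps)
    also have "(1 + s)\<^sup>2 + (norm w)\<^sup>2 = 2 * (1 + s)" using s(2) by (simp add: power2_eq_square algebra_simps)
    finally show ?thesis using s(1) by (simp add: power2_eq_square del: distrib_left_numeral)
  qed
  then have "klein z = w" using s by (simp add: klein_def z_def)
  ultimately show ?thesis using that by blast
qed

text \<open>
  The power of a point on a secant: a point of the line through \<open>r\<close> and \<open>s\<close> is inside the circle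
  exactly if it is strictly between \<open>r\<close> and \<open>s\<close>.
\<close>

lemma norm_on_chord:
  fixes r s :: complex assumes "norm r = 1" "norm s = 1"
  shows "(norm (r + t *\<^sub>R (s - r)))\<^sup>2 = 1 - t * (1 - t) * (norm (s - r))\<^sup>2"
proof -
  have "(Re r)\<^sup>2 + (Im r)\<^sup>2 = 1" "(Re s)\<^sup>2 + (Im s)\<^sup>2 = 1"
    using assms by (metis cmod_power2 one_power2)+
  then show ?thesis by (simp add: cmod_power2) algebra
qed

lemma side_eq_0D:
  assumes "side r s w = 0" "r \<noteq> s" obtains t where "w = r + t *\<^sub>R (s - r)"
proof -
  define d where "d = (Re (s - r))\<^sup>2 + (Im (s - r))\<^sup>2"
  have d: "d \<noteq> 0" using assms(2) by (auto simp: d_def complex_eq_iff add_nonneg_eq_0_iff)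
  define t where "t = ((w - r) \<bullet> (s - r)) / d"
  have "d * Re (w - r) = ((w - r) \<bullet> (s - r)) * Re (s - r)" "d * Im (w - r) = ((w - r) \<bullet> (s - r)) * Im (s - r)"
    using assms(1) by (simp_all add: side_def inner_complex_def d_def) algebra+
  then have "Re (w - r) = t * Re (s - r)" "Im (w - r) = t * Im (s - r)"
    using d by (simp_all add: t_def field_simps)
  then have "w = r + t *\<^sub>R (s - r)" by (simp add: complex_eq_iff algebra_simps)
  then show ?thesis using that by blast
qed

text \<open>
  In the Klein disk two different geodesics meet iff the line through \<open>p\<close> and \<open>q\<close> separates \<open>r\<close> from
  \<open>s\<close>: the meeting point is the zero of the affine function \<open>side p q\<close> on the chord from \<open>r\<close> to \<open>s\<close>.
\<close>

lemma crossing_iff_side: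
  assumes p: "norm p = 1" "norm q = 1" "p \<noteq> q" and r: "norm r = 1" "norm s = 1" "r \<noteq> s"
  shows "crossing {p, q} {r, s} \<longleftrightarrow> side p q r * side p q s < 0"
proof
  assume "crossing {p, q} {r, s}"
  then obtain z where ne: "{p, q} \<noteq> {r, s}" and z: "norm z < 1" "side p q (klein z) = 0" "side r s (klein z) = 0"
    unfolding crossing_def geodesic_points_klein[OF p(3)] geodesic_points_klein[OF r(3)] by auto
  obtain t where t: "klein z = r + t *\<^sub>R (s - r)" using side_eq_0D[OF z(3) r(3)] by blast
  have "(norm (klein z))\<^sup>2 < 1" using norm_klein_less_1[OF z(1)] by (simp add: abs_square_less_1)
  then have "t * (1 - t) * (norm (s - r))\<^sup>2 > 0" using norm_on_chord[OF r(1,2), of t] t by simp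
  then have t01: "0 < t" "t < 1" using r(3) by (auto simp: zero_less_mult_iff)
  have 0: "(1 - t) * side p q r + t * side p q s = 0" using z(2) t side_affine by simp
  have on: "x \<in> {p, q}" if x: "side p q x = 0" "norm x = 1" for x
  proof -
    obtain u where u: "x = p + u *\<^sub>R (q - p)" using side_eq_0D[OF x(1) p(3)] by blast
    then have "u * (1 - u) * (norm (q - p))\<^sup>2 = 0" using norm_on_chord[OF p(1,2), of u] x(2) by simp
    then have "u = 0 \<or> u = 1" using p(3) by auto
    then show ?thesis using u by auto
  qed
  have "side p q r \<noteq> 0"
  proof
    assume "side p q r = 0"
    then have "side p q s = 0" using 0 t01 by simp
    then show False using on[of r] on[of s] \<open>side p q r = 0\<close> r ne by auto
  qed
  then have "0 < (1 - t) * (side p q r)\<^sup>2" using t01 by simp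
  moreover have "t * (side p q r * side p q s) + (1 - t) * (side p q r)\<^sup>2
      = side p q r * ((1 - t) * side p q r + t * side p q s)"
    by (simp add: power2_eq_square algebra_simps)
  ultimately have "t * (side p q r * side p q s) < 0" unfolding 0 by simp
  then show "side p q r * side p q s < 0" using t01 by (simp add: mult_less_0_iff)
next
  assume neg: "side p q r * side p q s < 0"
  define t where "t = side p q r / (side p q r - side p q s)"
  have t: "0 < t" "t < 1" "(1 - t) * side p q r + t * side p q s = 0"
    using neg by (auto simp: t_def mult_less_0_iff field_simps)
  define w where "w = r + t *\<^sub>R (s - r)"
  have "(norm w)\<^sup>2 < 1" using norm_on_chord[OF r(1,2), of t] t r(3) by (simp add: w_def)
  then have "norm w < 1" by (simp add: abs_square_less_1)
  then obtain z where z: "norm z < 1" "klein z = w" using klein_surj by blast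
  have "side p q w = 0" using t by (simp add: w_def side_affine)
  moreover have "side r s w = 0" by (simp add: w_def side_affine) (simp add: side_def inner_complex_def algebra_simps)
  moreover have "side p q p = 0" "side p q q = 0" by (simp_all add: side_def inner_complex_def algebra_simps)
  then have "{p, q} \<noteq> {r, s}" using neg by (auto simp: doubleton_eq_iff)
  ultimately show "crossing {p, q} {r, s}"
    unfolding crossing_def geodesic_points_klein[OF p(3)] geodesic_points_klein[OF r(3)]
    using z by auto
qed

lemma crossing_chord:
  assumes "a < b" "b < \<infinity>" "c < d" "d < \<infinity>"
  shows "crossing (chord a b) (chord c d) \<longleftrightarrow> (a < c \<and> c < b \<and> b < d) \<or> (c < a \<and> a < d \<and> d < b)"
proof -
  have n: "a \<noteq> \<infinity>" "b \<noteq> \<infinity>" "c \<noteq> \<infinity>" "d \<noteq> \<infinity>" using assms by auto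
  then have "bdry_pt a \<noteq> bdry_pt b" "bdry_pt c \<noteq> bdry_pt d" using assms by (auto simp: bdry_pt_eq_iff)
  then have "crossing (chord a b) (chord c d) \<longleftrightarrow>
      side (bdry_pt a) (bdry_pt b) (bdry_pt c) * side (bdry_pt a) (bdry_pt b) (bdry_pt d) < 0"
    unfolding chord_def by (intro crossing_iff_side) auto
  then show ?thesis
    using assms n by (auto simp: mult_less_0_iff side_bdry_pt)
qed

section \<open>The Borel sets of a lamination\<close>

lemma bdry_pt_mem_image:
  assumes "c \<noteq> \<infinity>" "\<And>z. z \<in> X \<Longrightarrow> z \<noteq> \<infinity>"
  shows "bdry_pt c \<in> bdry_pt ` X \<longleftrightarrow> c \<in> X"
  using assms bdry_pt_eq_iff by blast

lemma chord_in_O_set: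
  "chord a b \<in> O_set L A B \<longleftrightarrow> chord a b \<in> L \<and>
     (bdry_pt a \<in> A \<and> bdry_pt b \<in> B \<or> bdry_pt b \<in> A \<and> bdry_pt a \<in> B)"
  unfolding O_set_def chord_def by (auto simp: doubleton_eq_iff)

lemma O_set_in_sets:
  assumes "open_arc A" "open_arc B"
  shows "O_set L A B \<in> sigma_sets L {U. openin (lam_topology L) U}"
  unfolding lam_topology_def
  by (intro sigma_sets.Basic CollectI topology_generated_by_Basis) (use assms in blast)

text \<open>
  For \<open>x \<le> y\<close> these sets are closed under intersection and generate the Borel sets, and their masses
  can be read off from the height function.
\<close>

definition leaves_over :: "complex set set \<Rightarrow> real \<Rightarrow> real \<Rightarrow> complex set set" where
  "leaves_over L x y = {\<gamma>\<in>L. lo \<gamma> < ereal x \<and> ereal y < hi \<gamma>}"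

text \<open>
  The smaller index \<open>lo\<close> is in general not continuous on a lamination: leaves with one endpoint far
  to the right can converge to a leaf ending at \<open>-\<infinity>\<close>. Describing an open set by ordered pairs of
  boundary points in an open subset of the plane squared avoids the order of the indices.
\<close>

lemma openin_lam_topology_pairs:
  assumes "L \<subseteq> geodesics" "openin (lam_topology L) U"
  obtains W where "open W" "\<And>p q. {p, q} \<in> L \<Longrightarrow> {p, q} \<in> U \<longleftrightarrow> (p, q) \<in> W"
proof -
  define P where "P U W \<longleftrightarrow> open W \<and> (\<forall>p q. {p, q} \<in> L \<longrightarrow> ({p, q} \<in> U \<longleftrightarrow> (p, q) \<in> W))" for U W
  have "generate_topology_on {O_set L A B |A B. open_arc A \<and> open_arc B} U"
    using assms(2) unfolding lam_topology_def by (rule openin_topology_generated_by)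
  then have "\<exists>W. P U W"
  proof induction
    case Empty
    show ?case by (rule exI[of _ "{}"]) (simp add: P_def)
  next
    case (Int a b)
    obtain V where V: "P a V" using Int by auto
    obtain W where W: "P b W" using Int by auto
    show ?case by (rule exI[of _ "V \<inter> W"]) (use V W in \<open>simp add: P_def open_Int\<close>)
  next
    case (UN K)
    then obtain f where f: "\<And>k. k \<in> K \<Longrightarrow> P k (f k)" by metis
    have "open (\<Union>(f ` K))" using f by (auto simp: P_def)
    moreover have "{p, q} \<in> \<Union>K \<longleftrightarrow> (p, q) \<in> \<Union>(f ` K)" if pq: "{p, q} \<in> L" for p q
    proof -
      have "{p, q} \<in> k \<longleftrightarrow> (p, q) \<in> f k" if "k \<in> K" for k
        using f[OF that] pq unfolding P_def by simp
      then show ?thesis by simp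
    qed
    ultimately have "P (\<Union>K) (\<Union>(f ` K))" by (simp add: P_def)
    then show ?case by (rule exI)
  next
    case (Basis s)
    then obtain A B where s: "s = O_set L A B" "open_arc A" "open_arc B" by auto
    obtain A' where A: "open A'" "A = sphere 0 1 \<inter> A'"
      using s(2) unfolding open_arc_def openin_open by auto
    obtain B' where B: "open B'" "B = sphere 0 1 \<inter> B'"
      using s(3) unfolding open_arc_def openin_open by auto
    have sph: "norm p = 1 \<and> norm q = 1" if "{p, q} \<in> L" for p q
    proof -
      have "{p, q} \<in> geodesics" using assms(1) that by auto
      then obtain a b where "{p, q} = {a, b}" "norm a = 1" "norm b = 1" unfolding geodesics_def by blast
      then show ?thesis by (metis doubleton_eq_iff)
    qed
    have iff: "{p, q} \<in> s \<longleftrightarrow> (p, q) \<in> A' \<times> B' \<union> B' \<times> A'" if "{p, q} \<in> L" for p q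
    proof -
      have "{p, q} \<in> s \<longleftrightarrow> (\<exists>p' q'. {p, q} = {p', q'} \<and> p' \<in> A \<and> q' \<in> B)"
        using that by (simp add: s(1) O_set_def)
      also have "\<dots> \<longleftrightarrow> p \<in> A \<and> q \<in> B \<or> q \<in> A \<and> p \<in> B" by (metis doubleton_eq_iff)
      also have "\<dots> \<longleftrightarrow> p \<in> A' \<and> q \<in> B' \<or> q \<in> A' \<and> p \<in> B'" using sph[OF that] by (simp add: A(2) B(2))
      finally show ?thesis by auto
    qed
    have op: "open (A' \<times> B' \<union> B' \<times> A')" using A B by (intro open_Un open_Times) auto
    show ?case unfolding P_def
      by (rule exI[of _ "A' \<times> B' \<union> B' \<times> A'"]) (intro conjI op allI impI iff)
  qed
  then obtain W where "P U W" ..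
  then show ?thesis using that[of W] by (simp add: P_def)
qed

text \<open>
  The set \<open>{lo < x}\<close> need not be open, since it contains the leaves ending at \<open>-\<infinity>\<close>. These are the
  leaves outside the open set of leaves with two real endpoints.
\<close>

lemma leaves_over_in_sets:
  assumes L: "L \<subseteq> geodesics"
  shows "leaves_over L x y \<in> sigma_sets L {U. openin (lam_topology L) U}" (is "_ \<in> ?S")
proof -
  interpret S: sigma_algebra L ?S
    by (rule sigma_algebra_sigma_sets) (auto simp: lam_topology_def topology_generated_by_topspace O_set_def dest!: openin_subset)
  define ray where "ray a b = bdry_pt ` {z::ereal. a < z \<and> z < b}" for a b
  have ray_arc: "open_arc (ray a b)" if "a < b" for a b using open_arc_inside[OF that] by (simp add: ray_def)
  have sph: "bdry_pt c \<in> sphere 0 1" for c by simp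
  have mem_ray: "bdry_pt c \<in> ray a b \<longleftrightarrow> a < c \<and> c < b" if "c \<noteq> \<infinity>" for a b c
  proof -
    have "z \<noteq> \<infinity>" if "z \<in> {z. a < z \<and> z < b}" for z using that by auto
    from bdry_pt_mem_image[OF \<open>c \<noteq> \<infinity>\<close>, of "{z. a < z \<and> z < b}", OF this] show ?thesis by (simp add: ray_def)
  qed
  have "O_set L (ray y \<infinity>) (sphere 0 1) = {\<gamma>\<in>L. ereal y < hi \<gamma>}" (is "?A = ?B")
  proof -
    have "\<gamma> \<in> ?A \<longleftrightarrow> \<gamma> \<in> ?B" if g: "\<gamma> \<in> geodesics" for \<gamma>
    proof -
      obtain a b where ab: "a < b" "b < \<infinity>" "\<gamma> = chord a b" using geodesic_cases[OF g] by metis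
      then have "a \<noteq> \<infinity>" "b \<noteq> \<infinity>" by auto
      then show ?thesis using ab by (auto simp: chord_in_O_set mem_ray dest: less_trans)
    qed
    moreover have "?A \<subseteq> L" by (auto simp: O_set_def)
    ultimately show ?thesis using L by blast
  qed
  then have 1: "{\<gamma>\<in>L. ereal y < hi \<gamma>} \<in> ?S"
    using O_set_in_sets[OF ray_arc open_arc_sphere, of "ereal y" \<infinity> L] by simp
  have "O_set L (ray (-\<infinity>) x) (sphere 0 1) \<union> (L - O_set L (ray (-\<infinity>) \<infinity>) (ray (-\<infinity>) \<infinity>))
      = {\<gamma>\<in>L. lo \<gamma> < ereal x}" (is "?A = ?B")
  proof -
    have "\<gamma> \<in> ?A \<longleftrightarrow> \<gamma> \<in> ?B" if g: "\<gamma> \<in> geodesics" for \<gamma>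
    proof -
      obtain a b where ab: "a < b" "b < \<infinity>" "\<gamma> = chord a b" using geodesic_cases[OF g] by metis
      then have "a \<noteq> \<infinity>" "b \<noteq> \<infinity>" by auto
      then show ?thesis using ab by (cases "a = -\<infinity>") (auto simp: chord_in_O_set mem_ray less_le[of "-\<infinity>"] dest: less_trans)
    qed
    moreover have "?A \<subseteq> L" by (auto simp: O_set_def)
    ultimately show ?thesis using L by blast
  qed
  moreover have "?A \<in> ?S"
    by (intro S.Un S.compl_sets O_set_in_sets ray_arc open_arc_sphere) auto
  ultimately have "{\<gamma>\<in>L. lo \<gamma> < ereal x} \<in> ?S" by simp
  then have "{\<gamma>\<in>L. lo \<gamma> < ereal x} \<inter> {\<gamma>\<in>L. ereal y < hi \<gamma>} \<in> ?S" using 1 by (rule S.Int)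
  moreover have "{\<gamma>\<in>L. lo \<gamma> < ereal x} \<inter> {\<gamma>\<in>L. ereal y < hi \<gamma>} = leaves_over L x y"
    by (auto simp: leaves_over_def)
  ultimately show ?thesis by simp
qed

lemma
  assumes L: "L \<subseteq> geodesics" "space N = L" and E: "\<And>x y. x \<le> y \<Longrightarrow> leaves_over L x y \<in> sets N"
  shows borel_measurable_lo: "lo \<in> borel_measurable N"
    and borel_measurable_hi: "hi \<in> borel_measurable N"
proof -
  have between: "\<exists>r\<in>\<rat>. lo \<gamma> < ereal r \<and> ereal r < hi \<gamma> \<and> c < ereal r \<and> ereal r < d"
    if "\<gamma> \<in> L" "c < hi \<gamma>" "lo \<gamma> < d" "c < d" for \<gamma> c d
  proof -
    have "max c (lo \<gamma>) < min d (hi \<gamma>)" using that L geodesic_lo_hi by auto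
    then obtain r where "max c (lo \<gamma>) < ereal (real_of_rat r)" "ereal (real_of_rat r) < min d (hi \<gamma>)"
      using ereal_dense3 by blast
    then show ?thesis by (intro bexI[of _ "real_of_rat r"]) auto
  qed
  have eq: "{\<gamma>\<in>L. lo \<gamma> < d} = (\<Union>r\<in>{r\<in>\<rat>. ereal r < d}. leaves_over L r r)"
    "{\<gamma>\<in>L. c < hi \<gamma>} = (\<Union>r\<in>{r\<in>\<rat>. c < ereal r}. leaves_over L r r)" for c d
  proof -
    have "\<exists>r\<in>{r\<in>\<rat>. ereal r < d}. \<gamma> \<in> leaves_over L r r" if "\<gamma> \<in> L" "lo \<gamma> < d" for \<gamma>
    proof -
      have "\<gamma> \<in> geodesics" using that L by auto
      from geodesic_lo_hi[OF this] have "-\<infinity> < hi \<gamma>" "-\<infinity> < d" using that by auto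
      then show ?thesis using between[of \<gamma> "-\<infinity>" d] that by (auto simp: leaves_over_def)
    qed
    then show "{\<gamma>\<in>L. lo \<gamma> < d} = (\<Union>r\<in>{r\<in>\<rat>. ereal r < d}. leaves_over L r r)"
      by (auto simp: leaves_over_def)
    have "\<exists>r\<in>{r\<in>\<rat>. c < ereal r}. \<gamma> \<in> leaves_over L r r" if "\<gamma> \<in> L" "c < hi \<gamma>" for \<gamma>
    proof -
      have "\<gamma> \<in> geodesics" using that L by auto
      from geodesic_lo_hi[OF this] have "lo \<gamma> < \<infinity>" "c < \<infinity>" using that by auto
      then show ?thesis using between[OF that, of \<infinity>] that by (auto simp: leaves_over_def)
    qed
    then show "{\<gamma>\<in>L. c < hi \<gamma>} = (\<Union>r\<in>{r\<in>\<rat>. c < ereal r}. leaves_over L r r)"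
      by (auto simp: leaves_over_def)
  qed
  have c: "countable {r\<in>\<rat>. P r}" for P :: "real \<Rightarrow> bool" by (rule countable_subset[OF _ countable_rat]) auto
  show "lo \<in> borel_measurable N"
    by (rule borel_measurableI_less) (unfold L(2) eq, intro sets.countable_UN' c, auto intro: E)
  show "hi \<in> borel_measurable N"
    by (rule borel_measurableI_greater) (unfold L(2) eq, intro sets.countable_UN' c, auto intro: E)
qed

lemma borel_measurable_bdry_pt: "bdry_pt \<in> borel_measurable borel"
proof -
  have "(\<lambda>x::ereal. if x \<in> {-\<infinity>} then -1 else exp (2 * \<i> * complex_of_real (arctan (real_of_ereal x)))) \<in> borel_measurable borel"
    by (intro measurable_If_set borel_measurable_const borel_measurable_exp borel_measurable_times
        borel_measurable_of_real borel_measurable_arctan borel_measurable_real_of_ereal measurable_ident_sets) auto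
  then show ?thesis by (simp add: bdry_pt_def[abs_def] cong: if_cong)
qed

text \<open>
  The generator makes \<open>lo\<close> and \<open>hi\<close> measurable, and an open set is a preimage of an open set of
  pairs under the measurable map to the two boundary points.
\<close>

lemma sigma_sets_lam_topology:
  assumes L: "L \<subseteq> geodesics"
  shows "sigma_sets L {U. openin (lam_topology L) U} = sigma_sets L {leaves_over L x y |x y. x \<le> y}"
    (is "?S = ?T")
proof (rule sigma_sets_eqI)
  fix U assume "U \<in> {U. openin (lam_topology L) U}"
  then obtain W where W: "open W" "\<And>p q. {p, q} \<in> L \<Longrightarrow> {p, q} \<in> U \<longleftrightarrow> (p, q) \<in> W" and U: "U \<subseteq> L"
    using openin_lam_topology_pairs[OF L, of U] openin_subset[of "lam_topology L" U]
    by (auto simp: lam_topology_def topology_generated_by_topspace O_set_def)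
  define N where "N = sigma L {leaves_over L x y |x y. x \<le> y}"
  have N: "space N = L" "sets N = ?T" by (auto simp: N_def leaves_over_def intro!: sets_measure_of space_measure_of)
  have E: "leaves_over L x y \<in> sets N" if "x \<le> y" for x y using that N by auto
  note [measurable] = borel_measurable_lo[OF L N(1) E] borel_measurable_hi[OF L N(1) E] borel_measurable_bdry_pt
  have "(\<lambda>\<gamma>. (bdry_pt (lo \<gamma>), bdry_pt (hi \<gamma>))) \<in> borel_measurable N"
    by (intro borel_measurable_Pair measurable_compose[OF _ borel_measurable_bdry_pt]) measurable
  then have "(\<lambda>\<gamma>. (bdry_pt (lo \<gamma>), bdry_pt (hi \<gamma>))) -` W \<inter> space N \<in> sets N"
    by (rule measurable_sets[OF _ borel_open[OF W(1)]])
  moreover have "(\<lambda>\<gamma>. (bdry_pt (lo \<gamma>), bdry_pt (hi \<gamma>))) -` W \<inter> space N = U"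
  proof -
    have "(bdry_pt (lo \<gamma>), bdry_pt (hi \<gamma>)) \<in> W \<longleftrightarrow> \<gamma> \<in> U" if "\<gamma> \<in> L" for \<gamma>
      using W(2)[of "bdry_pt (lo \<gamma>)" "bdry_pt (hi \<gamma>)"] geodesic_lo_hi(3)[of \<gamma>] that L by (auto simp: chord_def)
    then show ?thesis using N U by auto
  qed
  ultimately show "U \<in> ?T" using N by simp
next
  fix E assume "E \<in> {leaves_over L x y |x y. x \<le> y}"
  then show "E \<in> ?S" using leaves_over_in_sets[OF L] by auto
qed

section \<open>Functions of bounded variation\<close>

text \<open>
  Bounded variation, witnessed by a bounded monotone \<open>W\<close> that dominates the increments. In contrast
  to sums over partitions this form passes directly to infinite sums and to one-sided limits.
\<close>

definition bv :: "(real \<Rightarrow> real) \<Rightarrow> bool" where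
  "bv g \<longleftrightarrow> (\<exists>W. mono W \<and> bounded (range W) \<and> (\<forall>x y. x \<le> y \<longrightarrow> \<bar>g y - g x\<bar> \<le> W y - W x))"

lemma bvI:
  assumes "mono W" "bounded (range W)" "\<And>x y. x \<le> y \<Longrightarrow> \<bar>g y - g x\<bar> \<le> W y - W x"
  shows "bv g"
  unfolding bv_def by (intro exI[of _ W] conjI allI impI assms)

lemma bounded_range_real_iff: "bounded (range f) \<longleftrightarrow> (\<exists>C. \<forall>x. \<bar>f x\<bar> \<le> C)" for f :: "'a \<Rightarrow> real"
  unfolding bounded_iff by simp

lemma bounded_range_add:
  fixes f g :: "real \<Rightarrow> real"
  assumes "bounded (range f)" "bounded (range g)" shows "bounded (range (\<lambda>x. f x + g x))"
proof -
  obtain a b where ab: "\<And>x. \<bar>f x\<bar> \<le> a" "\<And>x. \<bar>g x\<bar> \<le> b"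
    using assms unfolding bounded_range_real_iff by metis
  have "\<bar>f x + g x\<bar> \<le> a + b" for x using ab(1)[of x] ab(2)[of x] by linarith
  then show ?thesis unfolding bounded_range_real_iff by blast
qed

lemma bv_mono: assumes "mono f" "bounded (range f)" shows "bv f"
  by (rule bvI[OF assms]) (use assms(1) in \<open>auto simp: mono_def\<close>)

lemma bv_add: assumes "bv f" "bv g" shows "bv (\<lambda>x. f x + g x)"
proof -
  obtain V W where V: "mono V" "bounded (range V)" "\<And>x y. x \<le> y \<Longrightarrow> \<bar>f y - f x\<bar> \<le> V y - V x"
    and W: "mono W" "bounded (range W)" "\<And>x y. x \<le> y \<Longrightarrow> \<bar>g y - g x\<bar> \<le> W y - W x"
    using assms unfolding bv_def by metis
  show ?thesis
  proof (rule bvI[of "\<lambda>x. V x + W x"])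
    show "mono (\<lambda>x. V x + W x)" using V(1) W(1) by (auto simp: mono_def intro: add_mono)
    show "bounded (range (\<lambda>x. V x + W x))" using bounded_range_add V(2) W(2) .
    fix x y :: real assume "x \<le> y"
    then show "\<bar>f y + g y - (f x + g x)\<bar> \<le> V y + W y - (V x + W x)" using V(3)[of x y] W(3)[of x y] by linarith
  qed
qed

lemma bv_uminus: assumes "bv f" shows "bv (\<lambda>x. - f x)"
  using assms unfolding bv_def by (simp add: abs_minus_commute)

lemma bv_diff_const: assumes "bv f" shows "bv (\<lambda>x. c - f x)"
  using assms unfolding bv_def by (simp add: abs_minus_commute)

lemma bv_imp_bounded_variation:
  assumes "bv f" shows "bounded_variation f"
proof -
  obtain W where W: "mono W" "bounded (range W)" "\<And>x y. x \<le> y \<Longrightarrow> \<bar>f y - f x\<bar> \<le> W y - W x"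
    using assms unfolding bv_def by metis
  obtain C where C: "\<And>x. \<bar>W x\<bar> \<le> C" using W(2) unfolding bounded_range_real_iff by metis
  have "(\<Sum>i<n. \<bar>f (t (Suc i)) - f (t i)\<bar>) \<le> 2 * C" if "mono t" for t :: "nat \<Rightarrow> real" and n
  proof -
    have "(\<Sum>i<n. \<bar>f (t (Suc i)) - f (t i)\<bar>) \<le> (\<Sum>i<n. W (t (Suc i)) - W (t i))"
      by (intro sum_mono W(3)) (use that in \<open>auto simp: mono_def\<close>)
    also have "\<dots> = W (t n) - W (t 0)" by (rule sum_lessThan_telescope)
    also have "\<dots> \<le> 2 * C" using C[of "t n"] C[of "t 0"] by linarith
    finally show ?thesis .
  qed
  then show ?thesis unfolding bounded_variation_def by blast
qed

text \<open>
  The witness \<open>W x\<close> is the supremum of the sums over partitions of \<open>(-\<infinity>, x]\<close>.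
\<close>

lemma bounded_variation_imp_bv:
  assumes "bounded_variation f" shows "bv f"
proof -
  obtain C where C: "\<And>t n. mono t \<Longrightarrow> (\<Sum>i<n. \<bar>f (t (Suc i)) - f (t i)\<bar>) \<le> C" for t :: "nat \<Rightarrow> real"
    using assms unfolding bounded_variation_def by blast
  define V where "V x = {(\<Sum>i<n. \<bar>f (t (Suc i)) - f (t i)\<bar>) | t n. mono t \<and> t n \<le> x}" for x :: real
  define W where "W x = Sup (V x)" for x
  have bdd: "bdd_above (V x)" for x by (rule bdd_aboveI[of _ C]) (auto simp: V_def C)
  have V0: "0 \<in> V x" for x unfolding V_def
    by (rule CollectI, rule exI[of _ "\<lambda>_. x"], rule exI[of _ "0::nat"]) (auto simp: mono_def)
  have W0: "0 \<le> W x" for x unfolding W_def by (rule cSup_upper[OF V0 bdd])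
  have WC: "W x \<le> C" for x unfolding W_def by (rule cSup_least) (use V0 in blast, auto simp: V_def C)
  have step: "W x + \<bar>f y - f x\<bar> \<le> W y" if xy: "x \<le> y" for x y
  proof -
    have "v \<le> W y - \<bar>f y - f x\<bar>" if vV: "v \<in> V x" for v
    proof -
      obtain t n where t: "mono t" "t n \<le> x" and v: "v = (\<Sum>i<n. \<bar>f (t (Suc i)) - f (t i)\<bar>)"
        using vV unfolding V_def by blast
      \<comment> \<open>a partition ending at or before \<open>x\<close>, continued by \<open>x\<close> and \<open>y\<close>\<close>
      define s where "s i = (if i \<le> n then t i else if i = Suc n then x else y)" for i
      have sm: "mono s"
      proof (rule mono_iff_le_Suc[THEN iffD2], rule allI)
        fix i show "s i \<le> s (Suc i)"
          using t xy monoD[OF t(1), of i "Suc i"] by (cases i n rule: linorder_cases) (auto simp: s_def)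
      qed
      have "(\<Sum>i<n. \<bar>f (s (Suc i)) - f (s i)\<bar>) = v" unfolding v by (intro sum.cong) (auto simp: s_def)
      then have "(\<Sum>i<Suc (Suc n). \<bar>f (s (Suc i)) - f (s i)\<bar>) = v + \<bar>f x - f (t n)\<bar> + \<bar>f y - f x\<bar>"
        by (simp add: s_def)
      moreover have "(\<Sum>i<Suc (Suc n). \<bar>f (s (Suc i)) - f (s i)\<bar>) \<in> V y"
        unfolding V_def by (rule CollectI, rule exI[of _ s], rule exI[of _ "Suc (Suc n)"]) (use sm in \<open>auto simp: s_def\<close>)
      then have "(\<Sum>i<Suc (Suc n). \<bar>f (s (Suc i)) - f (s i)\<bar>) \<le> W y"
        unfolding W_def by (rule cSup_upper[OF _ bdd])
      ultimately show ?thesis by linarith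
    qed
    then have "W x \<le> W y - \<bar>f y - f x\<bar>" unfolding W_def[of x] using V0 by (intro cSup_least) auto
    then show ?thesis by linarith
  qed
  show ?thesis
  proof (rule bvI[of W])
    show "mono W" 
    proof (rule monoI)
      fix x y :: real assume "x \<le> y" from step[OF this] show "W x \<le> W y" by linarith
    qed
    have "\<bar>W x\<bar> \<le> C" for x using W0[of x] WC[of x] by linarith
    then show "bounded (range W)" unfolding bounded_range_real_iff by blast
    show "\<bar>f y - f x\<bar> \<le> W y - W x" if "x \<le> y" for x y using step[OF that] by linarith
  qed
qed

lemma
  fixes f g :: "'a \<Rightarrow> real"
  assumes "f summable_on X" "g summable_on X"
  shows summable_on_diff_real: "(\<lambda>x. f x - g x) summable_on X"
    and infsum_diff_real: "(\<Sum>\<^sub>\<infinity>x\<in>X. f x - g x) = (\<Sum>\<^sub>\<infinity>x\<in>X. f x) - (\<Sum>\<^sub>\<infinity>x\<in>X. g x)"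
proof -
  have g: "(\<lambda>x. - g x) summable_on X" using assms(2) by (simp add: summable_on_uminus)
  show "(\<lambda>x. f x - g x) summable_on X" using summable_on_add[OF assms(1) g] by simp
  show "(\<Sum>\<^sub>\<infinity>x\<in>X. f x - g x) = (\<Sum>\<^sub>\<infinity>x\<in>X. f x) - (\<Sum>\<^sub>\<infinity>x\<in>X. g x)"
    using infsum_add[OF assms(1) g] by (simp add: infsum_uminus)
qed

text \<open>
  The witness is the same series with the coefficients replaced by their absolute values.
\<close>

lemma bv_infsum_steps:
  fixes u :: "'a \<Rightarrow> real" and \<delta> :: "'a \<Rightarrow> real \<Rightarrow> real"
  assumes u: "(\<lambda>x. \<bar>u x\<bar>) summable_on X"
    and \<delta>: "\<And>x. mono (\<delta> x)" "\<And>x z. 0 \<le> \<delta> x z" "\<And>x z. \<delta> x z \<le> 1"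
  shows "bv (\<lambda>z. \<Sum>\<^sub>\<infinity>x\<in>X. u x * \<delta> x z)"
proof (rule bvI[of "\<lambda>z. \<Sum>\<^sub>\<infinity>x\<in>X. \<bar>u x\<bar> * \<delta> x z"])
  have le: "\<bar>u x\<bar> * \<delta> x z \<le> \<bar>u x\<bar>" for x z using mult_left_mono[OF \<delta>(3), of "\<bar>u x\<bar>" x z] by simp
  have s: "(\<lambda>x. \<bar>u x\<bar> * \<delta> x z) summable_on X" for z
    by (rule summable_on_comparison_test[OF u]) (use le \<delta>(2) in auto)
  have s': "(\<lambda>x. u x * \<delta> x z) summable_on X" for z
    by (rule abs_summable_summable) (use s \<delta>(2) in \<open>simp add: abs_mult\<close>)
  show m: "mono (\<lambda>z. \<Sum>\<^sub>\<infinity>x\<in>X. \<bar>u x\<bar> * \<delta> x z)"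
    by (intro monoI infsum_mono s mult_left_mono monoD[OF \<delta>(1)]) auto
  have "0 \<le> (\<Sum>\<^sub>\<infinity>x\<in>X. \<bar>u x\<bar> * \<delta> x z)" "(\<Sum>\<^sub>\<infinity>x\<in>X. \<bar>u x\<bar> * \<delta> x z) \<le> (\<Sum>\<^sub>\<infinity>x\<in>X. \<bar>u x\<bar>)" for z
    by (intro infsum_nonneg mult_nonneg_nonneg \<delta>(2), simp) (intro infsum_mono s u le)
  then have "\<bar>\<Sum>\<^sub>\<infinity>x\<in>X. \<bar>u x\<bar> * \<delta> x z\<bar> \<le> (\<Sum>\<^sub>\<infinity>x\<in>X. \<bar>u x\<bar>)" for z by simp
  then show "bounded (range (\<lambda>z. \<Sum>\<^sub>\<infinity>x\<in>X. \<bar>u x\<bar> * \<delta> x z))"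
    unfolding bounded_range_real_iff by blast
  fix y z :: real assume "y \<le> z"
  then have yz: "\<delta> x y \<le> \<delta> x z" for x using \<delta>(1) by (simp add: monoD)
  have eq: "\<bar>u x * \<delta> x z - u x * \<delta> x y\<bar> = \<bar>u x\<bar> * \<delta> x z - \<bar>u x\<bar> * \<delta> x y" for x
    using yz[of x] by (simp add: abs_mult flip: right_diff_distrib)
  have sd: "(\<lambda>x. \<bar>u x * \<delta> x z - u x * \<delta> x y\<bar>) summable_on X"
     unfolding eq by (intro summable_on_diff_real s)
  have "\<bar>(\<Sum>\<^sub>\<infinity>x\<in>X. u x * \<delta> x z) - (\<Sum>\<^sub>\<infinity>x\<in>X. u x * \<delta> x y)\<bar> = \<bar>\<Sum>\<^sub>\<infinity>x\<in>X. u x * \<delta> x z - u x * \<delta> x y\<bar>"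
    by (simp add: infsum_diff_real s')
  also have "\<dots> \<le> (\<Sum>\<^sub>\<infinity>x\<in>X. \<bar>u x * \<delta> x z - u x * \<delta> x y\<bar>)"
    using norm_infsum_bound[of "\<lambda>x. u x * \<delta> x z - u x * \<delta> x y" X] sd by simp
  also have "\<dots> = (\<Sum>\<^sub>\<infinity>x\<in>X. \<bar>u x\<bar> * \<delta> x z) - (\<Sum>\<^sub>\<infinity>x\<in>X. \<bar>u x\<bar> * \<delta> x y)"
    unfolding eq by (rule infsum_diff_real[OF s s])
  finally show "\<bar>(\<Sum>\<^sub>\<infinity>x\<in>X. u x * \<delta> x z) - (\<Sum>\<^sub>\<infinity>x\<in>X. u x * \<delta> x y)\<bar>
    \<le> (\<Sum>\<^sub>\<infinity>x\<in>X. \<bar>u x\<bar> * \<delta> x z) - (\<Sum>\<^sub>\<infinity>x\<in>X. \<bar>u x\<bar> * \<delta> x y)" .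
qed

lemma bv_uf_val: assumes "useful D" shows "bv (uf_val D)"
proof -
  have "bv (\<lambda>z. cpart D z
     + (\<Sum>\<^sub>\<infinity>x\<in>{x. x \<noteq> -\<infinity>}. um D x * delta_minus x z)
     + (\<Sum>\<^sub>\<infinity>x\<in>{x. x \<noteq> \<infinity>}. up D x * delta_plus x z))"
  proof (intro bv_add bv_infsum_steps bounded_variation_imp_bv)
    fix x show "mono (delta_minus x)" "mono (delta_plus x)"
      by (auto simp: mono_def delta_minus_def delta_plus_def)
         (meson ereal_less_eq(3) order_trans le_less_trans)+
  qed (use assms in \<open>auto simp: useful_def delta_minus_def delta_plus_def\<close>)
  then show ?thesis by (simp add: uf_val_def[abs_def])
qed

lemma mono_bounded_tendsto:
  fixes f :: "real \<Rightarrow> real"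
  assumes f: "mono f" "bounded (range f)"
  shows "\<exists>l. (f \<longlongrightarrow> l) at_top" "\<exists>l. (f \<longlongrightarrow> l) at_bot"
    "\<exists>l. (f \<longlongrightarrow> l) (at_left x)" "\<exists>l. (f \<longlongrightarrow> l) (at_right x)"
proof -
  obtain C where C: "\<And>x. \<bar>f x\<bar> \<le> C" using f(2) unfolding bounded_range_real_iff by metis
  have bdd: "bdd_above (f ` S)" "bdd_below (f ` S)" for S
  proof -
    have "f x \<le> C" "- C \<le> f x" for x using C[of x] by linarith+
    then show "bdd_above (f ` S)" "bdd_below (f ` S)" by (auto intro!: bdd_aboveI[of _ C] bdd_belowI[of _ "- C"])
  qed
  have "(f \<longlongrightarrow> Sup (f ` UNIV)) at_top"
  proof (rule increasing_tendsto)
    show "\<forall>\<^sub>F y in at_top. f y \<le> Sup (f ` UNIV)" by (simp add: cSup_upper bdd)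
    fix c assume "c < Sup (f ` UNIV)"
    then obtain y where y: "c < f y" by (subst (asm) less_cSup_iff) (auto simp: bdd)
    show "\<forall>\<^sub>F z in at_top. c < f z"
      by (rule eventually_mono[OF eventually_ge_at_top[of y]]) (rule less_le_trans[OF y monoD[OF f(1)]])
  qed
  then show "\<exists>l. (f \<longlongrightarrow> l) at_top" by blast
  have "(f \<longlongrightarrow> Inf (f ` UNIV)) at_bot"
  proof (rule decreasing_tendsto)
    show "\<forall>\<^sub>F y in at_bot. Inf (f ` UNIV) \<le> f y" by (simp add: cInf_lower bdd)
    fix c assume "Inf (f ` UNIV) < c"
    then obtain y where y: "f y < c" by (subst (asm) cInf_less_iff) (auto simp: bdd)
    show "\<forall>\<^sub>F z in at_bot. f z < c"
      by (rule eventually_mono[OF eventually_le_at_bot[of y]]) (rule le_less_trans[OF monoD[OF f(1)] y])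
  qed
  then show "\<exists>l. (f \<longlongrightarrow> l) at_bot" by blast
  have "(f \<longlongrightarrow> Sup (f ` {..<x})) (at_left x)"
  proof (rule increasing_tendsto)
    show "\<forall>\<^sub>F y in at_left x. f y \<le> Sup (f ` {..<x})"
      unfolding eventually_at_filter by (auto intro!: cSup_upper bdd always_eventually)
    fix c assume "c < Sup (f ` {..<x})"
    then obtain y where y: "y < x" "c < f y" by (subst (asm) less_cSup_iff) (auto simp: bdd)
    show "\<forall>\<^sub>F z in at_left x. c < f z"
      by (rule eventually_mono[OF eventually_at_left_real[OF y(1)]]) (simp add: less_le_trans[OF y(2) monoD[OF f(1)]])
  qed
  then show "\<exists>l. (f \<longlongrightarrow> l) (at_left x)" by blast
  have "(f \<longlongrightarrow> Inf (f ` {x<..})) (at_right x)"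
  proof (rule decreasing_tendsto)
    show "\<forall>\<^sub>F y in at_right x. Inf (f ` {x<..}) \<le> f y"
      unfolding eventually_at_filter by (auto intro!: cInf_lower bdd always_eventually)
    fix c assume "Inf (f ` {x<..}) < c"
    then obtain y where y: "x < y" "f y < c" by (subst (asm) cInf_less_iff) (auto simp: bdd)
    show "\<forall>\<^sub>F z in at_right x. f z < c"
      by (rule eventually_mono[OF eventually_at_right_real[OF y(1)]]) (simp add: le_less_trans[OF monoD[OF f(1)] y(2)])
  qed
  then show "\<exists>l. (f \<longlongrightarrow> l) (at_right x)" by blast
qed

text \<open>
  If \<open>W\<close> is a witness for \<open>g\<close>, then \<open>g = (W + g) - W\<close> is a difference of bounded monotone functions.
\<close>

lemma bv_tendsto:
  assumes "bv g"
  shows "(g \<longlongrightarrow> Lim at_top g) at_top" "(g \<longlongrightarrow> Lim at_bot g) at_bot"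
    "(g \<longlongrightarrow> Lim (at_left x) g) (at_left x)" "(g \<longlongrightarrow> Lim (at_right x) g) (at_right x)"
proof -
  obtain W where W: "mono W" "bounded (range W)" "\<And>x y. x \<le> y \<Longrightarrow> \<bar>g y - g x\<bar> \<le> W y - W x"
    using assms unfolding bv_def by metis
  obtain C where C: "\<And>x. \<bar>W x\<bar> \<le> C" using W(2) unfolding bounded_range_real_iff by metis
  have "mono (\<lambda>x. W x + g x)" 
  proof (rule monoI)
    fix x y :: real assume "x \<le> y" from W(3)[OF this] show "W x + g x \<le> W y + g y" by linarith
  qed
  moreover have "\<bar>g x\<bar> \<le> \<bar>g 0\<bar> + 2 * C" for x
    using W(3)[of 0 x] W(3)[of x 0] C[of x] C[of 0] by (cases "0 \<le> x") auto
  then have "bounded (range g)" unfolding bounded_range_real_iff by blast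
  then have "bounded (range (\<lambda>x. W x + g x))" by (intro bounded_range_add W(2))
  ultimately have m: "mono (\<lambda>x. W x + g x)" "bounded (range (\<lambda>x. W x + g x))" .
  have conv: "(g \<longlongrightarrow> Lim F g) F"
    if F: "F \<noteq> bot" "\<exists>l. (W \<longlongrightarrow> l) F" "\<exists>l. ((\<lambda>x. W x + g x) \<longlongrightarrow> l) F" for F
  proof -
    obtain k l where "(W \<longlongrightarrow> k) F" "((\<lambda>x. W x + g x) \<longlongrightarrow> l) F" using F by blast
    then have "((\<lambda>x. (W x + g x) - W x) \<longlongrightarrow> l - k) F" by (intro tendsto_diff)
    then have "(g \<longlongrightarrow> l - k) F" by simp
    then show ?thesis using tendsto_Lim[OF F(1)] by metis
  qed
  show "(g \<longlongrightarrow> Lim at_top g) at_top" "(g \<longlongrightarrow> Lim at_bot g) at_bot"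
    "(g \<longlongrightarrow> Lim (at_left x) g) (at_left x)" "(g \<longlongrightarrow> Lim (at_right x) g) (at_right x)"
    by (intro conv mono_bounded_tendsto W m; simp)+
qed

section \<open>The height function of a red-blue pair\<close>

text \<open>
  At \<open>-\<infinity>\<close> the red and the blue function agree, so \<open>B - R\<close> has the value 0 there.
\<close>

definition ext0 :: "(real \<Rightarrow> real) \<Rightarrow> ereal \<Rightarrow> real" where
  "ext0 g a = (if a = -\<infinity> then 0 else g (real_of_ereal a))"

lemma ext0_simps [simp]: "ext0 g (-\<infinity>) = 0" "ext0 g (ereal x) = g x"
  by (simp_all add: ext0_def)

text \<open>
  A horizontal segment at height \<open>k\<close> from \<open>a\<close> to \<open>b\<close> that fits under the graph of \<open>g\<close>. It
  automatically meets the completed graph at its ends: there the vertical segment of the graph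
  reaches up to the limit of \<open>g\<close> from inside \<open>(a, b)\<close>, which is at least \<open>k\<close>.
\<close>

definition fits :: "(real \<Rightarrow> real) \<Rightarrow> ereal \<Rightarrow> ereal \<Rightarrow> real \<Rightarrow> bool" where
  "fits g a b k \<longleftrightarrow> ext0 g a \<le> k \<and> ext0 g b \<le> k \<and> (\<forall>x. a < ereal x \<and> ereal x < b \<longrightarrow> k \<le> g x)"

definition level :: "useful_data \<times> useful_data \<Rightarrow> real" where
  "level p = cpart (snd p) 0"

definition height :: "useful_data \<times> useful_data \<Rightarrow> real \<Rightarrow> real" where
  "height p x = level p - uf_val (fst p) x"

definition height_function :: "(real \<Rightarrow> real) \<Rightarrow> bool" where
  "height_function g \<longleftrightarrow> (\<forall>x. 0 \<le> g x) \<and> bv g \<and>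
     (\<forall>x c. c < g x \<longrightarrow> (\<forall>\<^sub>F y in nhds x. c < g y)) \<and> (g \<longlongrightarrow> 0) at_top"

lemma finite_side_values: "finite (side_values D x)" "uf_ext D x \<in> side_values D x"
  by (auto simp: side_values_def)

lemma uf_min_le_ext: "uf_min D x \<le> uf_ext D x" and uf_ext_le_max: "uf_ext D x \<le> uf_max D x"
  using finite_side_values[of D x] by (auto simp: uf_min_def uf_max_def)

lemma uf_min_le_uf_max: "uf_min D x \<le> uf_max D x"
  using uf_min_le_ext uf_ext_le_max by (rule order_trans)

lemma uf_const:
  assumes "\<And>z. uf_val D z = c" "up D (-\<infinity>) = 0" "um D \<infinity> = 0"
  shows "uf_ext D x = c" "uf_min D x = c" "uf_max D x = c"
proof -
  have v: "uf_val D = (\<lambda>_. c)" using assms(1) by auto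
  have "Lim at_bot (uf_val D) = c" "Lim at_top (uf_val D) = c"
    "Lim (at_left t) (uf_val D) = c" "Lim (at_right t) (uf_val D) = c" for t :: real
    unfolding v by (auto intro!: tendsto_Lim)
  then have s: "side_values D x = {c}" and e: "uf_ext D x = c"
    using assms by (auto simp: side_values_def uf_ext_def)
  from e show "uf_ext D x = c" .
  show "uf_min D x = c" "uf_max D x = c" by (simp_all add: uf_min_def uf_max_def s)
qed

lemma red_blue_pair_blue:
  assumes "red_blue_pair p"
  shows "uf_val (snd p) z = level p" "uf_ext (snd p) x = level p"
    "uf_min (snd p) x = level p" "uf_max (snd p) x = level p"
proof -
  obtain R B where p: "p = (R, B)" by (cases p)
  note rb = assms[unfolded red_blue_pair_def p, simplified]
  obtain c where c: "\<And>x. cpart B x = c" using rb by blast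
  have um: "um B x = 0" if "x \<noteq> -\<infinity>" for x using rb that by (cases x) auto
  have up: "up B x = 0" if "x \<noteq> \<infinity>" for x using rb that by (cases x) auto
  have v: "uf_val B z = c" for z
  proof -
    have "(\<Sum>\<^sub>\<infinity>x\<in>{x. x \<noteq> -\<infinity>}. um B x * delta_minus x z) = 0" by (rule infsum_0) (simp add: um)
    moreover have "(\<Sum>\<^sub>\<infinity>x\<in>{x. x \<noteq> \<infinity>}. up B x * delta_plus x z) = 0" by (rule infsum_0) (simp add: up)
    ultimately show ?thesis by (simp add: uf_val_def c)
  qed
  have "level p = c" using c p by (simp add: level_def)
  then show "uf_val (snd p) z = level p" "uf_ext (snd p) x = level p"
    "uf_min (snd p) x = level p" "uf_max (snd p) x = level p"
    using v uf_const[of B c x] um up p by simp_all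
qed

lemma red_blue_pair_red:
  assumes "red_blue_pair p"
  shows "useful (fst p)" "uf_ext (fst p) x \<le> level p"
    "uf_max (fst p) (ereal y) = uf_val (fst p) y"
    "uf_ext (fst p) (-\<infinity>) = level p" "uf_ext (fst p) \<infinity> = level p" "um (fst p) \<infinity> = 0"
  using red_blue_pair_blue[OF assms] assms by (cases p; force simp: red_blue_pair_def)+

text \<open>
  Lower semicontinuity is the condition \<open>R_max = R\<close>: neither one-sided limit of \<open>R\<close> exceeds its
  value.
\<close>

lemma height_function_height:
  assumes "red_blue_pair p" shows "height_function (height p)"
proof -
  let ?r = "uf_val (fst p)" and ?g = "height p"
  have bv: "bv ?r" by (intro bv_uf_val red_blue_pair_red assms)
  note lim = bv_tendsto[OF bv]
  have "0 \<le> ?g x" for x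
    using red_blue_pair_red(2)[OF assms, of "ereal x"] by (simp add: height_def uf_ext_def)
  moreover have "bv ?g" using bv_diff_const[OF bv] by (simp add: height_def[abs_def])
  moreover have "\<forall>\<^sub>F y in nhds x. c < ?g y" if c: "c < ?g x" for x c
  proof -
    have "Lim (at_left x) ?r \<le> ?r x" "Lim (at_right x) ?r \<le> ?r x"
      using red_blue_pair_red(3)[OF assms, of x] finite_side_values(1)[of "fst p" "ereal x"]
      by (auto simp: uf_max_def side_values_def)
    moreover have "?r x < level p - c" using c by (simp add: height_def)
    ultimately have "Lim (at_left x) ?r < level p - c" "Lim (at_right x) ?r < level p - c" by linarith+
    then have "\<forall>\<^sub>F y in at_left x. ?r y < level p - c" "\<forall>\<^sub>F y in at_right x. ?r y < level p - c"
      using order_tendstoD(2)[OF lim(3)] order_tendstoD(2)[OF lim(4)] by blast+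
    then have "\<forall>\<^sub>F y in at x. ?r y < level p - c" by (simp add: eventually_at_split)
    then have "\<forall>\<^sub>F y in nhds x. ?r y < level p - c"
      using \<open>?r x < level p - c\<close> by (simp add: eventually_nhds_conv_at)
    then show ?thesis by eventually_elim (simp add: height_def)
  qed
  moreover have "(?g \<longlongrightarrow> 0) at_top"
  proof -
    have "Lim at_top ?r = level p"
      using red_blue_pair_red(5,6)[OF assms] by (simp add: uf_ext_def)
    then have "((\<lambda>x. level p - ?r x) \<longlongrightarrow> level p - level p) at_top"
      using lim(1) by (intro tendsto_diff tendsto_const) simp
    then show ?thesis by (simp add: height_def[abs_def])
  qed
  ultimately show ?thesis by (simp add: height_function_def)
qed

lemma uf_max_red:
  assumes "red_blue_pair p" "x \<noteq> \<infinity>"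
  shows "uf_max (fst p) x = level p - ext0 (height p) x"
proof (cases x)
  case (real r)
  then show ?thesis using red_blue_pair_red(3)[OF assms(1)] by (simp add: height_def)
next
  case MInf
  have "\<forall>x. uf_val (fst p) x \<le> level p"
    using red_blue_pair_red(2)[OF assms(1), of "ereal x" for x] by (simp add: uf_ext_def)
  then have "Lim at_bot (uf_val (fst p)) \<le> level p"
    by (intro tendsto_upperbound[OF bv_tendsto(2)[OF bv_uf_val[OF red_blue_pair_red(1)[OF assms(1)]]]]) auto
  then show ?thesis using MInf red_blue_pair_red(4)[OF assms(1)]
    by (simp add: uf_max_def side_values_def)
qed (use assms in simp)

lemma mod_graph_iff:
  assumes "a \<noteq> \<infinity>"
  shows "(a, h) \<in> mod_graph p \<longleftrightarrow> uf_min (fst p) a \<le> h \<and> h \<le> uf_max (fst p) a"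
  using assms by (cases p; cases a) (auto simp: mod_graph_def graph_def graph_bar_def)

lemma mod_graph_imp_ext0_le:
  assumes "red_blue_pair p" "a \<noteq> \<infinity>" "(a, h) \<in> mod_graph p"
  shows "ext0 (height p) a \<le> level p - h"
  using assms uf_max_red[OF assms(1,2)] by (simp add: mod_graph_iff)

text \<open>
  Only the ends need an argument: the modified graph at an end contains the interval between the
  value of \<open>R\<close> and its limit from inside, hence every level that \<open>R\<close> does not exceed on \<open>(a, b)\<close>.
\<close>

lemma semistable_at_iff:
  assumes p: "red_blue_pair p" and ab: "a < b" "b < \<infinity>"
  shows "semistable_at p a b h \<longleftrightarrow> fits (height p) a b (level p - h)"
proof -
  let ?r = "uf_val (fst p)" and ?g = "height p"
  have n: "a \<noteq> \<infinity>" "b \<noteq> \<infinity>" "b \<noteq> -\<infinity>" using ab by auto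
  obtain b' where b': "b = ereal b'" using n by (cases b) auto
  note lim = bv_tendsto[OF bv_uf_val[OF red_blue_pair_red(1)[OF p]]]
  have g0: "0 \<le> ext0 ?g a"
    using height_function_height[OF p] by (simp add: ext0_def height_function_def)
  have between: "{a..b} - {a, b} = ereal ` {x. a < ereal x \<and> ereal x < b}"
  proof (intro equalityI subsetI)
    fix x assume "x \<in> {a..b} - {a, b}"
    then have x: "a < x" "x < b" by auto
    then obtain t where "x = ereal t" using n by (cases x) auto
    then show "x \<in> ereal ` {x. a < ereal x \<and> ereal x < b}" using x by auto
  qed auto
  have mid: "(\<forall>x\<in>{a..b} - {a, b}. uf_max (fst p) x \<le> h \<and> h \<le> uf_min (snd p) x)
      \<longleftrightarrow> (\<forall>x. a < ereal x \<and> ereal x < b \<longrightarrow> level p - h \<le> ?g x)" if "h \<le> level p"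
    using that unfolding between by (auto simp: red_blue_pair_blue[OF p] uf_max_red[OF p])
  have ends: "(a, h) \<in> mod_graph p \<and> (b, h) \<in> mod_graph p"
    if c: "fits ?g a b (level p - h)"
  proof -
    have g: "level p - h \<le> ?g x" if "a < ereal x" "ereal x < b" for x using c that by (simp add: fits_def)
    have r: "?r x \<le> h" if "a < ereal x" "ereal x < b" for x using g[OF that] by (simp add: height_def)
    have "Lim (at_left b') ?r \<le> h"
    proof (rule tendsto_upperbound[OF lim(3)])
      obtain z where z: "a < ereal z" "z < b'" using ereal_dense3[OF ab(1)] b' by auto
      show "\<forall>\<^sub>F x in at_left b'. ?r x \<le> h"
        by (rule eventually_mono[OF eventually_at_left_real[OF z(2)]])
          (use z b' in \<open>auto intro!: r intro: less_trans\<close>)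
    qed simp
    then have "uf_min (fst p) b \<le> h"
      by (auto simp: uf_min_def side_values_def b' Min_le_iff)
    moreover have "uf_min (fst p) a \<le> h"
    proof (cases a)
      case (real a')
      have "Lim (at_right a') ?r \<le> h"
      proof (rule tendsto_upperbound[OF lim(4)])
        have "a' < b'" using ab real b' by simp
        show "\<forall>\<^sub>F x in at_right a'. ?r x \<le> h"
          by (rule eventually_mono[OF eventually_at_right_real[OF \<open>a' < b'\<close>]])
            (use real b' in \<open>auto intro!: r\<close>)
      qed simp
      then show ?thesis by (auto simp: uf_min_def side_values_def real Min_le_iff)
    next
      case MInf
      have "Lim at_bot ?r \<le> h"
      proof (rule tendsto_upperbound[OF lim(2)])
        show "\<forall>\<^sub>F x in at_bot. ?r x \<le> h"
          by (rule eventually_mono[OF eventually_gt_at_bot[of b', folded eventually_at_bot_dense]])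
            (use MInf b' in \<open>auto intro!: r\<close>)
      qed simp
      then show ?thesis by (auto simp: uf_min_def side_values_def MInf Min_le_iff)
    qed (use n in simp)
    ultimately show ?thesis
      using c by (simp add: mod_graph_iff n uf_max_red[OF p] fits_def)
  qed
  show ?thesis
  proof
    assume s: "semistable_at p a b h"
    then have e: "ext0 ?g a \<le> level p - h" "ext0 ?g b \<le> level p - h"
      using mod_graph_imp_ext0_le[OF p] n by (auto simp: semistable_at_def)
    then have "h \<le> level p" using g0 by linarith
    then show "fits ?g a b (level p - h)" using s e mid by (simp add: semistable_at_def fits_def)
  next
    assume c: "fits ?g a b (level p - h)"
    then have "h \<le> level p" using g0 by (simp add: fits_def)
    then show "semistable_at p a b h" using mid ends[OF c] c by (simp add: semistable_at_def fits_def)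
  qed
qed

lemma vtrans_graph_bar_iff:
  "vtrans c ` graph_bar D = graph_bar D' \<longleftrightarrow>
    (\<forall>x. uf_min D' x = uf_min D x + c \<and> uf_max D' x = uf_max D x + c)"
proof -
  have mem: "(x, y) \<in> vtrans c ` graph_bar D \<longleftrightarrow> uf_min D x + c \<le> y \<and> y \<le> uf_max D x + c" for x y
  proof
    assume "uf_min D x + c \<le> y \<and> y \<le> uf_max D x + c"
    then have "(x, y) = vtrans c (x, y - c)" "(x, y - c) \<in> graph_bar D"
      by (auto simp: vtrans_def graph_bar_def)
    then show "(x, y) \<in> vtrans c ` graph_bar D" by (metis imageI)
  qed (auto simp: vtrans_def graph_bar_def)
  have "vtrans c ` graph_bar D = graph_bar D' \<longleftrightarrow>
      (\<forall>x. {uf_min D x + c..uf_max D x + c} = {uf_min D' x..uf_max D' x})"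
    unfolding set_eq_iff split_paired_All mem by (simp add: graph_bar_def)
  also have "\<dots> \<longleftrightarrow> (\<forall>x. uf_min D' x = uf_min D x + c \<and> uf_max D' x = uf_max D x + c)"
    using uf_min_le_uf_max by (auto simp: Icc_eq_Icc)
  finally show ?thesis .
qed

text \<open>
  The height function is a complete invariant: \<open>R\<close> can be read off from its graph as the upper
  boundary, and conversely the graphs over \<open>-\<infinity>\<close> and \<open>\<infinity>\<close> are determined by \<open>R\<close> on \<open>\<real>\<close>, since there
  \<open>R\<close> takes the constant value of \<open>B\<close>.
\<close>

lemma rb_rel_iff:
  "(p, p') \<in> rb_rel \<longleftrightarrow> red_blue_pair p \<and> red_blue_pair p' \<and> height p = height p'"
proof -
  have "(\<exists>c. vtrans c ` graph_bar (fst p) = graph_bar (fst p') \<and> vtrans c ` graph_bar (snd p) = graph_bar (snd p'))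
      \<longleftrightarrow> height p = height p'" if p: "red_blue_pair p" and p': "red_blue_pair p'"
  proof
    assume "\<exists>c. vtrans c ` graph_bar (fst p) = graph_bar (fst p') \<and> vtrans c ` graph_bar (snd p) = graph_bar (snd p')"
    then obtain c where c: "\<And>x. uf_max (fst p') x = uf_max (fst p) x + c" "\<And>x. uf_max (snd p') x = uf_max (snd p) x + c"
      unfolding vtrans_graph_bar_iff by blast
    have "level p' = level p + c" using c(2)[of 0] by (simp add: red_blue_pair_blue p p')
    moreover have "uf_val (fst p') x = uf_val (fst p) x + c" for x
      using c(1)[of "ereal x"] by (simp add: red_blue_pair_red(3) p p')
    ultimately show "height p = height p'" by (simp add: height_def fun_eq_iff)
  next
    assume eq: "height p = height p'"
    define c where "c = level p' - level p"
    have r: "uf_val (fst p') = (\<lambda>x. uf_val (fst p) x + c)"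
      using eq unfolding height_def fun_eq_iff c_def by (simp add: algebra_simps)
    have Lim: "Lim F (uf_val (fst p')) = Lim F (uf_val (fst p)) + c"
      if "(uf_val (fst p) \<longlongrightarrow> Lim F (uf_val (fst p))) F" "F \<noteq> bot" for F
      unfolding r using that by (intro tendsto_Lim tendsto_add tendsto_const)
    note lim = bv_tendsto[OF bv_uf_val[OF red_blue_pair_red(1)[OF p]]]
    have e: "uf_ext (fst p') x = uf_ext (fst p) x + c" for x
      using red_blue_pair_red(4,5)[OF p] red_blue_pair_red(4,5)[OF p']
      by (cases x) (auto simp: c_def uf_ext_def r)
    have s: "side_values (fst p') x = (\<lambda>y. y + c) ` side_values (fst p) x" for x
      by (auto simp: side_values_def e Lim lim)
    have "uf_min (fst p') x = uf_min (fst p) x + c \<and> uf_max (fst p') x = uf_max (fst p) x + c" for x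
      unfolding uf_min_def uf_max_def s using finite_side_values[of "fst p" x]
      by (metis add.commute add_right_mono empty_iff monoI mono_Max_commute mono_Min_commute)
    moreover have "uf_min (snd p') x = uf_min (snd p) x + c \<and> uf_max (snd p') x = uf_max (snd p) x + c" for x
      by (simp add: red_blue_pair_blue p p' c_def)
    ultimately show "\<exists>c. vtrans c ` graph_bar (fst p) = graph_bar (fst p') \<and> vtrans c ` graph_bar (snd p) = graph_bar (snd p')"
      unfolding vtrans_graph_bar_iff by blast
  qed
  then show ?thesis by (cases p; cases p') (auto simp: rb_rel_def)
qed

section \<open>Distribution functions on the extended line\<close>

lemma has_sum_measure_singletons:
  assumes "finite_measure P" "\<And>x. x \<in> C \<Longrightarrow> {x} \<in> sets P" "countable C"
  shows "((\<lambda>x. measure P {x}) has_sum measure P C) C"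
proof -
  interpret finite_measure P by fact
  show ?thesis
  proof (cases "finite C")
    case True
    then have "measure P C = (\<Sum>x\<in>C. measure P {x})"
      using assms by (intro finite_measure_eq_sum_singleton) auto
    then show ?thesis using True by (simp add: has_sum_finite)
  next
    case False
    let ?f = "from_nat_into C"
    have bij: "bij_betw ?f UNIV C" using bij_betw_from_nat_into[OF assms(3) False] .
    have inC: "?f i \<in> C" for i using bij by (auto simp: bij_betw_def)
    have "(\<lambda>i. measure P {?f i}) sums measure P (\<Union>i. {?f i})"
    proof (rule finite_measure_UNION)
      show "range (\<lambda>i. {?f i}) \<subseteq> sets P" using inC assms(2) by auto
      show "disjoint_family (\<lambda>i. {?f i})"
        using bij by (auto simp: disjoint_family_on_def bij_betw_def inj_on_def)
    qed
    moreover have "(\<Union>i. {?f i}) = C" using bij by (auto simp: bij_betw_def)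
    ultimately have s: "(\<lambda>i. measure P {?f i}) sums measure P C" by simp
    have "((\<lambda>i. measure P {?f i}) has_sum measure P C) UNIV"
      using s by (intro sums_nonneg_imp_has_sum) auto
    then show ?thesis using has_sum_reindex_bij_betw[OF bij, of "\<lambda>x. measure P {x}"] by simp
  qed
qed

text \<open>
  Only countably many points carry mass, so the sum over an arbitrary set reduces to countable
  additivity.
\<close>

lemma has_sum_atoms:
  assumes P: "finite_measure P" "\<And>x. {x} \<in> sets P"
  shows "((\<lambda>x. measure P {x}) has_sum measure P (X \<inter> {x. measure P {x} \<noteq> 0})) X"
proof -
  let ?D = "{x. measure P {x} \<noteq> 0}"
  have "countable ?D" using finite_measure.countable_support[OF P(1)] .
  then have "((\<lambda>x. measure P {x}) has_sum measure P (X \<inter> ?D)) (X \<inter> ?D)"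
    by (intro has_sum_measure_singletons P countable_Int2)
  then show ?thesis by (subst (asm) has_sum_cong_neutral[where T = X and g = "\<lambda>x. measure P {x}"]) auto
qed

lemma tendsto_at_bot_mono:
  fixes f :: "real \<Rightarrow> real"
  assumes "mono f" "(\<lambda>n. f (- real n)) \<longlonglongrightarrow> l" shows "(f \<longlongrightarrow> l) at_bot"
proof -
  have "((\<lambda>x. - f (- x)) \<longlongrightarrow> - l) at_top"
  proof (rule tendsto_at_topI_sequentially_real)
    show "mono (\<lambda>x. - f (- x))" using assms(1) by (auto simp: mono_def)
    show "(\<lambda>n. - f (- real n)) \<longlonglongrightarrow> - l" by (intro tendsto_minus assms)
  qed
  then have "((\<lambda>x. f (- x)) \<longlongrightarrow> l) at_top" by (simp add: tendsto_minus_cancel_left)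
  then show ?thesis by (simp add: filterlim_at_bot_mirror)
qed

lemma
  fixes Q :: "ereal measure"
  assumes Q: "finite_measure Q" "sets Q = sets borel"
  shows tendsto_measure_lessThan_left: "((\<lambda>y. measure Q {..<ereal y}) \<longlongrightarrow> measure Q {..<ereal x}) (at_left x)"
    and tendsto_measure_atMost_right: "((\<lambda>y. measure Q {..ereal y}) \<longlongrightarrow> measure Q {..ereal x}) (at_right x)"
    and tendsto_measure_lessThan_top: "((\<lambda>y. measure Q {..<ereal y}) \<longlongrightarrow> measure Q {..<\<infinity>}) at_top"
    and tendsto_measure_atMost_top: "((\<lambda>y. measure Q {..ereal y}) \<longlongrightarrow> measure Q {..<\<infinity>}) at_top"
    and tendsto_measure_lessThan_bot: "((\<lambda>y. measure Q {..<ereal y}) \<longlongrightarrow> measure Q {-\<infinity>}) at_bot"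
    and tendsto_measure_atMost_bot: "((\<lambda>y. measure Q {..ereal y}) \<longlongrightarrow> measure Q {-\<infinity>}) at_bot"
    and mono_measure_lessThan: "mono (\<lambda>y. measure Q {..<ereal y})"
    and mono_measure_atMost: "mono (\<lambda>y. measure Q {..ereal y})"
proof -
  interpret finite_measure Q by fact
  show m1: "mono (\<lambda>y. measure Q {..<ereal y})" and m2: "mono (\<lambda>y. measure Q {..ereal y})"
    using Q(2) by (intro monoI finite_measure_mono; simp)+
  have inc: "(\<lambda>n. measure Q {..<ereal (S n)}) \<longlonglongrightarrow> measure Q (\<Union>n. {..<ereal (S n)})"
    "(\<lambda>n. measure Q {..ereal (S n)}) \<longlonglongrightarrow> measure Q (\<Union>n. {..ereal (S n)})" if "incseq S" for S :: "nat \<Rightarrow> real"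
    using Q(2) that by (intro finite_Lim_measure_incseq; auto simp: mono_def monotone_def)+
  have dec: "(\<lambda>n. measure Q {..<ereal (S n)}) \<longlonglongrightarrow> measure Q (\<Inter>n. {..<ereal (S n)})"
    "(\<lambda>n. measure Q {..ereal (S n)}) \<longlonglongrightarrow> measure Q (\<Inter>n. {..ereal (S n)})" if "decseq S" for S :: "nat \<Rightarrow> real"
    using Q(2) that by (intro finite_Lim_measure_decseq; auto simp: mono_def monotone_def)+
  have nn: "incseq real" "decseq (\<lambda>n. - real n)" by (auto simp: incseq_def decseq_def)
  show "((\<lambda>y. measure Q {..<ereal y}) \<longlongrightarrow> measure Q {..<ereal x}) (at_left x)"
  proof (rule tendsto_at_left_sequentially[of "x - 1"])
    fix S :: "nat \<Rightarrow> real" assume S: "\<And>n. S n < x" "S \<longlonglongrightarrow> x" "incseq S"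
    have "(\<Union>n. {..<ereal (S n)}) = {..<ereal x}"
    proof (intro equalityI subsetI)
      fix z assume "z \<in> {..<ereal x}"
      moreover have "(\<lambda>n. ereal (S n)) \<longlonglongrightarrow> ereal x" using S(2) by simp
      ultimately have "\<forall>\<^sub>F n in sequentially. z < ereal (S n)" by (intro order_tendstoD(1)) auto
      then show "z \<in> (\<Union>n. {..<ereal (S n)})" by (auto simp: eventually_sequentially)
    next
      fix z assume "z \<in> (\<Union>n. {..<ereal (S n)})"
      then obtain n where "z < ereal (S n)" by auto
      also have "ereal (S n) < ereal x" using S(1) by simp
      finally show "z \<in> {..<ereal x}" by simp
    qed
    moreover have "(\<lambda>n. measure Q {..<ereal (S n)}) \<longlonglongrightarrow> measure Q (\<Union>n. {..<ereal (S n)})"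
      by (rule inc(1)[OF S(3)])
    ultimately show "(\<lambda>n. measure Q {..<ereal (S n)}) \<longlonglongrightarrow> measure Q {..<ereal x}" by simp
  qed simp
  show "((\<lambda>y. measure Q {..ereal y}) \<longlongrightarrow> measure Q {..ereal x}) (at_right x)"
  proof (rule tendsto_at_right_sequentially[of _ "x + 1"])
    fix S :: "nat \<Rightarrow> real" assume S: "\<And>n. x < S n" "S \<longlonglongrightarrow> x" "decseq S"
    have "(\<Inter>n. {..ereal (S n)}) = {..ereal x}"
    proof (intro equalityI subsetI)
      fix z assume z: "z \<in> (\<Inter>n. {..ereal (S n)})"
      have "(\<lambda>n. ereal (S n)) \<longlonglongrightarrow> ereal x" using S(2) by simp
      then have "z \<le> ereal x" by (rule LIMSEQ_le_const) (use z in auto)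
      then show "z \<in> {..ereal x}" by simp
    next
      fix z assume "z \<in> {..ereal x}"
      then have "z \<le> ereal x" by simp
      also have "ereal x \<le> ereal (S n)" for n using S(1)[of n] by simp
      finally show "z \<in> (\<Inter>n. {..ereal (S n)})" by simp
    qed
    moreover have "(\<lambda>n. measure Q {..ereal (S n)}) \<longlonglongrightarrow> measure Q (\<Inter>n. {..ereal (S n)})"
      by (rule dec(2)[OF S(3)])
    ultimately show "(\<lambda>n. measure Q {..ereal (S n)}) \<longlonglongrightarrow> measure Q {..ereal x}" by simp
  qed simp
  have top: "\<exists>n. z < ereal (real n)" if "z < \<infinity>" for z
    using that reals_Archimedean2 by (cases z) auto
  have U1: "(\<Union>n. {..<ereal (real n)}) = {..<\<infinity>}" using top by auto
  have U2: "(\<Union>n. {..ereal (real n)}) = {..<\<infinity>}"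
  proof (intro equalityI subsetI)
    fix z :: ereal assume "z \<in> {..<\<infinity>}"
    then obtain n where "z < ereal (real n)" using top[of z] by auto
    then show "z \<in> (\<Union>n. {..ereal (real n)})" using less_imp_le by blast
  qed auto
  have bot: "z = -\<infinity>" if "\<And>n. z \<le> ereal (- real n)" for z
  proof (cases z)
    case (real r)
    obtain n where "- r < real n" using reals_Archimedean2 by blast
    then show ?thesis using that[of n] real by simp
  qed (use that[of 0] in auto)
  have I1: "(\<Inter>n. {..<ereal (- real n)}) = {-\<infinity>}" 
  proof (intro equalityI subsetI)
    fix z :: ereal assume "z \<in> (\<Inter>n. {..<ereal (- real n)})"
    then have "z \<le> ereal (- real n)" for n by (intro less_imp_le) blast
    then show "z \<in> {-\<infinity>}" using bot by blast
  qed auto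
  have I2: "(\<Inter>n. {..ereal (- real n)}) = {-\<infinity>}" 
  proof (intro equalityI subsetI)
    fix z :: ereal assume "z \<in> (\<Inter>n. {..ereal (- real n)})"
    then have "z \<le> ereal (- real n)" for n by blast
    then show "z \<in> {-\<infinity>}" using bot by blast
  qed auto
  have "(\<lambda>n. measure Q {..<ereal (real n)}) \<longlonglongrightarrow> measure Q (\<Union>n. {..<ereal (real n)})"
    by (rule inc(1)[OF nn(1)])
  then show "((\<lambda>y. measure Q {..<ereal y}) \<longlongrightarrow> measure Q {..<\<infinity>}) at_top"
    unfolding U1 by (rule tendsto_at_topI_sequentially_real[OF m1])
  have "(\<lambda>n. measure Q {..ereal (real n)}) \<longlonglongrightarrow> measure Q (\<Union>n. {..ereal (real n)})"
    by (rule inc(2)[OF nn(1)])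
  then show "((\<lambda>y. measure Q {..ereal y}) \<longlongrightarrow> measure Q {..<\<infinity>}) at_top"
    unfolding U2 by (rule tendsto_at_topI_sequentially_real[OF m2])
  have "(\<lambda>n. measure Q {..<ereal (- real n)}) \<longlonglongrightarrow> measure Q (\<Inter>n. {..<ereal (- real n)})"
    by (rule dec(1)[OF nn(2)])
  then show "((\<lambda>y. measure Q {..<ereal y}) \<longlongrightarrow> measure Q {-\<infinity>}) at_bot"
    unfolding I1 by (rule tendsto_at_bot_mono[OF m1])
  have "(\<lambda>n. measure Q {..ereal (- real n)}) \<longlonglongrightarrow> measure Q (\<Inter>n. {..ereal (- real n)})"
    by (rule dec(2)[OF nn(2)])
  then show "((\<lambda>y. measure Q {..ereal y}) \<longlongrightarrow> measure Q {-\<infinity>}) at_bot"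
    unfolding I2 by (rule tendsto_at_bot_mono[OF m2])
qed

definition diffuse_cdf :: "ereal measure \<Rightarrow> real \<Rightarrow> real" where
  "diffuse_cdf P y = measure P ({..ereal y} - {x. measure P {x} \<noteq> 0})"

text \<open>
  Restricting \<open>P\<close> to the complement of its atoms gives a measure whose distribution function is both
  left and right continuous, since a single point has measure zero.
\<close>

lemma diffuse_cdf:
  fixes P :: "ereal measure"
  assumes P: "finite_measure P" "sets P = sets borel"
  shows "diffuse_cdf P y = measure P {..ereal y} - (\<Sum>\<^sub>\<infinity>x\<in>{x. x \<le> ereal y}. measure P {x})"
    and "diffuse_cdf P y = measure P {..<ereal y} - (\<Sum>\<^sub>\<infinity>x\<in>{x. x < ereal y}. measure P {x})"
    and "continuous_on UNIV (diffuse_cdf P)" "bv (diffuse_cdf P)"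
proof -
  interpret finite_measure P by fact
  let ?D = "{x. measure P {x} \<noteq> 0}"
  have cD: "countable ?D" by (rule countable_support)
  have D: "?D \<in> sets P" using sets.countable[of ?D P] cD P(2) by simp
  have sum: "(\<Sum>\<^sub>\<infinity>x\<in>X. measure P {x}) = measure P (X \<inter> ?D)" for X
    by (rule infsumI[OF has_sum_atoms]) (use P in auto)
  have diff: "measure P X - (\<Sum>\<^sub>\<infinity>x\<in>X. measure P {x}) = measure P (X - ?D)" if "X \<in> sets P" for X
    unfolding sum using finite_measure_Diff'[OF that D] by simp
  show 1: "diffuse_cdf P y = measure P {..ereal y} - (\<Sum>\<^sub>\<infinity>x\<in>{x. x \<le> ereal y}. measure P {x})" for y
    using diff[of "{..ereal y}"] P(2) by (simp add: diffuse_cdf_def atMost_def)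
  have less: "diffuse_cdf P y = measure P ({..<ereal y} - ?D)" for y
  proof (cases "measure P {ereal y} = 0")
    case True
    have "measure P ({..ereal y} - ?D) = measure P (({..<ereal y} - ?D) \<union> {ereal y})"
      by (rule arg_cong[of _ _ "measure P"]) (use True in auto)
    also have "\<dots> = measure P ({..<ereal y} - ?D) + measure P {ereal y}"
      using D P(2) by (intro finite_measure_Union) auto
    finally show ?thesis using True by (simp add: diffuse_cdf_def)
  next
    case False
    then have "{..ereal y} - ?D = {..<ereal y} - ?D" by (auto simp: less_le)
    then show ?thesis by (simp add: diffuse_cdf_def)
  qed
  then show 2: "diffuse_cdf P y = measure P {..<ereal y} - (\<Sum>\<^sub>\<infinity>x\<in>{x. x < ereal y}. measure P {x})" for y
    using diff[of "{..<ereal y}"] P(2) by (simp add: lessThan_def)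
  define Q where "Q = density P (indicator (- ?D))"
  have sQ: "sets Q = sets borel" using P(2) by (simp add: Q_def)
  have mD: "- ?D \<in> sets P" using D P(2) by auto
  have eQ: "emeasure Q X = emeasure P (X - ?D)" if "X \<in> sets borel" for X
    using emeasure_restricted[OF mD, of X] that P(2) unfolding Q_def by (simp add: Int_commute Diff_eq)
  have fQ: "finite_measure Q"
    by (rule finite_measureI) (use eQ[of UNIV] P(2) sets_eq_imp_space_eq[OF sQ] in simp)
  have mQ: "measure Q X = measure P (X - ?D)" if "X \<in> sets borel" for X
    using eQ[OF that] by (simp add: measure_def)
  have q1: "diffuse_cdf P = (\<lambda>y. measure Q {..ereal y})" by (simp add: fun_eq_iff diffuse_cdf_def mQ)
  have q2: "diffuse_cdf P = (\<lambda>y. measure Q {..<ereal y})" by (simp add: fun_eq_iff less mQ)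
  have "(diffuse_cdf P \<longlongrightarrow> diffuse_cdf P y) (at y)" for y
  proof (subst filterlim_at_split, intro conjI)
    show "(diffuse_cdf P \<longlongrightarrow> diffuse_cdf P y) (at_left y)"
      unfolding q2 by (rule tendsto_measure_lessThan_left[OF fQ sQ])
    show "(diffuse_cdf P \<longlongrightarrow> diffuse_cdf P y) (at_right y)"
      unfolding q1 by (rule tendsto_measure_atMost_right[OF fQ sQ])
  qed
  then show "continuous_on UNIV (diffuse_cdf P)" by (simp add: continuous_on_def)
  interpret Q: finite_measure Q by fact
  have "bounded (range (\<lambda>y. measure Q {..ereal y}))"
    unfolding bounded_range_real_iff using Q.bounded_measure by (intro exI[of _ "measure Q (space Q)"]) simp
  then show "bv (diffuse_cdf P)" unfolding q1
    by (rule bv_mono[OF mono_measure_atMost[OF fQ sQ]])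
qed

section \<open>The height function of a measured lamination\<close>

locale measured_lamination =
  fixes L :: "complex set set" and M :: "complex set measure"
  assumes in_measured_laminations: "(L, M) \<in> measured_laminations"
begin

lemma leaves: "L \<subseteq> geodesics"
  and noncrossing: "\<gamma> \<in> L \<Longrightarrow> \<delta> \<in> L \<Longrightarrow> \<not> crossing \<gamma> \<delta>"
  and maximal: "noncrossing_set L' \<Longrightarrow> L \<subseteq> L' \<Longrightarrow> L' = L"
  and space_eq: "space M = L"
  and sets_eq: "sets M = sigma_sets L {U. openin (lam_topology L) U}"
  and O_set_pos: "open_arc A \<Longrightarrow> open_arc B \<Longrightarrow> O_set L A B \<noteq> {} \<Longrightarrow> 0 < emeasure M (O_set L A B)"
  and O_set_finite: "open_arc A \<Longrightarrow> open_arc B \<Longrightarrow> O_set L A B \<noteq> {} \<Longrightarrow> emeasure M (O_set L A B) < \<infinity>"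
  using in_measured_laminations by (auto simp: measured_laminations_def lamination_def noncrossing_set_def)

lemma leafE:
  assumes "\<gamma> \<in> L" obtains a b where "a < b" "b < \<infinity>" "\<gamma> = chord a b" "lo \<gamma> = a" "hi \<gamma> = b"
proof -
  have "\<gamma> \<in> geodesics" using assms leaves by auto
  then obtain a b where "a < b" "b < \<infinity>" "\<gamma> = chord a b" by (rule geodesic_cases)
  then show ?thesis using that[of a b] by simp
qed

lemma leaf_lo_hi:
  assumes "\<gamma> \<in> L" shows "lo \<gamma> < hi \<gamma>" "hi \<gamma> \<noteq> \<infinity>" "hi \<gamma> \<noteq> -\<infinity>" "lo \<gamma> \<noteq> \<infinity>"
proof -
  obtain a b where "a < b" "b < \<infinity>" "lo \<gamma> = a" "hi \<gamma> = b" using leafE[OF assms] .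
  then show "lo \<gamma> < hi \<gamma>" "hi \<gamma> \<noteq> \<infinity>" "hi \<gamma> \<noteq> -\<infinity>" "lo \<gamma> \<noteq> \<infinity>" by auto
qed

lemma leaves_not_interleaved:
  assumes "\<gamma> \<in> L" "\<delta> \<in> L" "lo \<gamma> < lo \<delta>" "lo \<delta> < hi \<gamma>" shows "hi \<delta> \<le> hi \<gamma>"
proof (rule ccontr)
  assume n: "\<not> hi \<delta> \<le> hi \<gamma>"
  obtain a b where 1: "a < b" "b < \<infinity>" "\<gamma> = chord a b" "lo \<gamma> = a" "hi \<gamma> = b" using leafE[OF assms(1)] .
  obtain c d where 2: "c < d" "d < \<infinity>" "\<delta> = chord c d" "lo \<delta> = c" "hi \<delta> = d" using leafE[OF assms(2)] .
  have "crossing \<gamma> \<delta>" using 1 2 assms(3,4) n crossing_chord[OF 1(1,2) 2(1,2)] by auto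
  then show False using noncrossing assms by blast
qed

lemma leaves_over_sets: "leaves_over L x y \<in> sets M"
  unfolding sets_eq by (rule leaves_over_in_sets[OF leaves])

lemma measurable_lo [measurable]: "lo \<in> borel_measurable M"
  and measurable_hi [measurable]: "hi \<in> borel_measurable M"
  by (rule borel_measurable_lo[OF leaves space_eq leaves_over_sets],
      rule borel_measurable_hi[OF leaves space_eq leaves_over_sets])

lemma leaf_sets:
  "Measurable.pred M P \<Longrightarrow> {\<gamma>\<in>L. P \<gamma>} \<in> sets M"
  unfolding pred_def space_eq .

lemma O_set_whole: "O_set L (sphere 0 1) (sphere 0 1) = L"
proof -
  have "\<gamma> \<in> O_set L (sphere 0 1) (sphere 0 1)" if g: "\<gamma> \<in> L" for \<gamma>
  proof -
    obtain a b where "\<gamma> = chord a b" using leafE[OF g] .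
    then show ?thesis using g by (simp add: chord_in_O_set)
  qed
  then show ?thesis by (auto simp: O_set_def)
qed

sublocale finite_measure M
proof (rule finite_measureI)
  show "emeasure M (space M) \<noteq> \<infinity>"
    using O_set_finite[OF open_arc_sphere open_arc_sphere] unfolding O_set_whole space_eq
    by (cases "L = {}") auto
qed

text \<open>
  The height function of the lamination, see \<open>height_lam_useful\<close> below.
\<close>

definition straddle :: "real \<Rightarrow> real" where
  "straddle x = measure M (leaves_over L x x)"

abbreviation leaf_data where "leaf_data \<equiv> lam_useful (L, M)"

lemma lam_fun_eq: "lam_fun (L, M) = (\<lambda>x. - straddle x)"
  by (simp add: lam_fun_def straddle_def leaves_over_def fun_eq_iff)

definition lo_law :: "ereal measure" where "lo_law = distr M borel lo"
definition hi_law :: "ereal measure" where "hi_law = distr M borel hi"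

lemma finite_laws: "finite_measure lo_law" "finite_measure hi_law"
  unfolding lo_law_def hi_law_def by (auto intro!: finite_measure_distr)

lemma sets_laws [simp]: "sets lo_law = sets borel" "sets hi_law = sets borel"
  by (simp_all add: lo_law_def hi_law_def)

lemma measure_laws:
  assumes "X \<in> sets borel"
  shows "measure lo_law X = measure M {\<gamma>\<in>L. lo \<gamma> \<in> X}" "measure hi_law X = measure M {\<gamma>\<in>L. hi \<gamma> \<in> X}"
  using assms by (auto simp: lo_law_def hi_law_def measure_distr space_eq vimage_def Int_def conj_commute)

lemma law_infinity:
  "measure lo_law {\<infinity>} = 0" "measure hi_law {\<infinity>} = 0" "measure hi_law {-\<infinity>} = 0"
proof -
  have z: "measure M {\<gamma>\<in>L. P \<gamma>} = 0" if "\<And>\<gamma>. \<gamma> \<in> L \<Longrightarrow> \<not> P \<gamma>" for P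
  proof -
    have "{\<gamma>\<in>L. P \<gamma>} = {}" using that by blast
    then show ?thesis by (simp only: measure_empty)
  qed
  show "measure lo_law {\<infinity>} = 0" "measure hi_law {\<infinity>} = 0" "measure hi_law {-\<infinity>} = 0"
    by (simp_all add: measure_laws z leaf_lo_hi)
qed

text \<open>
  A leaf that starts left of \<open>x\<close> either passes over \<open>x\<close> or ends at or before \<open>x\<close>.
\<close>

lemma straddle_eq: "straddle x = measure lo_law {..<ereal x} - measure hi_law {..ereal x}"
proof -
  have "{\<gamma>\<in>L. lo \<gamma> < ereal x} = leaves_over L x x \<union> {\<gamma>\<in>L. hi \<gamma> \<le> ereal x}"
    using leaf_lo_hi(1) by (auto simp: leaves_over_def not_less intro: less_le_trans)
  moreover have "measure M (leaves_over L x x \<union> {\<gamma>\<in>L. hi \<gamma> \<le> ereal x})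
      = straddle x + measure M {\<gamma>\<in>L. hi \<gamma> \<le> ereal x}"
    unfolding straddle_def
    by (rule finite_measure_Union[OF leaves_over_sets]) (auto intro!: leaf_sets simp: leaves_over_def)
  ultimately show ?thesis by (simp add: measure_laws)
qed

lemma lam_um_eq: "lam_um (L, M) x = measure hi_law {x}"
  using law_infinity by (auto simp: lam_um_def measure_laws)

lemma lam_up_eq: "lam_up (L, M) x = - measure lo_law {x}"
  using law_infinity by (auto simp: lam_up_def measure_laws)

text \<open>
  Subtracting the jumps of the two distribution functions in \<open>straddle_eq\<close> removes the atoms of the
  two laws.
\<close>

lemma cpart_lam_useful: "cpart leaf_data = (\<lambda>x. diffuse_cdf hi_law x - diffuse_cdf lo_law x)"
proof
  fix x
  have "(\<Sum>\<^sub>\<infinity>y\<in>{y. y < ereal x}. - measure lo_law {y}) = - (\<Sum>\<^sub>\<infinity>y\<in>{y. y < ereal x}. measure lo_law {y})"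
    by (rule infsum_uminus)
  then show "cpart leaf_data x = diffuse_cdf hi_law x - diffuse_cdf lo_law x"
    unfolding diffuse_cdf(1)[OF finite_laws(2) sets_laws(2)] diffuse_cdf(2)[OF finite_laws(1) sets_laws(1)]
    by (simp add: lam_useful_def lam_fun_eq straddle_eq lam_um_eq lam_up_eq)
qed

lemma summable_atoms:
  "(\<lambda>x. \<bar>lam_um (L, M) x\<bar>) summable_on X" "(\<lambda>x. \<bar>lam_up (L, M) x\<bar>) summable_on X"
  using has_sum_atoms[OF finite_laws(1)] has_sum_atoms[OF finite_laws(2)]
  by (auto simp: lam_um_eq lam_up_eq intro!: has_sum_imp_summable)

lemma useful_lam_useful: "useful leaf_data"
proof -
  note hl = diffuse_cdf(3,4)[OF finite_laws(2) sets_laws(2)] and ll = diffuse_cdf(3,4)[OF finite_laws(1) sets_laws(1)]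
  have "continuous_on UNIV (cpart leaf_data)"
    unfolding cpart_lam_useful by (intro continuous_on_diff hl ll)
  moreover have "bounded_variation (cpart leaf_data)"
    using bv_add[OF hl(2) bv_uminus[OF ll(2)]] by (intro bv_imp_bounded_variation) (simp add: cpart_lam_useful)
  moreover have "um leaf_data (-\<infinity>) = 0" "up leaf_data \<infinity> = 0"
    by (simp_all add: lam_useful_def lam_um_def lam_up_def)
  ultimately show ?thesis using summable_atoms by (simp add: useful_def) (simp add: lam_useful_def)
qed

lemma uf_val_eq: "uf_val leaf_data x = measure hi_law {..ereal x} - measure lo_law {..<ereal x}"
  by (simp add: uf_val_lam_useful lam_fun_eq straddle_eq)

text \<open>
  In \<open>straddle_eq\<close> one of the two distribution functions is continuous from the side in question,
  and the other one is monotone in the favourable direction.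
\<close>

lemma Lim_straddle:
  "Lim (at_left x) (uf_val leaf_data) \<le> uf_val leaf_data x"
  "Lim (at_right x) (uf_val leaf_data) \<le> uf_val leaf_data x"
  "Lim at_bot (uf_val leaf_data) = - measure lo_law {-\<infinity>}"
  "Lim at_top (uf_val leaf_data) = 0"
proof -
  let ?F = "uf_val leaf_data"
  note lim = bv_tendsto[OF bv_uf_val[OF useful_lam_useful]]
  note fl = finite_laws(1) sets_laws(1) and fh = finite_laws(2) sets_laws(2)
  note mono = mono_measure_lessThan[OF fl, THEN monoD] mono_measure_atMost[OF fh, THEN monoD]
  show "Lim (at_left x) ?F \<le> ?F x"
  proof (rule tendsto_le[OF _ _ lim(3)])
    show "((\<lambda>y. measure hi_law {..ereal x} - measure lo_law {..<ereal y}) \<longlongrightarrow> ?F x) (at_left x)"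
      unfolding uf_val_eq by (intro tendsto_diff tendsto_const tendsto_measure_lessThan_left[OF fl])
    show "\<forall>\<^sub>F y in at_left x. ?F y \<le> measure hi_law {..ereal x} - measure lo_law {..<ereal y}"
      unfolding eventually_at_filter uf_val_eq using mono(2) by (auto intro!: always_eventually)
  qed simp
  show "Lim (at_right x) ?F \<le> ?F x"
  proof (rule tendsto_le[OF _ _ lim(4)])
    show "((\<lambda>y. measure hi_law {..ereal y} - measure lo_law {..<ereal x}) \<longlongrightarrow> ?F x) (at_right x)"
      unfolding uf_val_eq by (intro tendsto_diff tendsto_const tendsto_measure_atMost_right[OF fh])
    show "\<forall>\<^sub>F y in at_right x. ?F y \<le> measure hi_law {..ereal y} - measure lo_law {..<ereal x}"
      unfolding eventually_at_filter uf_val_eq using mono(1) by (auto intro!: always_eventually)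
  qed simp
  have "(?F \<longlongrightarrow> measure hi_law {-\<infinity>} - measure lo_law {-\<infinity>}) at_bot"
    unfolding uf_val_eq[abs_def]
    by (intro tendsto_diff tendsto_measure_atMost_bot[OF fh] tendsto_measure_lessThan_bot[OF fl])
  then show "Lim at_bot ?F = - measure lo_law {-\<infinity>}"
    using law_infinity by (intro tendsto_Lim) simp_all
  have "{\<gamma>\<in>L. hi \<gamma> < \<infinity>} = {\<gamma>\<in>L. lo \<gamma> < \<infinity>}" using leaf_lo_hi by auto
  then have "measure hi_law {..<\<infinity>} = measure lo_law {..<\<infinity>}" by (simp add: measure_laws)
  moreover have "(?F \<longlongrightarrow> measure hi_law {..<\<infinity>} - measure lo_law {..<\<infinity>}) at_top"
    unfolding uf_val_eq[abs_def]
    by (intro tendsto_diff tendsto_measure_atMost_top[OF fh] tendsto_measure_lessThan_top[OF fl])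
  ultimately show "Lim at_top ?F = 0" by (intro tendsto_Lim) simp_all
qed

lemma red_blue_pair_lam_useful: "red_blue_pair (leaf_data, zero_useful)"
proof -
  let ?D = "leaf_data"
  have z: "uf_val zero_useful x = 0" for x by (simp add: uf_val_def zero_useful_def)
  have zc: "up zero_useful (-\<infinity>) = 0" "um zero_useful \<infinity> = 0" by (simp_all add: zero_useful_def)
  note zero = uf_const[OF z zc]
  have uz: "useful zero_useful"
    by (auto simp: useful_def zero_useful_def bounded_variation_def intro!: exI[of _ 0])
  have uc: "um ?D \<infinity> = 0" "up ?D (-\<infinity>) = - measure lo_law {-\<infinity>}"
    by (simp_all add: lam_useful_def lam_up_eq lam_um_def)
  have ext: "uf_ext ?D (-\<infinity>) = 0" "uf_ext ?D \<infinity> = 0"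
    by (simp_all add: uf_ext_def Lim_straddle uc)
  have ext': "uf_ext ?D x \<le> 0" for x
    using ext by (cases x) (simp_all add: uf_ext_def uf_val_lam_useful lam_fun_eq straddle_def)
  have "uf_max ?D (ereal x) = uf_val ?D x" for x
    unfolding uf_max_def by (rule Max_eqI) (auto simp: side_values_def uf_ext_def Lim_straddle)
  moreover have "uf_min ?D x \<le> 0" for x using uf_min_le_ext[of ?D x] ext'[of x] by linarith
  ultimately show ?thesis
    unfolding red_blue_pair_def
    using useful_lam_useful uz z zc uc ext ext' zero by (simp add: zero_useful_def)
qed

lemma height_lam_useful: "height (leaf_data, zero_useful) = straddle"
  by (simp add: height_def level_def zero_useful_def uf_val_lam_useful lam_fun_eq fun_eq_iff)

lemma Phi_iff: "p \<in> Phi (L, M) \<longleftrightarrow> red_blue_pair p \<and> height p = straddle"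
  using red_blue_pair_lam_useful by (auto simp: Phi_def rb_rel_iff height_lam_useful)

end

section \<open>Leaves and semistable chords\<close>

context measured_lamination
begin

lemma measure_leaves_over_le_straddle:
  assumes "x \<le> z" "z \<le> y" shows "measure M (leaves_over L x y) \<le> straddle z"
  unfolding straddle_def
proof (rule finite_measure_mono[OF _ leaves_over_sets])
  have "lo \<gamma> < ereal z" if "lo \<gamma> < ereal x" for \<gamma> by (rule less_le_trans[OF that]) (simp add: assms)
  moreover have "ereal z < hi \<gamma>" if "ereal y < hi \<gamma>" for \<gamma> by (rule le_less_trans[OF _ that]) (simp add: assms)
  ultimately show "leaves_over L x y \<subseteq> leaves_over L z z" by (auto simp: leaves_over_def)
qed

text \<open>
  Together with the obvious bound in the other direction this says that the mass of the leaves over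
  all of \<open>[x, y]\<close> is the infimum of \<open>straddle\<close> on \<open>[x, y]\<close>. Look at the leaves that start in \<open>[x,
  y]\<close> and end beyond \<open>y\<close>. If there are none, the leaves over \<open>y\<close> start before \<open>x\<close>. Else let \<open>z\<close> be
  the infimum of their starting points. If \<open>z\<close> is attained, a leaf over \<open>z\<close> ends beyond \<open>y\<close>, as it
  does not cross the leaf that starts at \<open>z\<close>, and by minimality it starts before \<open>x\<close>. Otherwise a
  leaf over a starting point \<open>t\<close> close to \<open>z\<close> starts before \<open>t\<close> and ends beyond \<open>y\<close>; as \<open>t\<close> tends to
  \<open>z\<close>, the mass of such leaves tends to the mass of those that start before \<open>x\<close>.
\<close>

lemma valley:
  assumes "x \<le> y" "0 < e"
  obtains z where "x \<le> z" "z \<le> y" "straddle z < measure M (leaves_over L x y) + e"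
proof -
  define T where "T = {t. x \<le> t \<and> t \<le> y \<and> (\<exists>\<delta>\<in>L. lo \<delta> = ereal t \<and> ereal y < hi \<delta>)}"
  have T_I: "lo \<gamma> < ereal x \<or> (\<exists>t\<in>T. lo \<gamma> = ereal t)"
    if "\<gamma> \<in> L" "lo \<gamma> \<le> ereal y" "ereal y < hi \<gamma>" for \<gamma>
  proof (cases "lo \<gamma>")
    case (real t) then show ?thesis using that by (cases "t < x") (auto simp: T_def)
  qed (use that in auto)
  have over: "leaves_over L t t \<subseteq> {\<gamma>\<in>L. lo \<gamma> < ereal t \<and> ereal y < hi \<gamma>}" if tT: "t \<in> T" for t
  proof
    fix \<gamma> assume "\<gamma> \<in> leaves_over L t t"
    then have g: "\<gamma> \<in> L" "lo \<gamma> < ereal t" "ereal t < hi \<gamma>" by (auto simp: leaves_over_def)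
    obtain \<delta> where d: "\<delta> \<in> L" "lo \<delta> = ereal t" "ereal y < hi \<delta>" using tT by (auto simp: T_def)
    have "hi \<delta> \<le> hi \<gamma>" using leaves_not_interleaved[OF g(1) d(1)] g d by simp
    then show "\<gamma> \<in> {\<gamma>\<in>L. lo \<gamma> < ereal t \<and> ereal y < hi \<gamma>}" using g d by auto
  qed
  show ?thesis
  proof (cases "T = {}")
    case True
    have "leaves_over L y y \<subseteq> leaves_over L x y" using T_I True by (auto simp: leaves_over_def)
    then have "straddle y \<le> measure M (leaves_over L x y)"
      unfolding straddle_def by (intro finite_measure_mono leaves_over_sets)
    then show ?thesis using that[of y] assms by simp
  next
    case False
    define z where "z = Inf T"
    have bdd: "bdd_below T" by (rule bdd_belowI[of _ x]) (simp add: T_def)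
    have zle: "z \<le> t" if "t \<in> T" for t unfolding z_def using bdd that by (rule cInf_lower[rotated])
    have xz: "x \<le> z" unfolding z_def using False by (rule cInf_greatest) (simp add: T_def)
    obtain t0 where "t0 \<in> T" using False by blast
    then have zy: "z \<le> y" using zle[of t0] by (simp add: T_def)
    show ?thesis
    proof (cases "z \<in> T")
      case True
      have "leaves_over L z z \<subseteq> leaves_over L x y"
      proof
        fix \<gamma> assume g: "\<gamma> \<in> leaves_over L z z"
        then have g1: "\<gamma> \<in> L" "lo \<gamma> < ereal z" "ereal y < hi \<gamma>" using over[OF True] by auto
        have "lo \<gamma> \<le> ereal y" by (rule order_trans[OF less_imp_le[OF g1(2)]]) (simp add: zy)
        have "lo \<gamma> < ereal x"
        proof (rule ccontr)
          assume "\<not> lo \<gamma> < ereal x"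
          then obtain t where "t \<in> T" "lo \<gamma> = ereal t" using T_I[OF g1(1) \<open>lo \<gamma> \<le> ereal y\<close> g1(3)] by blast
          then show False using zle[of t] g1(2) by simp
        qed
        then show "\<gamma> \<in> leaves_over L x y" using g1 by (simp add: leaves_over_def)
      qed
      then have "straddle z \<le> measure M (leaves_over L x y)"
        unfolding straddle_def by (intro finite_measure_mono leaves_over_sets)
      then show ?thesis using that[of z] xz zy assms by simp
    next
      case notin: False
      define G where "G n = {\<gamma>\<in>L. lo \<gamma> < ereal (z + 1 / Suc n) \<and> ereal y < hi \<gamma>}" for n
      have Gs: "G n \<in> sets M" for n unfolding G_def by (rule leaf_sets) measurable
      have "(\<lambda>n. measure M (G n)) \<longlonglongrightarrow> measure M (\<Inter>n. G n)"
      proof (rule finite_Lim_measure_decseq)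
        show "decseq G"
        proof (rule decseq_SucI)
          fix n
          have "ereal (z + 1 / Suc (Suc n)) \<le> ereal (z + 1 / Suc n)" by (simp add: field_simps)
          then show "G (Suc n) \<subseteq> G n" unfolding G_def using less_le_trans by blast
        qed
      qed (use Gs in auto)
      moreover have "(\<Inter>n. G n) \<subseteq> leaves_over L x y"
      proof
        fix \<gamma> assume "\<gamma> \<in> (\<Inter>n. G n)"
        then have g: "\<gamma> \<in> L" "ereal y < hi \<gamma>" "lo \<gamma> < ereal (z + 1 / Suc n)" for n by (auto simp: G_def)
        have "(\<lambda>n. ereal (z + 1 / Suc n)) \<longlonglongrightarrow> ereal (z + 0)"
          by (intro tendsto_intros LIMSEQ_Suc lim_1_over_n)
        moreover have "\<exists>N. \<forall>n\<ge>N. lo \<gamma> \<le> ereal (z + 1 / Suc n)" using less_imp_le[OF g(3)] by blast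
        ultimately have "lo \<gamma> \<le> ereal (z + 0)" by (rule LIMSEQ_le_const)
        then have lz: "lo \<gamma> \<le> ereal z" by simp
        have "lo \<gamma> \<le> ereal y" by (rule order_trans[OF lz]) (simp add: zy)
        have "lo \<gamma> < ereal x"
        proof (rule ccontr)
          assume "\<not> lo \<gamma> < ereal x"
          then obtain t where t: "t \<in> T" "lo \<gamma> = ereal t" using T_I[OF g(1) \<open>lo \<gamma> \<le> ereal y\<close> g(2)] by blast
          then have "t = z" using zle[of t] lz by simp
          then show False using notin t by simp
        qed
        then show "\<gamma> \<in> leaves_over L x y" using g by (simp add: leaves_over_def)
      qed
      then have "measure M (\<Inter>n. G n) < measure M (leaves_over L x y) + e"
        using finite_measure_mono[OF _ leaves_over_sets, of "\<Inter>n. G n" x y] assms(2) by linarith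
      ultimately have "\<forall>\<^sub>F n in sequentially. measure M (G n) < measure M (leaves_over L x y) + e"
        by (rule order_tendstoD(2))
      then obtain n where n: "measure M (G n) < measure M (leaves_over L x y) + e"
        by (auto simp: eventually_sequentially)
      have "Inf T < z + 1 / Suc n" by (simp add: z_def)
      then obtain t where t: "t \<in> T" "t < z + 1 / Suc n" using cInf_lessD[OF False] by blast
      have "{\<gamma>\<in>L. lo \<gamma> < ereal t \<and> ereal y < hi \<gamma>} \<subseteq> G n"
      proof
        fix \<gamma> assume g: "\<gamma> \<in> {\<gamma>\<in>L. lo \<gamma> < ereal t \<and> ereal y < hi \<gamma>}"
        then have "lo \<gamma> < ereal t" by simp
        also have "ereal t < ereal (z + 1 / Suc n)" using t(2) by simp
        finally show "\<gamma> \<in> G n" using g by (simp add: G_def)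
      qed
      then have "leaves_over L t t \<subseteq> G n" using over[OF t(1)] by blast
      then have "straddle t \<le> measure M (G n)" unfolding straddle_def by (intro finite_measure_mono Gs)
      then show ?thesis using that[of t] t(1) n by (simp add: T_def)
    qed
  qed
qed

lemma measure_leaves_over_eq_Inf:
  assumes "x \<le> y" shows "measure M (leaves_over L x y) = Inf (straddle ` {x..y})"
proof (rule cInf_eq[symmetric])
  show "measure M (leaves_over L x y) \<le> s" if "s \<in> straddle ` {x..y}" for s
    using that measure_leaves_over_le_straddle by auto
  fix s assume s: "\<And>t. t \<in> straddle ` {x..y} \<Longrightarrow> s \<le> t"
  show "s \<le> measure M (leaves_over L x y)"
  proof (rule field_le_epsilon)
    fix e :: real assume "0 < e"
    obtain z where z: "x \<le> z" "z \<le> y" "straddle z < measure M (leaves_over L x y) + e"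
      using valley[OF assms \<open>0 < e\<close>] .
    then have "s \<le> straddle z" by (intro s) auto
    then show "s \<le> measure M (leaves_over L x y) + e" using z(3) by linarith
  qed
qed

lemma measure_leaves_over_ge:
  assumes "x \<le> y" "\<And>z. x \<le> z \<Longrightarrow> z \<le> y \<Longrightarrow> s \<le> straddle z"
  shows "s \<le> measure M (leaves_over L x y)"
  unfolding measure_leaves_over_eq_Inf[OF assms(1)] by (rule cInf_greatest) (use assms in auto)

text \<open>
  The mass of the leaves enclosing the given one (itself included) is a possible height: all of them
  pass over every interior point, and a leaf over an endpoint encloses, being noncrossing.
\<close>

lemma leaf_imp_fits:
  assumes ab: "a < b" "b < \<infinity>" and leaf: "chord a b \<in> L"
  shows "fits straddle a b (measure M {\<gamma>\<in>L. lo \<gamma> \<le> a \<and> b \<le> hi \<gamma>})" (is "fits _ _ _ (measure M ?K)")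
proof -
  have K: "?K \<in> sets M" by (rule leaf_sets) measurable
  have b: "\<bar>b\<bar> \<noteq> \<infinity>" "ereal (real_of_ereal b) = b" using ab by (cases b; auto)+
  have "ext0 straddle a \<le> measure M ?K"
  proof (cases a)
    case (real r)
    have "leaves_over L r r \<subseteq> ?K"
    proof
      fix \<gamma> assume "\<gamma> \<in> leaves_over L r r"
      then have g: "\<gamma> \<in> L" "lo \<gamma> < a" "a < hi \<gamma>" using real by (auto simp: leaves_over_def)
      then have "b \<le> hi \<gamma>" using leaves_not_interleaved[OF g(1) leaf] ab by simp
      then show "\<gamma> \<in> ?K" using g by simp
    qed
    then have "straddle r \<le> measure M ?K" unfolding straddle_def by (intro finite_measure_mono K)
    then show ?thesis by (simp add: real)
  qed (use ab in auto)
  moreover have "ext0 straddle b \<le> measure M ?K"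
  proof -
    have "leaves_over L (real_of_ereal b) (real_of_ereal b) \<subseteq> ?K"
    proof
      fix \<gamma> assume "\<gamma> \<in> leaves_over L (real_of_ereal b) (real_of_ereal b)"
      then have g: "\<gamma> \<in> L" "lo \<gamma> < b" "b < hi \<gamma>" using b by (auto simp: leaves_over_def)
      have "lo \<gamma> \<le> a"
      proof (rule ccontr)
        assume "\<not> lo \<gamma> \<le> a"
        then have "hi \<gamma> \<le> b" using leaves_not_interleaved[OF leaf g(1)] ab g by simp
        then show False using g by simp
      qed
      then show "\<gamma> \<in> ?K" using g by simp
    qed
    then have "straddle (real_of_ereal b) \<le> measure M ?K" unfolding straddle_def by (intro finite_measure_mono K)
    then show ?thesis using ab by (auto simp: ext0_def)
  qed
  moreover have "measure M ?K \<le> straddle x" if "a < ereal x" "ereal x < b" for x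
    unfolding straddle_def
  proof (rule finite_measure_mono[OF _ leaves_over_sets])
    show "?K \<subseteq> leaves_over L x x"
      using le_less_trans[OF _ that(1)] less_le_trans[OF that(2)] by (auto simp: leaves_over_def)
  qed
  ultimately show ?thesis by (simp add: fits_def)
qed

text \<open>
  Suppose a leaf crosses the chord. The leaves near it have one end in a small interval \<open>(x, y)\<close>
  inside \<open>(a, b)\<close> and the other one outside \<open>[a, b]\<close>, hence pass over exactly one of \<open>a\<close> and \<open>b\<close>.
  Since \<open>straddle\<close> is on \<open>(a, b)\<close> at least as large as at \<open>a\<close>, \<open>valley\<close> says that almost every leaf
  over \<open>a\<close> is also over \<open>y\<close>; in the same way almost every leaf over \<open>b\<close> is over \<open>x\<close>. So a
  neighbourhood of a leaf would be a null set.
\<close>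

lemma fits_imp_noncrossing:
  assumes ab: "a < b" "b < \<infinity>" and c: "fits straddle a b k" and d: "\<delta> \<in> L"
  shows "\<not> crossing (chord a b) \<delta>"
proof
  assume cr: "crossing (chord a b) \<delta>"
  obtain p q where pq: "p < q" "q < \<infinity>" "\<delta> = chord p q" using leafE[OF d] .
  have n: "p \<noteq> \<infinity>" "q \<noteq> \<infinity>" "a \<noteq> \<infinity>" using pq ab by auto
  obtain b' where b: "b = ereal b'" using ab by (cases b) auto
  \<comment> \<open>\<open>e\<close> is the endpoint of \<open>\<delta>\<close> inside \<open>(a, b)\<close> and \<open>f\<close> the one outside, in either order\<close>
  obtain e f where ef: "a < e" "e < b" "f \<noteq> \<infinity>" "f < a \<or> b < f" "\<delta> = chord e f \<or> \<delta> = chord f e"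
    using cr pq n unfolding pq(3) crossing_chord[OF ab pq(1,2)] by metis
  obtain x where x: "a < ereal x" "ereal x < e" using ereal_dense2[OF ef(1)] by blast
  obtain y where y: "e < ereal y" "ereal y < b" using ereal_dense2[OF ef(2)] by blast
  have xb: "ereal x < b" "a < ereal y" using x y ef less_trans by blast+
  define A where "A = bdry_pt ` {z. ereal x < z \<and> z < ereal y}"
  define B where "B = bdry_pt ` {z. z \<noteq> \<infinity> \<and> (z < a \<or> b < z)}"
  define N1 where "N1 = {\<gamma>\<in>L. lo \<gamma> < a \<and> a < hi \<gamma> \<and> hi \<gamma> \<le> ereal y}"
  define N2 where "N2 = {\<gamma>\<in>L. ereal x \<le> lo \<gamma> \<and> lo \<gamma> < b \<and> b < hi \<gamma>}"
  have s1: "N1 \<in> sets M" unfolding N1_def by (rule leaf_sets) measurable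
  have s2: "N2 \<in> sets M" unfolding N2_def by (rule leaf_sets) measurable
  have arcs: "open_arc A" "open_arc B"
    unfolding A_def B_def by (rule open_arc_inside[OF less_trans[OF x(2) y(1)]], rule open_arc_outside[OF ab])
  have inA: "bdry_pt z \<in> A \<longleftrightarrow> ereal x < z \<and> z < ereal y" if "z \<noteq> \<infinity>" for z
    unfolding A_def by (subst bdry_pt_mem_image[OF that]) auto
  have inB: "bdry_pt z \<in> B \<longleftrightarrow> z < a \<or> b < z" if "z \<noteq> \<infinity>" for z
    unfolding B_def using that by (subst bdry_pt_mem_image[OF that]) auto
  have "\<delta> \<in> O_set L A B"
  proof -
    have "e \<noteq> \<infinity>" using ef by auto
    then have "bdry_pt e \<in> A" "bdry_pt f \<in> B" using inA inB ef x y by auto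
    then show ?thesis using d ef(5) by (auto simp: chord_in_O_set)
  qed
  then have pos: "0 < emeasure M (O_set L A B)" using O_set_pos[OF arcs] by blast
  have "O_set L A B \<subseteq> N1 \<union> N2"
  proof
    fix \<gamma> assume g: "\<gamma> \<in> O_set L A B"
    then have gL: "\<gamma> \<in> L" by (simp add: O_set_def)
    obtain u v where uv: "u < v" "v < \<infinity>" "\<gamma> = chord u v" "lo \<gamma> = u" "hi \<gamma> = v" using leafE[OF gL] .
    have nn: "u \<noteq> \<infinity>" "v \<noteq> \<infinity>" using uv by auto
    have "ereal x < u \<and> u < ereal y \<and> (v < a \<or> b < v) \<or> ereal x < v \<and> v < ereal y \<and> (u < a \<or> b < u)"
      using g unfolding uv(3) chord_in_O_set inA[OF nn(1)] inA[OF nn(2)] inB[OF nn(1)] inB[OF nn(2)] by auto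
    then show "\<gamma> \<in> N1 \<union> N2"
    proof
      assume u: "ereal x < u \<and> u < ereal y \<and> (v < a \<or> b < v)"
      have "a < v" using x(1) u uv(1) less_trans by blast
      then have "b < v" using u by auto
      moreover have "u < b" using u y less_trans by blast
      ultimately show ?thesis using u uv gL less_imp_le by (auto simp: N2_def)
    next
      assume v: "ereal x < v \<and> v < ereal y \<and> (u < a \<or> b < u)"
      have "u < b" using y(2) v uv(1) less_trans by blast
      then have "u < a" using v by auto
      moreover have "a < v" using v x less_trans by blast
      ultimately show ?thesis using v uv gL less_imp_le by (auto simp: N1_def)
    qed
  qed
  moreover have "measure M N1 = 0"
  proof (cases a)
    case (real a')
    have "straddle a' \<le> measure M (leaves_over L a' y)"
    proof (rule measure_leaves_over_ge)
      fix z assume z: "a' \<le> z" "z \<le> y"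
      show "straddle a' \<le> straddle z"
      proof (cases "z = a'")
        case False
        have "z < b'" using z y xb b by simp
        then have "k \<le> straddle z" using c z False real by (simp add: fits_def b)
        then show ?thesis using c real by (simp add: fits_def)
      qed simp
    qed (use xb real in auto)
    moreover have "measure M (leaves_over L a' y \<union> N1) = measure M (leaves_over L a' y) + measure M N1"
      by (rule finite_measure_Union[OF leaves_over_sets s1]) (auto simp: leaves_over_def N1_def)
    moreover have "leaves_over L a' y \<union> N1 = leaves_over L a' a'"
      using xb real le_less_trans[OF less_imp_le[OF xb(2)]] by (auto simp: leaves_over_def N1_def not_less)
    ultimately show ?thesis using measure_nonneg[of M N1] unfolding straddle_def by (smt (verit))
  next
    case MInf
    then have "N1 = {}" by (auto simp: N1_def)
    then show ?thesis by simp
  qed (use n in simp)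
  moreover have "measure M N2 = 0"
  proof -
    have "straddle b' \<le> measure M (leaves_over L x b')"
    proof (rule measure_leaves_over_ge)
      fix z assume z: "x \<le> z" "z \<le> b'"
      show "straddle b' \<le> straddle z"
      proof (cases "z = b'")
        case False
        have "a < ereal z" by (rule less_le_trans[OF x(1)]) (simp add: z)
        then have "k \<le> straddle z" using c z False by (simp add: fits_def b)
        then show ?thesis using c by (simp add: fits_def b)
      qed simp
    qed (use xb b in auto)
    moreover have "measure M (leaves_over L x b' \<union> N2) = measure M (leaves_over L x b') + measure M N2"
      by (rule finite_measure_Union[OF leaves_over_sets s2]) (auto simp: leaves_over_def N2_def)
    moreover have "leaves_over L x b' \<union> N2 = leaves_over L b' b'"
    proof -
      have "lo \<gamma> < ereal b'" if "lo \<gamma> < ereal x" for \<gamma> by (rule less_trans[OF that]) (use xb b in simp)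
      then show ?thesis by (auto simp: leaves_over_def N2_def b not_less)
    qed
    ultimately show ?thesis using measure_nonneg[of M N2] unfolding straddle_def by (smt (verit))
  qed
  moreover have "measure M (N1 \<union> N2) \<le> measure M N1 + measure M N2"
    by (rule measure_Un_le[OF s1 s2])
  moreover have "measure M (O_set L A B) \<le> measure M (N1 \<union> N2)" if "O_set L A B \<subseteq> N1 \<union> N2"
    using that s1 s2 by (intro finite_measure_mono) auto
  ultimately have "measure M (O_set L A B) \<le> 0" by simp
  then show False using pos by (simp add: emeasure_eq_measure ennreal_neg)
qed

lemma leaf_iff_fits:
  assumes ab: "a < b" "b < \<infinity>"
  shows "chord a b \<in> L \<longleftrightarrow> (\<exists>k. fits straddle a b k)"
proof
  assume "chord a b \<in> L"
  then show "\<exists>k. fits straddle a b k" using leaf_imp_fits[OF ab] by blast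
next
  assume "\<exists>k. fits straddle a b k"
  then obtain k where k: "fits straddle a b k" ..
  note nc = fits_imp_noncrossing[OF ab k]
  have sym: "crossing \<delta> \<gamma> \<longleftrightarrow> crossing \<gamma> \<delta>" for \<gamma> \<delta> by (auto simp: crossing_def)
  have self: "\<not> crossing \<gamma> \<gamma>" for \<gamma> by (simp add: crossing_def)
  have "noncrossing_set (insert (chord a b) L)"
    unfolding noncrossing_set_def using chord_in_geodesics[OF ab] leaves nc noncrossing sym self by blast
  then have "insert (chord a b) L = L" by (rule maximal) blast
  then show "chord a b \<in> L" by blast
qed

text \<open>
  Four points \<open>x1 < x2 < x3 < x4\<close> at one level would make the crossing chords from \<open>x1\<close> to \<open>x3\<close> and
  from \<open>x2\<close> to \<open>x4\<close> semistable, hence leaves.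
\<close>

lemma four_point_condition_Phi: "four_point_condition (Phi (L, M))"
  unfolding four_point_condition_def
proof (intro ballI allI impI)
  fix p h and a b :: ereal
  assume p: "p \<in> Phi (L, M)" and ab: "a < b \<and> b < \<infinity> \<and> semistable_at p a b h"
  then have rb: "red_blue_pair p" and h: "height p = straddle" by (simp_all add: Phi_iff)
  define k where "k = level p - h"
  have c: "fits straddle a b k" using semistable_at_iff[OF rb, of a b h] ab h by (simp add: k_def)
  define X where "X = {x\<in>{a..b}. (x, h) \<in> mod_graph p}"
  have X: "({a..b} \<times> {h}) \<inter> mod_graph p = (\<lambda>x. (x, h)) ` X" by (auto simp: X_def)
  have inj: "inj_on (\<lambda>x. (x, h)) X" by (simp add: inj_on_def)
  have "finite X \<and> card X \<le> 3"
  proof (rule ccontr)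
    assume "\<not> (finite X \<and> card X \<le> 3)"
    then have "\<exists>T\<subseteq>X. finite T \<and> card T = 4"
    proof (cases "finite X")
      case True
      then have "4 \<le> card X" using \<open>\<not> (finite X \<and> card X \<le> 3)\<close> by simp
      then show ?thesis by (rule obtain_subset_with_card_n) blast
    next
      case False then show ?thesis using infinite_arbitrarily_large[of X 4] by blast
    qed
    then obtain T where T: "T \<subseteq> X" "finite T" "card T = 4" by blast
    define xs where "xs = sorted_list_of_set T"
    have xs: "sorted_wrt (<) xs" "length xs = 4" "set xs = T"
      using T by (auto simp: xs_def strict_sorted_list_of_set)
    obtain x1 x2 x3 x4 where "xs = [x1, x2, x3, x4]"
      using xs(2) by (auto simp: numeral_eq_Suc length_Suc_conv)
    then have ord: "x1 < x2" "x2 < x3" "x3 < x4" and sub: "{x1, x2, x3, x4} \<subseteq> X" using xs T by auto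
    have pt: "a \<le> x \<and> x \<le> b \<and> x < \<infinity> \<and> ext0 straddle x \<le> k" if "x \<in> X" for x
    proof -
      have "a \<le> x" "x \<le> b" using that by (auto simp: X_def)
      moreover have "x < \<infinity>" using \<open>x \<le> b\<close> ab le_less_trans by blast
      ultimately show ?thesis
        using mod_graph_imp_ext0_le[OF rb, of x h] that h by (auto simp: X_def k_def)
    qed
    have ch: "chord x y \<in> L" if "x \<in> X" "y \<in> X" "x < y" for x y
    proof -
      have "k \<le> straddle t" if t: "x < ereal t" "ereal t < y" for t
      proof -
        have "a < ereal t" "ereal t < b"
          using le_less_trans[OF _ t(1), of a] less_le_trans[OF t(2), of b] pt \<open>x \<in> X\<close> \<open>y \<in> X\<close> by blast+
        then show ?thesis using c by (simp add: fits_def)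
      qed
      then have "fits straddle x y k" using pt[OF that(1)] pt[OF that(2)] by (simp add: fits_def)
      then show ?thesis using leaf_iff_fits[OF that(3)] pt[OF that(2)] by blast
    qed
    have "chord x1 x3 \<in> L" "chord x2 x4 \<in> L" using ch sub ord by auto
    then have "\<not> crossing (chord x1 x3) (chord x2 x4)" by (rule noncrossing)
    moreover have "x3 < \<infinity>" "x4 < \<infinity>" using pt sub by auto
    ultimately show False using crossing_chord[of x1 x3 x2 x4] ord by auto
  qed
  then show "finite ({a..b} \<times> {h} \<inter> mod_graph p) \<and> card ({a..b} \<times> {h} \<inter> mod_graph p) \<le> 3"
    unfolding X using inj by (simp add: card_image)
qed

lemma Phi_in_stability_fpc: "Phi (L, M) \<in> stability_fpc"
proof -
  have "Phi (L, M) \<in> stability_conditions"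
    unfolding stability_conditions_def Phi_def
    by (rule quotientI) (simp add: red_blue_pair_lam_useful)
  then show ?thesis using four_point_condition_Phi by (simp add: stability_fpc_def)
qed

lemma Union_leaves_over: "(\<Union>r\<in>\<rat>. leaves_over L r r) = L"
proof -
  have "\<exists>r\<in>\<rat>. \<gamma> \<in> leaves_over L r r" if g: "\<gamma> \<in> L" for \<gamma>
  proof -
    obtain q where "lo \<gamma> < ereal (real_of_rat q)" "ereal (real_of_rat q) < hi \<gamma>"
      using ereal_dense3[OF leaf_lo_hi(1)[OF g]] by blast
    then show ?thesis using g by (intro bexI[of _ "real_of_rat q"]) (auto simp: leaves_over_def)
  qed
  then show ?thesis by (auto simp: leaves_over_def)
qed

end

lemma M_mod_ivl_inj:
  assumes "M_mod (ivl a b) = (M_mod (ivl c d) :: 'k::field qmod)" "a < b" "b < \<infinity>" "c < d" "d < \<infinity>"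
  shows "a = c \<and> b = d"
proof -
  have fib: "(\<lambda>i::nat. if i = 0 then 1 else 0 :: 'k) \<in> fib (M_mod I) x \<longleftrightarrow> x \<in> I" for I x
    by (auto simp: M_mod_def interval_sum_def)
  have I: "x \<in> ivl a b \<longleftrightarrow> x \<in> ivl c d" for x using fib[of "ivl a b" x] fib[of "ivl c d" x] assms(1) by simp
  have I': "a < ereal x \<and> ereal x \<le> b \<longleftrightarrow> c < ereal x \<and> ereal x \<le> d" for x using I[of x] by (simp add: ivl_def)
  obtain b' d' where bd: "b = ereal b'" "d = ereal d'" using assms by (cases b; cases d) auto
  have bd': "b = d" using I'[of b'] I'[of d'] assms bd by auto
  have "\<not> a < c" 
  proof
    assume "a < c"
    then obtain x where x: "a < ereal x" "ereal x < c" using ereal_dense2 by blast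
    then show False using I'[of x] assms(4) bd' by (metis less_imp_le less_trans not_less_iff_gr_or_eq)
  qed
  moreover have "\<not> c < a"
  proof
    assume "c < a"
    then obtain x where x: "c < ereal x" "ereal x < a" using ereal_dense2 by blast
    then show False using I'[of x] assms(2) bd' by (metis less_imp_le less_trans not_less_iff_gr_or_eq)
  qed
  ultimately show ?thesis using bd' by auto
qed

lemma (in measured_lamination) bij_betw_leaves_semistable_modules:
  "bij_betw (\<lambda>\<gamma>. M_mod (ivl (lo \<gamma>) (hi \<gamma>))) L (semistable_modules (Phi (L, M)) :: 'k::field qmod set)"
  unfolding bij_betw_def
proof
  let ?f = "\<lambda>\<gamma>. M_mod (ivl (lo \<gamma>) (hi \<gamma>)) :: 'k qmod"
  show "inj_on ?f L"
  proof (rule inj_onI)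
    fix \<gamma> \<delta> assume g: "\<gamma> \<in> L" and d: "\<delta> \<in> L" and eq: "?f \<gamma> = ?f \<delta>"
    obtain a b where 1: "a < b" "b < \<infinity>" "\<gamma> = chord a b" "lo \<gamma> = a" "hi \<gamma> = b" using leafE[OF g] .
    obtain x y where 2: "x < y" "y < \<infinity>" "\<delta> = chord x y" "lo \<delta> = x" "hi \<delta> = y" using leafE[OF d] .
    show "\<gamma> = \<delta>" using M_mod_ivl_inj[OF eq] 1 2 by simp
  qed
  have sem: "(\<exists>p\<in>Phi (L, M). \<exists>h. semistable_at p a b h) \<longleftrightarrow> chord a b \<in> L" if ab: "a < b" "b < \<infinity>" for a b
  proof
    assume "\<exists>p\<in>Phi (L, M). \<exists>h. semistable_at p a b h"
    then obtain p h where "p \<in> Phi (L, M)" "semistable_at p a b h" by blast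
    then have "fits straddle a b (level p - h)" using semistable_at_iff[OF _ ab, of p h] by (simp add: Phi_iff)
    then show "chord a b \<in> L" using leaf_iff_fits[OF ab] by blast
  next
    assume "chord a b \<in> L"
    then obtain k where k: "fits straddle a b k" using leaf_iff_fits[OF ab] by blast
    let ?p = "(leaf_data, zero_useful)"
    have p: "?p \<in> Phi (L, M)" using red_blue_pair_lam_useful height_lam_useful by (simp add: Phi_iff)
    have "semistable_at ?p a b (level ?p - k)"
      using semistable_at_iff[OF red_blue_pair_lam_useful ab] k by (simp add: height_lam_useful)
    then show "\<exists>p\<in>Phi (L, M). \<exists>h. semistable_at p a b h" using p by blast
  qed
  show "?f ` L = semistable_modules (Phi (L, M))"
  proof (intro equalityI subsetI)
    fix N assume "N \<in> ?f ` L"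
    then obtain \<gamma> where g: "\<gamma> \<in> L" "N = ?f \<gamma>" by blast
    obtain a b where 1: "a < b" "b < \<infinity>" "\<gamma> = chord a b" "lo \<gamma> = a" "hi \<gamma> = b" using leafE[OF g(1)] .
    have "N = M_mod (ivl a b)" "N \<in> Ind_r" using g 1 M_mod_in_Ind_r by simp_all
    then show "N \<in> semistable_modules (Phi (L, M))"
      unfolding semistable_modules_def using sem[OF 1(1,2)] 1 g(1) by blast
  next
    fix N :: "'k qmod" assume "N \<in> semistable_modules (Phi (L, M))"
    then obtain a b where ab: "a < b" "b < \<infinity>" "N = M_mod (ivl a b)" "\<exists>p\<in>Phi (L, M). \<exists>h. semistable_at p a b h"
      unfolding semistable_modules_def by blast
    then have "chord a b \<in> L" using sem by blast
    moreover have "N = ?f (chord a b)" using ab by simp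
    ultimately show "N \<in> ?f ` L" by blast
  qed
qed

text \<open>
  The height function determines the leaves by \<open>leaf_iff_fits\<close>, and the masses on the generator
  \<open>leaves_over\<close> by \<open>measure_leaves_over_eq_Inf\<close>.
\<close>

lemma inj_on_Phi: "inj_on Phi measured_laminations"
proof (rule inj_onI)
  fix l l' assume l: "l \<in> measured_laminations" "l' \<in> measured_laminations" "Phi l = Phi l'"
  obtain L M L' M' where e: "l = (L, M)" "l' = (L', M')" by (cases l; cases l')
  interpret X: measured_lamination L M using l e by unfold_locales simp
  interpret Y: measured_lamination L' M' using l e by unfold_locales simp
  have "(lam_useful (L, M), zero_useful) \<in> Phi (L', M')"
    using l(3) e X.Phi_iff X.red_blue_pair_lam_useful X.height_lam_useful by metis
  then have s: "X.straddle = Y.straddle" using Y.Phi_iff X.height_lam_useful by simp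
  have "\<gamma> \<in> L \<longleftrightarrow> \<gamma> \<in> L'" if g: "\<gamma> \<in> geodesics" for \<gamma>
  proof -
    obtain a b where "a < b" "b < \<infinity>" "\<gamma> = chord a b" using geodesic_cases[OF g] .
    then show ?thesis using X.leaf_iff_fits[of a b] Y.leaf_iff_fits[of a b] s by simp
  qed
  then have L: "L' = L" using X.leaves Y.leaves by blast
  have em: "emeasure M (leaves_over L x y) = emeasure M' (leaves_over L x y)" if "x \<le> y" for x y
    using X.measure_leaves_over_eq_Inf[OF that] Y.measure_leaves_over_eq_Inf[OF that] s
    by (simp add: X.emeasure_eq_measure Y.emeasure_eq_measure L)
  have "M = M'"
  proof (rule measure_eqI_generator_eq_countable[where \<Omega> = L and E = "{leaves_over L x y |x y. x \<le> y}"
        and A = "(\<lambda>r. leaves_over L r r) ` \<rat>"])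
    have "c < ereal (min x x') \<longleftrightarrow> c < ereal x \<and> c < ereal x'"
      "ereal (max x x') < c \<longleftrightarrow> ereal x < c \<and> ereal x' < c" for c x x'
    proof -
      have "ereal (min x x') = min (ereal x) (ereal x')" "ereal (max x x') = max (ereal x) (ereal x')"
        by (simp_all add: min_def max_def)
      then show "c < ereal (min x x') \<longleftrightarrow> c < ereal x \<and> c < ereal x'"
        "ereal (max x x') < c \<longleftrightarrow> ereal x < c \<and> ereal x' < c" by (simp_all only: min_less_iff_conj max_less_iff_conj)
    qed
    then have "leaves_over L x y \<inter> leaves_over L x' y' = leaves_over L (min x x') (max y y')" for x y x' y'
      by (auto simp: leaves_over_def)
    moreover have "min x x' \<le> max y y'" if "x \<le> y" for x y x' y' :: real using that by linarith
    ultimately show "Int_stable {leaves_over L x y |x y. x \<le> y}"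
      unfolding Int_stable_def by blast
    show "\<And>X. X \<in> {leaves_over L x y |x y. x \<le> y} \<Longrightarrow> emeasure M X = emeasure M' X" using em by auto
    show "sets M = sigma_sets L {leaves_over L x y |x y. x \<le> y}"
      using X.sets_eq sigma_sets_lam_topology[OF X.leaves] by simp
    show "sets M' = sigma_sets L {leaves_over L x y |x y. x \<le> y}"
      using Y.sets_eq sigma_sets_lam_topology[OF Y.leaves] L by simp
    show "\<Union>((\<lambda>r. leaves_over L r r) ` \<rat>) = L" by (rule X.Union_leaves_over)
    show "countable ((\<lambda>r. leaves_over L r r) ` \<rat>)" by (intro countable_image countable_rat)
  qed (auto simp: leaves_over_def X.emeasure_eq_measure)
  then show "l = l'" using e L by simp
qed

section \<open>The lamination of a height function\<close>

text \<open>
  The four point condition in terms of the height function.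
\<close>

definition at_most_three :: "(real \<Rightarrow> real) \<Rightarrow> bool" where
  "at_most_three g \<longleftrightarrow> (\<forall>w x y z k. w < x \<and> x < y \<and> y < z \<and> z < \<infinity> \<and> fits g w z k \<longrightarrow>
     \<not> (ext0 g x \<le> k \<and> ext0 g y \<le> k))"

lemma fits_sub:
  assumes "fits g a b k" "a \<le> x" "y \<le> b" "ext0 g x \<le> k" "ext0 g y \<le> k"
  shows "fits g x y k"
  using assms le_less_trans[OF assms(2)] less_le_trans[OF _ assms(3)] by (auto simp: fits_def)

lemma four_point_condition_imp_at_most_three:
  assumes p: "red_blue_pair p" and fpc: "four_point_condition (rb_rel `` {p})"
  shows "at_most_three (height p)"
  unfolding at_most_three_def
proof (intro allI impI notI, elim conjE)
  fix w x y z k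
  assume ord: "w < x" "x < y" "y < z" "z < \<infinity>" and c: "fits (height p) w z k"
    and xy: "ext0 (height p) x \<le> k" "ext0 (height p) y \<le> k"
  define h where "h = level p - k"
  have fin: "x < \<infinity>" "y < \<infinity>" "w < y" "w < z" using ord less_trans by blast+
  have e: "ext0 (height p) w \<le> k" "ext0 (height p) z \<le> k" using c by (auto simp: fits_def)
  have s: "semistable_at p w z h" "semistable_at p w x h" "semistable_at p w y h"
    using semistable_at_iff[OF p fin(4) ord(4)] semistable_at_iff[OF p ord(1) fin(1)] semistable_at_iff[OF p fin(3,2)]
      c fits_sub[OF c _ _ e(1) xy(1)] fits_sub[OF c _ _ e(1) xy(2)] ord fin
    by (auto simp: h_def intro: less_imp_le less_trans)
  then have g: "(w, h) \<in> mod_graph p" "(x, h) \<in> mod_graph p" "(y, h) \<in> mod_graph p" "(z, h) \<in> mod_graph p"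
    by (auto simp: semistable_at_def)
  let ?S = "({w..z} \<times> {h}) \<inter> mod_graph p"
  have "p \<in> rb_rel `` {p}" using p by (simp add: rb_rel_iff)
  then have fc: "finite ?S" "card ?S \<le> 3"
    using fpc s(1) fin(4) ord(4) unfolding four_point_condition_def by blast+
  have "x \<le> z" "y \<le> z" "w \<le> x" "w \<le> y" "w \<le> z" using ord fin less_trans[OF ord(2,3)] by (auto intro: less_imp_le)
  then have "{(w, h), (x, h), (y, h), (z, h)} \<subseteq> ?S" using g by auto
  then have "card {(w, h), (x, h), (y, h), (z, h)} \<le> card ?S" by (intro card_mono fc)
  moreover have "w \<noteq> x" "w \<noteq> y" "w \<noteq> z" "x \<noteq> y" "x \<noteq> z" "y \<noteq> z"
    using ord fin less_trans[OF ord(2,3)] by blast+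
  then have "card {(w, h), (x, h), (y, h), (z, h)} = 4" by simp
  ultimately show False using fc(2) by linarith
qed

text \<open>
  The points \<open>x\<close> and \<open>y\<close> lie in the same connected component of \<open>{g > h}\<close>.
\<close>

definition linked :: "(real \<Rightarrow> real) \<Rightarrow> real \<Rightarrow> real \<Rightarrow> real \<Rightarrow> bool" where
  "linked g h x y \<longleftrightarrow> (\<forall>z. min x y \<le> z \<and> z \<le> max x y \<longrightarrow> h < g z)"

text \<open>
  For \<open>h < g x\<close> the component of \<open>{g > h}\<close> around \<open>x\<close> extends from \<open>left_end g h x\<close> to \<open>right_end g
  h x\<close>; the values \<open>-\<infinity>\<close> and \<open>\<infinity>\<close> arise as supremum and infimum of the empty set.
\<close>

definition left_end :: "(real \<Rightarrow> real) \<Rightarrow> real \<Rightarrow> real \<Rightarrow> ereal" where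
  "left_end g h x = Sup (ereal ` {y. y < x \<and> g y \<le> h})"

definition right_end :: "(real \<Rightarrow> real) \<Rightarrow> real \<Rightarrow> real \<Rightarrow> ereal" where
  "right_end g h x = Inf (ereal ` {y. x < y \<and> g y \<le> h})"

lemma linked_sym: "linked g h x y \<longleftrightarrow> linked g h y x"
  by (simp add: linked_def min.commute max.commute)

lemma sameD: "linked g h x y \<Longrightarrow> h < g x" "linked g h x y \<Longrightarrow> h < g y"
  by (auto simp: linked_def)

lemma linked_trans: "linked g h x y \<Longrightarrow> linked g h y z \<Longrightarrow> linked g h x z"
  unfolding linked_def by (metis le_max_iff_disj min_le_iff_disj linorder_linear)

lemma linked_antimono: "linked g h x y \<Longrightarrow> h' \<le> h \<Longrightarrow> linked g h' x y"
  unfolding linked_def by (meson le_less_trans)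

lemma linked_ends_eq:
  assumes "linked g h x y" shows "left_end g h x = left_end g h y" "right_end g h x = right_end g h y"
proof -
  have n: "h < g z" if "x \<le> z \<and> z \<le> y \<or> y \<le> z \<and> z \<le> x" for z
    using assms that by (auto simp: linked_def min_def max_def split: if_splits)
  have "z < x \<and> g z \<le> h \<longleftrightarrow> z < y \<and> g z \<le> h" "x < z \<and> g z \<le> h \<longleftrightarrow> y < z \<and> g z \<le> h" for z
    using n[of z] by linarith+
  then show "left_end g h x = left_end g h y" "right_end g h x = right_end g h y" by (simp_all add: left_end_def right_end_def)
qed

lemma between_left_end: "left_end g h x < ereal y \<Longrightarrow> y < x \<Longrightarrow> h < g y"
proof (rule ccontr)
  assume "left_end g h x < ereal y" "y < x" "\<not> h < g y"
  then have "ereal y \<le> left_end g h x" unfolding left_end_def by (intro Sup_upper) auto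
  then show False using \<open>left_end g h x < ereal y\<close> by simp
qed

lemma between_right_end: "ereal y < right_end g h x \<Longrightarrow> x < y \<Longrightarrow> h < g y"
proof (rule ccontr)
  assume "ereal y < right_end g h x" "x < y" "\<not> h < g y"
  then have "right_end g h x \<le> ereal y" unfolding right_end_def by (intro Inf_lower) auto
  then show False using \<open>ereal y < right_end g h x\<close> by simp
qed

lemma left_end_ge: "g y \<le> h \<Longrightarrow> y < x \<Longrightarrow> ereal y \<le> left_end g h x"
  unfolding left_end_def by (intro Sup_upper) auto

lemma right_end_le: "g y \<le> h \<Longrightarrow> x < y \<Longrightarrow> right_end g h x \<le> ereal y"
  unfolding right_end_def by (intro Inf_lower) auto

definition excursion_chords :: "(real \<Rightarrow> real) \<Rightarrow> complex set set" where
  "excursion_chords g = {chord a b | a b. a < b \<and> b < \<infinity> \<and> (\<exists>k. fits g a b k)}"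

lemma chord_in_excursion_chords:
  assumes "a < b" "b < \<infinity>" shows "chord a b \<in> excursion_chords g \<longleftrightarrow> (\<exists>k. fits g a b k)"
proof
  assume "chord a b \<in> excursion_chords g"
  then obtain c d where cd: "chord a b = chord c d" "c < d" "d < \<infinity>" "\<exists>k. fits g c d k"
    unfolding excursion_chords_def by blast
  have "a = c" "b = d" using lo_chord[OF assms] hi_chord[OF assms] lo_chord[OF cd(2,3)] hi_chord[OF cd(2,3)] cd(1) by metis+
  then show "\<exists>k. fits g a b k" using cd by simp
qed (use assms in \<open>auto simp: excursion_chords_def\<close>)

lemma excursion_chords_geodesics: "excursion_chords g \<subseteq> geodesics"
  using chord_in_geodesics by (auto simp: excursion_chords_def)

locale excursion =
  fixes g :: "real \<Rightarrow> real"
  assumes height_function: "height_function g" and at_most_three: "at_most_three g"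
begin

lemma nonneg: "0 \<le> g x"
  using height_function by (simp add: height_function_def)

lemma ext0_nonneg: "0 \<le> ext0 g a"
  using nonneg by (simp add: ext0_def)

lemma open_superlevel: "open {x. h < g x}"
proof (subst open_subopen, intro ballI)
  fix x assume "x \<in> {x. h < g x}"
  then have "\<forall>\<^sub>F y in nhds x. h < g y" using height_function by (simp add: height_function_def)
  then show "\<exists>T. open T \<and> x \<in> T \<and> T \<subseteq> {x. h < g x}" unfolding eventually_nhds by auto
qed

lemma closed_sublevel: "closed {x. g x \<le> h}"
  using open_superlevel[of h] by (simp add: closed_def Compl_eq not_le)

lemma exists_below:
  assumes "0 < h" obtains y where "x < y" "g y < h"
proof -
  have "(g \<longlongrightarrow> 0) at_top" using height_function by (simp add: height_function_def)
  then have "\<forall>\<^sub>F y in at_top. g y < h" using assms by (rule order_tendstoD(2))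
  then have "\<forall>\<^sub>F y in at_top. g y < h \<and> x < y" using eventually_gt_at_top by (rule eventually_conj)
  then have "\<exists>y. g y < h \<and> x < y" by (rule eventually_happens'[OF trivial_limit_at_top_linorder])
  then show ?thesis using that by blast
qed

text \<open>
  Compactness: the open sets \<open>{g > h + 1/n}\<close> cover the interval.
\<close>

lemma uniform_gap:
  assumes "\<And>z. x \<le> z \<Longrightarrow> z \<le> y \<Longrightarrow> h < g z"
  obtains h' where "h < h'" "\<And>z. x \<le> z \<Longrightarrow> z \<le> y \<Longrightarrow> h' < g z"
proof -
  define U where "U n = {z. h + 1 / Suc n < g z}" for n
  have mono: "U m \<subseteq> U n" if "m \<le> n" for m n
  proof -
    have "1 / real (Suc n) \<le> 1 / real (Suc m)" using that by (simp add: frac_le)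
    then show ?thesis unfolding U_def by auto
  qed
  have cover: "{x..y} \<subseteq> (\<Union>n\<in>UNIV. U n)"
  proof
    fix z assume "z \<in> {x..y}"
    then have "0 < g z - h" using assms by simp
    then obtain n where "inverse (real (Suc n)) < g z - h" using reals_Archimedean by blast
    then have "z \<in> U n" by (simp add: U_def field_simps)
    then show "z \<in> (\<Union>n\<in>UNIV. U n)" by blast
  qed
  have "open (U n)" for n unfolding U_def by (rule open_superlevel)
  then obtain C where C: "finite C" "{x..y} \<subseteq> (\<Union>n\<in>C. U n)"
    by (rule compactE_image[OF compact_Icc _ cover])
  then obtain N where N: "\<forall>n\<in>C. n \<le> N" unfolding finite_nat_set_iff_bounded_le by blast
  have "z \<in> U N" if "x \<le> z" "z \<le> y" for z
  proof -
    have "z \<in> {x..y}" using that by simp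
    then obtain n where n: "n \<in> C" "z \<in> U n" using C(2) by blast
    then have "U n \<subseteq> U N" using N by (intro mono) simp
    then show ?thesis using n(2) by blast
  qed
  then show ?thesis by (intro that[of "h + 1 / Suc N"]) (auto simp: U_def)
qed

text \<open>
  The sublevel sets of \<open>g\<close> are closed, so a finite end of a component is itself a point where \<open>g \<le>
  h\<close>.
\<close>

lemma left_end_attained:
  assumes "h < g x"
  shows "left_end g h x < ereal x" "left_end g h x = -\<infinity> \<or> (\<exists>s. left_end g h x = ereal s \<and> g s \<le> h)"
proof -
  let ?S = "{y. y < x \<and> g y \<le> h}"
  have "left_end g h x < ereal x \<and> (left_end g h x = -\<infinity> \<or> (\<exists>s. left_end g h x = ereal s \<and> g s \<le> h))"
  proof (cases "?S = {}")
    case True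
    then have "left_end g h x = -\<infinity>" by (simp only: left_end_def) (simp add: bot_ereal_def)
    then show ?thesis by simp
  next
    case False
    have S: "?S = {..x} \<inter> {y. g y \<le> h}" using assms by (auto simp: less_le)
    have bdd: "bdd_above ?S" by (rule bdd_aboveI[of _ x]) auto
    have "closed ?S" unfolding S by (intro closed_Int closed_sublevel closed_atMost)
    then have m: "Sup ?S \<in> ?S" using closed_contains_Sup[OF False bdd] by simp
    have "left_end g h x = ereal (Sup ?S)"
      unfolding left_end_def
    proof (rule Sup_eqI)
      show "y \<le> ereal (Sup ?S)" if "y \<in> ereal ` ?S" for y using that cSup_upper[OF _ bdd] by auto
      show "ereal (Sup ?S) \<le> y" if "\<And>z. z \<in> ereal ` ?S \<Longrightarrow> z \<le> y" for y using that m by blast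
    qed
    then show ?thesis using m by auto
  qed
  then show "left_end g h x < ereal x" "left_end g h x = -\<infinity> \<or> (\<exists>s. left_end g h x = ereal s \<and> g s \<le> h)" by auto
qed

lemma right_end_attained:
  assumes "h < g x"
  shows "ereal x < right_end g h x" "right_end g h x = \<infinity> \<or> (\<exists>s. right_end g h x = ereal s \<and> g s \<le> h)"
proof -
  let ?S = "{y. x < y \<and> g y \<le> h}"
  have "ereal x < right_end g h x \<and> (right_end g h x = \<infinity> \<or> (\<exists>s. right_end g h x = ereal s \<and> g s \<le> h))"
  proof (cases "?S = {}")
    case True
    then have "right_end g h x = \<infinity>" by (simp only: right_end_def) (simp add: top_ereal_def)
    then show ?thesis by simp
  next
    case False
    have S: "?S = {x..} \<inter> {y. g y \<le> h}" using assms by (auto simp: less_le)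
    have bdd: "bdd_below ?S" by (rule bdd_belowI[of _ x]) auto
    have "closed ?S" unfolding S by (intro closed_Int closed_sublevel closed_atLeast)
    then have m: "Inf ?S \<in> ?S" using closed_contains_Inf[OF False bdd] by simp
    have "right_end g h x = ereal (Inf ?S)"
      unfolding right_end_def
    proof (rule Inf_eqI)
      show "ereal (Inf ?S) \<le> y" if "y \<in> ereal ` ?S" for y using that cInf_lower[OF _ bdd] by auto
      show "y \<le> ereal (Inf ?S)" if "\<And>z. z \<in> ereal ` ?S \<Longrightarrow> y \<le> z" for y using that m by blast
    qed
    then show ?thesis using m by auto
  qed
  then show "ereal x < right_end g h x" "right_end g h x = \<infinity> \<or> (\<exists>s. right_end g h x = ereal s \<and> g s \<le> h)" by auto
qed

lemma right_end_less_infinity: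
  assumes "0 < h" shows "right_end g h x < \<infinity>"
proof -
  obtain y where "x < y" "g y < h" using exists_below[OF assms] .
  then have "right_end g h x \<le> ereal y" by (intro right_end_le) auto
  then show ?thesis by (rule le_less_trans) simp
qed

lemma fits_component:
  assumes h: "0 < h" "h < g x"
  shows "left_end g h x < right_end g h x" "right_end g h x < \<infinity>" "fits g (left_end g h x) (right_end g h x) h"
proof -
  show "left_end g h x < right_end g h x"
    using left_end_attained(1)[OF h(2)] right_end_attained(1)[OF h(2)] by (rule less_trans)
  show f: "right_end g h x < \<infinity>" by (rule right_end_less_infinity[OF h(1)])
  have "h \<le> g y" if "left_end g h x < ereal y" "ereal y < right_end g h x" for y
    using between_left_end[OF that(1)] between_right_end[OF that(2)] h(2) by (cases y x rule: linorder_cases) auto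
  moreover have "ext0 g (left_end g h x) \<le> h" using left_end_attained(2)[OF h(2)] h(1) by auto
  moreover have "ext0 g (right_end g h x) \<le> h" using right_end_attained(2)[OF h(2)] f by auto
  ultimately show "fits g (left_end g h x) (right_end g h x) h" by (simp add: fits_def)
qed

lemma component_in_excursion_chords:
  assumes "0 < h" "h < g x" shows "chord (left_end g h x) (right_end g h x) \<in> excursion_chords g"
  using chord_in_excursion_chords[OF fits_component(1,2)[OF assms]] fits_component(3)[OF assms] by blast

lemma linked_iff:
  assumes "h < g x" shows "linked g h x y \<longleftrightarrow> left_end g h x < ereal y \<and> ereal y < right_end g h x"
proof
  assume s: "linked g h x y"
  then show "left_end g h x < ereal y \<and> ereal y < right_end g h x"
    using left_end_attained(1)[OF sameD(2)[OF s]] right_end_attained(1)[OF sameD(2)[OF s]] linked_ends_eq[OF s] by simp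
next
  assume y: "left_end g h x < ereal y \<and> ereal y < right_end g h x"
  show "linked g h x y" unfolding linked_def
  proof (intro allI impI)
    fix z assume z: "min x y \<le> z \<and> z \<le> max x y"
    have "left_end g h x < ereal z"
    proof (cases "x \<le> z")
      case True
      then show ?thesis by (intro less_le_trans[OF left_end_attained(1)[OF assms]]) simp
    next
      case False
      then have "ereal y \<le> ereal z" using z by auto
      then show ?thesis using y less_le_trans by blast
    qed
    moreover have "ereal z < right_end g h x"
    proof (cases "z \<le> x")
      case True
      then show ?thesis by (intro le_less_trans[OF _ right_end_attained(1)[OF assms]]) simp
    next
      case False
      then have "ereal z \<le> ereal y" using z by auto
      then show ?thesis using y le_less_trans by blast
    qed
    ultimately show "h < g z"
      using between_left_end[of g h x z] between_right_end[of z g h x] assms by (cases z x rule: linorder_cases) auto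
  qed
qed

text \<open>
  If chords from \<open>a\<close> to \<open>b\<close> and from \<open>c\<close> to \<open>d\<close> with \<open>a < c < b < d\<close> fit under the graph, the values
  of \<open>g\<close> at \<open>c\<close> and \<open>b\<close> force their heights to agree. Then the chord from \<open>a\<close> to \<open>d\<close> fits as well
  and meets the graph in four points.
\<close>

lemma noncrossing_excursion_chords: "noncrossing_set (excursion_chords g)"
proof -
  have no: False if ord: "a < c" "c < b" "b < d" "d < \<infinity>" and c1: "fits g a b k" and c2: "fits g c d l"
    for a b c d k l
  proof -
    have cc: "c \<noteq> -\<infinity>" "c \<noteq> \<infinity>" "b \<noteq> -\<infinity>" "b \<noteq> \<infinity>" using ord by auto
    then obtain c' b' where e: "c = ereal c'" "b = ereal b'" by (metis ereal_cases)
    have "k \<le> g c'" "g c' \<le> l" "l \<le> g b'" "g b' \<le> k" using c1 c2 ord e by (auto simp: fits_def)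
    then have k: "l = k" "g c' = k" "g b' = k" by linarith+
    have "fits g a d k"
      unfolding fits_def
    proof (intro conjI allI impI)
      fix x assume x: "a < ereal x \<and> ereal x < d"
      show "k \<le> g x"
      proof (cases "ereal x < b")
        case True then show ?thesis using x c1 by (simp add: fits_def)
      next
        case False
        then have "c < ereal x" using ord(2) by (simp add: not_less less_le_trans)
        then show ?thesis using x c2 k by (simp add: fits_def)
      qed
    qed (use c1 c2 k in \<open>auto simp: fits_def\<close>)
    then have "\<not> (ext0 g c \<le> k \<and> ext0 g b \<le> k)" using at_most_three ord unfolding at_most_three_def by blast
    then show False using k e by simp
  qed
  show ?thesis unfolding noncrossing_set_def
  proof (intro conjI ballI excursion_chords_geodesics)
    fix \<gamma> \<delta> assume "\<gamma> \<in> excursion_chords g" "\<delta> \<in> excursion_chords g"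
    moreover obtain a b k where "\<gamma> = chord a b" "a < b" "b < \<infinity>" "fits g a b k"
      using \<open>\<gamma> \<in> excursion_chords g\<close> unfolding excursion_chords_def by blast
    moreover obtain c d l where "\<delta> = chord c d" "c < d" "d < \<infinity>" "fits g c d l"
      using \<open>\<delta> \<in> excursion_chords g\<close> unfolding excursion_chords_def by blast
    ultimately have "\<gamma> = chord a b" "a < b" "b < \<infinity>" "fits g a b k"
      "\<delta> = chord c d" "c < d" "d < \<infinity>" "fits g c d l" by blast+
    then show "\<not> crossing \<gamma> \<delta>" using no[of a c b d k l] no[of c a d b l k] crossing_chord[of a b c d] by auto
  qed
qed

text \<open>
  If the chord from \<open>a\<close> to \<open>b\<close> does not fit, \<open>g\<close> is at an interior point \<open>x\<close> smaller than at one
  end. For a height \<open>h\<close> in between, the component of \<open>{g > h}\<close> around that end stops before reaching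
  \<open>x\<close>, and its chord crosses the given one.
\<close>

lemma maximal_excursion_chords:
  assumes L': "noncrossing_set L'" "excursion_chords g \<subseteq> L'"
  shows "L' = excursion_chords g"
proof -
  have "\<gamma> \<in> excursion_chords g" if \<gamma>: "\<gamma> \<in> L'" for \<gamma>
  proof (rule ccontr)
    assume not: "\<gamma> \<notin> excursion_chords g"
    have "\<gamma> \<in> geodesics" using L'(1) \<gamma> by (auto simp: noncrossing_set_def)
    then obtain a b where ab: "a < b" "b < \<infinity>" "\<gamma> = chord a b" by (rule geodesic_cases)
    have "\<not> fits g a b (max (ext0 g a) (ext0 g b))"
      using not chord_in_excursion_chords[OF ab(1,2)] ab(3) by blast
    then obtain x where x: "a < ereal x" "ereal x < b" "g x < max (ext0 g a) (ext0 g b)"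
      by (auto simp: fits_def not_le)
    have comp: "chord (left_end g h z) (right_end g h z) \<in> L'" if "0 < h" "h < g z" for h z
      using component_in_excursion_chords[OF that] L'(2) by blast
    have nc: "\<not> crossing (chord a b) (chord (left_end g h z) (right_end g h z))" if "0 < h" "h < g z" for h z
      using comp[OF that] \<gamma> L'(1) ab(3) by (auto simp: noncrossing_set_def)
    show False
    proof (cases "g x < ext0 g a")
      case True
      then have "a \<noteq> -\<infinity>" using nonneg[of x] by auto
      then obtain a' where a: "a = ereal a'" using ab by (cases a) auto
      obtain h where h: "g x < h" "h < g a'" using True a dense by auto
      then have h0: "0 < h" using nonneg[of x] by linarith
      have "right_end g h a' \<le> ereal x" using h x a by (intro right_end_le) auto
      then have "right_end g h a' < b" using x(2) by (rule le_less_trans)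
      then have "crossing (chord a b) (chord (left_end g h a') (right_end g h a'))"
        using crossing_chord[OF ab(1,2) fits_component(1,2)[OF h0 h(2)]]
          left_end_attained(1)[OF h(2)] right_end_attained(1)[OF h(2)] a by simp
      then show False using nc[OF h0 h(2)] by simp
    next
      case False
      then have gb: "g x < ext0 g b" using x(3) by (simp add: max_def split: if_splits)
      have "b \<noteq> -\<infinity>" using ab by auto
      then obtain b' where b: "b = ereal b'" using ab by (cases b) auto
      obtain h where h: "g x < h" "h < g b'" using gb b dense by auto
      then have h0: "0 < h" using nonneg[of x] by linarith
      have "ereal x \<le> left_end g h b'" using h x b by (intro left_end_ge) auto
      then have "a < left_end g h b'" using x(1) by (rule less_le_trans[rotated])
      then have "crossing (chord a b) (chord (left_end g h b') (right_end g h b'))"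
        using crossing_chord[OF ab(1,2) fits_component(1,2)[OF h0 h(2)]]
          left_end_attained(1)[OF h(2)] right_end_attained(1)[OF h(2)] b by simp
      then show False using nc[OF h0 h(2)] by simp
    qed
  qed
  then show ?thesis using L'(2) by blast
qed

lemma lamination_excursion_chords: "lamination (excursion_chords g)"
  unfolding lamination_def using noncrossing_excursion_chords maximal_excursion_chords by blast

end

section \<open>The measure on the chords of a height function\<close>

lemma open_arc_real_vimage:
  assumes "open_arc A" shows "open {x. bdry_pt (ereal x) \<in> A}"
proof -
  obtain A' where A: "open A'" "A = sphere 0 1 \<inter> A'"
    using assms unfolding open_arc_def openin_open by auto
  have eq: "{x. bdry_pt (ereal x) \<in> A} = (\<lambda>x. cis (2 * arctan x)) -` A'"
    by (auto simp: A(2) bdry_pt_eq_cis angle_def)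
  show ?thesis unfolding eq by (intro open_vimage A continuous_intros)
qed

lemma arc_infinity_nbhd:
  assumes "open_arc A" "bdry_pt (-\<infinity>) \<in> A"
  obtains l r where "\<And>x. x < l \<Longrightarrow> bdry_pt (ereal x) \<in> A" "\<And>x. r < x \<Longrightarrow> bdry_pt (ereal x) \<in> A"
proof -
  obtain A' where A: "open A'" "A = sphere 0 1 \<inter> A'"
    using assms unfolding open_arc_def openin_open by auto
  have b: "bdry_pt (ereal x) = cis (2 * arctan x)" for x by (simp add: bdry_pt_eq_cis angle_def)
  have m: "-1 \<in> A'" using assms(2) A(2) by (simp add: bdry_pt_def)
  have cont: "isCont cis t" for t
    using continuous_on_cis[OF continuous_on_id, of UNIV] by (simp add: continuous_on_eq_continuous_at)
  have "((\<lambda>x. cis (2 * arctan x)) \<longlongrightarrow> cis (2 * (pi / 2))) at_top"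
    by (intro isCont_tendsto_compose[OF cont] tendsto_mult tendsto_const tendsto_arctan_at_top)
  then have "\<forall>\<^sub>F x in at_top. cis (2 * arctan x) \<in> A'" using A(1) m by (intro topological_tendstoD) auto
  then obtain r where r: "\<And>x. r \<le> x \<Longrightarrow> cis (2 * arctan x) \<in> A'"
    unfolding eventually_at_top_linorder by blast
  have "((\<lambda>x. cis (2 * arctan x)) \<longlongrightarrow> cis (2 * - (pi / 2))) at_bot"
    by (intro isCont_tendsto_compose[OF cont] tendsto_mult tendsto_const tendsto_arctan_at_bot)
  moreover have "cis (2 * - (pi / 2)) = -1" by (simp add: complex_eq_iff)
  ultimately have "\<forall>\<^sub>F x in at_bot. cis (2 * arctan x) \<in> A'"
    using A(1) m topological_tendstoD by metis
  then obtain l where l: "\<And>x. x \<le> l \<Longrightarrow> cis (2 * arctan x) \<in> A'"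
    unfolding eventually_at_bot_linorder by blast
  show ?thesis by (rule that[of l r]) (use l r in \<open>auto simp: b A(2)\<close>)
qed

lemma arc_left_nbhd:
  assumes "open_arc A" "bdry_pt (ereal a) \<in> A"
  obtains l where "l < a" "\<And>x. ereal l < x \<Longrightarrow> x \<le> ereal a \<Longrightarrow> bdry_pt x \<in> A"
proof -
  obtain e where e: "e > 0" "\<And>x. dist x a < e \<Longrightarrow> bdry_pt (ereal x) \<in> A"
    using open_arc_real_vimage[OF assms(1)] assms(2) unfolding open_dist by blast
  show ?thesis
  proof (rule that[of "a - e"])
    fix x assume x: "ereal (a - e) < x" "x \<le> ereal a"
    then obtain t where "x = ereal t" by (cases x) auto
    then show "bdry_pt x \<in> A" using e(2)[of t] x by (simp add: dist_real_def)
  qed (use e in simp)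
qed

lemma arc_right_nbhd:
  assumes "open_arc A" "bdry_pt a \<in> A" "a \<noteq> \<infinity>"
  obtains r where "a < ereal r" "\<And>x. a \<le> x \<Longrightarrow> x < ereal r \<Longrightarrow> bdry_pt x \<in> A"
proof (cases a)
  case (real a')
  obtain e where e: "e > 0" "\<And>x. dist x a' < e \<Longrightarrow> bdry_pt (ereal x) \<in> A"
    using open_arc_real_vimage[OF assms(1)] assms(2) real unfolding open_dist by blast
  show ?thesis
  proof (rule that[of "a' + e"])
    fix x assume x: "a \<le> x" "x < ereal (a' + e)"
    then obtain t where "x = ereal t" using real by (cases x) auto
    then show "bdry_pt x \<in> A" using e(2)[of t] x real by (simp add: dist_real_def)
  qed (use e real in simp)
next
  case MInf
  obtain l r where l: "\<And>x. x < l \<Longrightarrow> bdry_pt (ereal x) \<in> A"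
    using arc_infinity_nbhd[OF assms(1)] assms(2) MInf by metis
  show ?thesis
  proof (rule that[of l])
    fix x assume x: "a \<le> x" "x < ereal l"
    show "bdry_pt x \<in> A" using x l assms(2) MInf by (cases x) auto
  qed (use MInf in simp)
qed (use assms in simp)

lemma upward_closed_borel:
  fixes S :: "real set" assumes "\<And>a b. a \<in> S \<Longrightarrow> a \<le> b \<Longrightarrow> b \<in> S" shows "S \<in> sets borel"
proof -
  have "mono (indicator S :: real \<Rightarrow> real)" using assms by (intro monoI) (auto simp: indicator_def)
  then have "(indicator S :: real \<Rightarrow> real) \<in> borel_measurable borel" by (rule borel_measurable_mono)
  then show ?thesis by (simp add: borel_measurable_indicator_iff)
qed

lemma linked_borel: "{h. linked g h x y} \<in> sets borel"
proof -
  have "{h. \<not> linked g h x y} \<in> sets borel"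
    by (rule upward_closed_borel) (use linked_antimono in blast)
  then have "- {h. \<not> linked g h x y} \<in> sets borel" by (rule borel_comp)
  then show ?thesis by (simp add: Compl_eq)
qed

lemma count_lborel_sets:
  assumes "\<And>n. {h. (n, h) \<in> X} \<in> sets borel"
  shows "X \<in> sets (count_space (UNIV :: nat set) \<Otimes>\<^sub>M lborel)"
proof -
  have "(\<Union>n\<in>UNIV. {n} \<times> {h. (n, h) \<in> X}) \<in> sets (count_space (UNIV :: nat set) \<Otimes>\<^sub>M lborel)"
    using assms by (intro sets.countable_UN' pair_measureI) auto
  moreover have "(\<Union>n\<in>UNIV. {n} \<times> {h. (n, h) \<in> X}) = X" by auto
  ultimately show ?thesis by simp
qed

definition rat_point :: "nat \<Rightarrow> real" where
  "rat_point = from_nat_into \<rat>"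

lemma rat_point_surj: assumes "r \<in> \<rat>" obtains n where "rat_point n = r"
proof -
  have "range rat_point = \<rat>" unfolding rat_point_def
    using Rats_0 by (intro range_from_nat_into countable_rat) blast
  then have "r \<in> range rat_point" using assms by simp
  then show ?thesis using that by blast
qed

context excursion
begin

abbreviation chords where "chords \<equiv> excursion_chords g"

abbreviation chord_space where
  "chord_space \<equiv> sigma chords {U. openin (lam_topology chords) U}"

text \<open>
  Each component of \<open>{g > h}\<close> contains rational points; the pair \<open>(n, h)\<close> stands for the component
  around the \<open>n\<close>-th rational if no earlier rational lies in the same component. In this way every
  component at a height \<open>h > 0\<close> is listed once.
\<close>

definition fresh :: "(nat \<times> real) set" where
  "fresh = {(n, h). 0 < h \<and> h < g (rat_point n) \<and> (\<forall>m<n. \<not> linked g h (rat_point n) (rat_point m))}"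

definition component :: "nat \<times> real \<Rightarrow> complex set" where
  "component = (\<lambda>(n, h). chord (left_end g h (rat_point n)) (right_end g h (rat_point n)))"

text \<open>
  Lebesgue measure in the heights, carried over to the chords spanned by the components.
\<close>

definition lam_measure :: "complex set measure" where
  "lam_measure = distr (restrict_space (count_space UNIV \<Otimes>\<^sub>M lborel) fresh)
     chord_space component"

lemma fresh_section: "{h. (n, h) \<in> fresh} \<in> sets borel"
proof -
  have "{0<..<g (rat_point n)} - (\<Union>m\<in>{..<n}. {h. linked g h (rat_point n) (rat_point m)}) \<in> sets borel"
    by (intro sets.Diff sets.countable_UN') (auto intro: linked_borel)
  moreover have "{h. (n, h) \<in> fresh} =
      {0<..<g (rat_point n)} - (\<Union>m\<in>{..<n}. {h. linked g h (rat_point n) (rat_point m)})"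
    by (auto simp: fresh_def)
  ultimately show ?thesis by simp
qed

lemma fresh_sets: "fresh \<in> sets (count_space UNIV \<Otimes>\<^sub>M lborel)"
  by (rule count_lborel_sets[OF fresh_section])

lemma component_in_chords: "nh \<in> fresh \<Longrightarrow> component nh \<in> chords"
proof -
  assume nh: "nh \<in> fresh"
  obtain n h where e: "nh = (n, h)" by (cases nh)
  then have "0 < h" "h < g (rat_point n)" using nh by (auto simp: fresh_def)
  then show "component nh \<in> chords" using component_in_excursion_chords by (simp add: e component_def)
qed

text \<open>
  At a fixed \<open>n\<close> the condition on the right is monotone in \<open>h\<close>, which gives measurability.
\<close>

lemma component_over:
  assumes "(n, h) \<in> fresh" "x \<le> y"
  shows "component (n, h) \<in> leaves_over chords x y \<longleftrightarrow> linked g h (rat_point n) x \<and> linked g h (rat_point n) y"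
proof -
  have h: "0 < h" "h < g (rat_point n)" using assms(1) by (auto simp: fresh_def)
  let ?l = "left_end g h (rat_point n)" and ?r = "right_end g h (rat_point n)"
  have "component (n, h) \<in> leaves_over chords x y \<longleftrightarrow> ?l < ereal x \<and> ereal y < ?r"
    using component_in_chords[OF assms(1)] fits_component(1,2)[OF h]
    by (simp add: leaves_over_def component_def)
  also have "\<dots> \<longleftrightarrow> (?l < ereal x \<and> ereal x < ?r) \<and> (?l < ereal y \<and> ereal y < ?r)"
    using assms(2) less_le_trans[of ?l "ereal x" "ereal y"] le_less_trans[of "ereal x" "ereal y" ?r] by auto
  finally show ?thesis using linked_iff[OF h(2)] by simp
qed

lemma sets_lam:
  "sets chord_space = sigma_sets chords {U. openin (lam_topology chords) U}"
  "space chord_space = chords"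
proof -
  have "{U. openin (lam_topology chords) U} \<subseteq> Pow chords"
    using openin_subset[of "lam_topology chords"] by (auto simp: lam_topology_def O_set_def)
  then show "sets chord_space = sigma_sets chords {U. openin (lam_topology chords) U}"
    "space chord_space = chords"
    by (simp_all add: sets_measure_of space_measure_of)
qed

lemma measurable_component:
  "component \<in> measurable (restrict_space (count_space UNIV \<Otimes>\<^sub>M lborel) fresh)
     chord_space"
proof (rule measurable_sigma_sets)
  let ?B = "count_space (UNIV :: nat set) \<Otimes>\<^sub>M lborel"
  show "sets chord_space
      = sigma_sets chords {leaves_over chords x y |x y. x \<le> y}"
    unfolding sets_lam(1) by (rule sigma_sets_lam_topology[OF excursion_chords_geodesics])
  show "{leaves_over chords x y |x y. x \<le> y} \<subseteq> Pow chords" by (auto simp: leaves_over_def)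
  have sp: "space (restrict_space ?B fresh) = fresh"
    by (simp add: space_restrict_space space_pair_measure)
  show "component \<in> space (restrict_space ?B fresh) \<rightarrow> chords"
    unfolding sp using component_in_chords by auto
  fix E assume "E \<in> {leaves_over chords x y |x y. x \<le> y}"
  then obtain x y where E: "E = leaves_over chords x y" "x \<le> y" by blast
  define X where "X = {(n, h). linked g h (rat_point n) x \<and> linked g h (rat_point n) y}"
  have "X \<in> sets ?B"
  proof (rule count_lborel_sets)
    fix n show "{h. (n, h) \<in> X} \<in> sets borel"
      using sets.Int[OF linked_borel linked_borel, of g "rat_point n" x g "rat_point n" y]
      by (simp add: X_def Collect_conj_eq)
  qed
  then have "fresh \<inter> X \<in> sets (restrict_space ?B fresh)"
    unfolding sets_restrict_space by (rule imageI)
  moreover have "component -` E \<inter> fresh = fresh \<inter> X"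
    using component_over[OF _ E(2)] unfolding E(1) X_def by auto
  ultimately show "component -` E \<inter> space (restrict_space ?B fresh) \<in> sets (restrict_space ?B fresh)"
    unfolding sp by simp
qed

lemma space_lam_measure: "space lam_measure = chords"
  and sets_lam_measure: "sets lam_measure = sigma_sets chords {U. openin (lam_topology chords) U}"
  unfolding lam_measure_def by (simp_all only: space_distr sets_distr sets_lam)

lemma O_set_sets_lam_measure: "open_arc A \<Longrightarrow> open_arc B \<Longrightarrow> O_set chords A B \<in> sets lam_measure"
  unfolding sets_lam_measure by (rule O_set_in_sets)

lemma
  assumes E: "E \<in> sets lam_measure"
  shows preimage_sets: "{nh\<in>fresh. component nh \<in> E} \<in> sets (count_space UNIV \<Otimes>\<^sub>M lborel)"
    and emeasure_lam_measure: "emeasure lam_measure E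
      = emeasure (count_space UNIV \<Otimes>\<^sub>M lborel) {nh\<in>fresh. component nh \<in> E}"
proof -
  let ?B = "count_space (UNIV :: nat set) \<Otimes>\<^sub>M lborel"
  have E': "E \<in> sets chord_space"
    using E by (simp add: lam_measure_def)
  have sp: "space (restrict_space ?B fresh) = fresh"
    by (simp add: space_restrict_space space_pair_measure)
  have eq: "component -` E \<inter> space (restrict_space ?B fresh) = {nh\<in>fresh. component nh \<in> E}"
    unfolding sp by auto
  have "{nh\<in>fresh. component nh \<in> E} \<in> sets (restrict_space ?B fresh)"
    using measurable_sets[OF measurable_component E'] unfolding eq .
  then show "{nh\<in>fresh. component nh \<in> E} \<in> sets ?B"
    using fresh_sets by (simp add: sets_restrict_space_iff space_pair_measure)
  show "emeasure lam_measure E = emeasure ?B {nh\<in>fresh. component nh \<in> E}"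
    unfolding lam_measure_def emeasure_distr[OF measurable_component E'] eq
    using fresh_sets by (intro emeasure_restrict_space) (auto simp: space_pair_measure)
qed

lemma emeasure_by_height:
  assumes "X \<in> sets (count_space (UNIV :: nat set) \<Otimes>\<^sub>M lborel)"
  shows "emeasure (count_space UNIV \<Otimes>\<^sub>M lborel) X
    = (\<integral>\<^sup>+h. emeasure (count_space UNIV) {n. (n, h) \<in> X} \<partial>lborel)"
proof -
  interpret sigma_finite_measure "count_space (UNIV :: nat set)"
    by (rule sigma_finite_measure_count_space_countable) simp
  interpret pair_sigma_finite "count_space (UNIV :: nat set)" lborel by unfold_locales
  show ?thesis using emeasure_pair_measure_alt2[OF assms] by (simp add: vimage_def)
qed

text \<open>
  The component of \<open>x\<close> is represented by the first rational in it, and only by that one.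
\<close>

lemma fresh_ex1:
  assumes "0 < h" "h < g x"
  shows "\<exists>n. {n. (n, h) \<in> fresh \<and> linked g h (rat_point n) x} = {n}"
proof -
  have ex: "\<exists>n. linked g h (rat_point n) x"
  proof -
    obtain q where q: "ereal x < ereal (real_of_rat q)" "ereal (real_of_rat q) < right_end g h x"
      using ereal_dense3[OF right_end_attained(1)[OF assms(2)]] by blast
    obtain n where n: "rat_point n = real_of_rat q" using rat_point_surj[of "real_of_rat q"] by auto
    have "linked g h x (rat_point n)"
      unfolding n linked_iff[OF assms(2)] using q less_trans[OF left_end_attained(1)[OF assms(2)] q(1)] by simp
    then show ?thesis using linked_sym by blast
  qed
  define n where "n = (LEAST n. linked g h (rat_point n) x)"
  have n: "linked g h (rat_point n) x" unfolding n_def using ex by (rule LeastI_ex)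
  have least: "n \<le> m" if "linked g h (rat_point m) x" for m unfolding n_def using that by (rule Least_le)
  have f: "(n, h) \<in> fresh"
  proof -
    have "\<not> linked g h (rat_point n) (rat_point m)" if "m < n" for m
    proof
      assume "linked g h (rat_point n) (rat_point m)"
      then have "linked g h (rat_point m) x" using linked_trans[OF _ n] linked_sym by blast
      then show False using least[of m] that by simp
    qed
    then show ?thesis using assms(1) sameD(1)[OF n] by (simp add: fresh_def)
  qed
  have "m = n" if m: "(m, h) \<in> fresh" "linked g h (rat_point m) x" for m
  proof (rule ccontr)
    assume "m \<noteq> n"
    then have "n < m" using least[OF m(2)] by simp
    moreover have "linked g h (rat_point m) (rat_point n)" using linked_trans[OF m(2)] n linked_sym by blast
    ultimately show False using m(1) by (simp add: fresh_def)
  qed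
  then have "{n. (n, h) \<in> fresh \<and> linked g h (rat_point n) x} = {n}" using f n by blast
  then show ?thesis by blast
qed

text \<open>
  By Fubini: at each height \<open>h\<close> with \<open>0 < h < g x\<close> exactly one component lies over \<open>x\<close>.
\<close>

lemma emeasure_straddle: "emeasure lam_measure (leaves_over chords x x) = ennreal (g x)"
proof -
  have E: "leaves_over chords x x \<in> sets lam_measure"
    unfolding sets_lam_measure by (rule leaves_over_in_sets[OF excursion_chords_geodesics])
  let ?X = "{nh\<in>fresh. component nh \<in> leaves_over chords x x}"
  have "emeasure (count_space UNIV) {n. (n, h) \<in> ?X} = indicator {0<..<g x} h" for h
  proof -
    have eq: "{n. (n, h) \<in> ?X} = {n. (n, h) \<in> fresh \<and> linked g h (rat_point n) x}"
      using component_over[OF _ order_refl] by auto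
    show ?thesis
    proof (cases "0 < h \<and> h < g x")
      case True
      then obtain n where "{n. (n, h) \<in> ?X} = {n}" unfolding eq using fresh_ex1 by blast
      then show ?thesis using True by simp
    next
      case False
      then have "{n. (n, h) \<in> ?X} = {}" unfolding eq using sameD(2) by (auto simp: fresh_def)
      then have "emeasure (count_space UNIV) {n. (n, h) \<in> ?X} = 0" by (simp only: emeasure_empty)
      then show ?thesis using False by (simp only: indicator_def) simp
    qed
  qed
  then have "emeasure lam_measure (leaves_over chords x x) = (\<integral>\<^sup>+h. indicator {0<..<g x} h \<partial>lborel)"
    unfolding emeasure_lam_measure[OF E] emeasure_by_height[OF preimage_sets[OF E]] by simp
  then show ?thesis using nonneg[of x] by simp
qed

lemma left_end_inj:
  assumes "h < g x" "h < g y" "left_end g h x = left_end g h y" shows "linked g h x y"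
proof -
  have *: "linked g h y x" if "x \<le> y" "h < g x" "h < g y" "left_end g h x = left_end g h y" for x y
  proof -
    have "ereal x < right_end g h y"
      by (rule le_less_trans[OF _ right_end_attained(1)[OF that(3)]]) (simp add: that)
    then show ?thesis using linked_iff[OF that(3)] left_end_attained(1)[OF that(2)] that(4) by simp
  qed
  show ?thesis
  proof (cases "x \<le> y")
    case True
    then have "linked g h y x" by (rule *[OF _ assms])
    then show ?thesis by (subst linked_sym)
  next
    case False
    then show ?thesis using *[OF _ assms(2,1) assms(3)[symmetric]] by simp
  qed
qed

text \<open>
  Components are counted by their left ends. Adding a new smallest point \<open>x\<close> to the sample \<open>y, \<dots>\<close>
  adds a component only at heights \<open>h < g x\<close> that \<open>g\<close> undercuts between \<open>x\<close> and \<open>y\<close>, and these lie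
  in an interval of length \<open>W y - W x\<close>. The bounds add up to a telescoping sum.
\<close>

lemma component_count_bound:
  assumes W: "mono W" "\<And>x y. x \<le> y \<Longrightarrow> \<bar>g y - g x\<bar> \<le> W y - W x" and G: "\<And>x. g x \<le> G"
    and xs: "sorted_wrt (<) xs" "xs \<noteq> []"
  shows "\<exists>b\<in>borel_measurable lborel.
    (\<forall>h>0. of_nat (card (left_end g h ` {t\<in>set xs. h < g t})) \<le> b h) \<and>
    (\<integral>\<^sup>+h. b h \<partial>lborel) \<le> ennreal (G + W (last xs) - W (hd xs))"
  using xs
proof (induction xs rule: induct_list012)
  case (2 x)
  have "of_nat (card (left_end g h ` {t\<in>set [x]. h < g t})) \<le> (indicator {0<..<g x} h :: ennreal)" if "0 < h" for h
  proof (cases "h < g x")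
    case True
    then have "{t\<in>set [x]. h < g t} = {x}" by auto
    then show ?thesis using True that by simp
  next
    case False
    then have "{t\<in>set [x]. h < g t} = {}" by auto
    then show ?thesis by (simp only: image_empty card.empty) simp
  qed
  moreover have "(\<integral>\<^sup>+h. indicator {0<..<g x} h \<partial>lborel) \<le> ennreal (G + W (last [x]) - W (hd [x]))"
    using nonneg[of x] G[of x] by (simp add: ennreal_leI)
  ultimately show ?case
    by (intro bexI[of _ "indicator {0<..<g x}"]) auto
next
  case (3 x y xs)
  have xy: "x < y" and sorted: "sorted_wrt (<) (y # xs)" using "3.prems" by auto
  obtain b where b: "b \<in> borel_measurable lborel"
    "\<And>h. 0 < h \<Longrightarrow> of_nat (card (left_end g h ` {t\<in>set (y # xs). h < g t})) \<le> b h"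
    "(\<integral>\<^sup>+h. b h \<partial>lborel) \<le> ennreal (G + W (last (y # xs)) - W (hd (y # xs)))"
    using "3.IH"(2)[OF sorted] by blast
  define J where "J = {g x - (W y - W x)..g x}"
  define c where "c h = indicator J h + b h" for h
  have Wxy: "0 \<le> W y - W x" using W(1) xy by (simp add: monoD)
  have "of_nat (card (left_end g h ` {t\<in>set (x # y # xs). h < g t})) \<le> c h" if h: "0 < h" for h
  proof -
    let ?T = "left_end g h ` {t\<in>set (y # xs). h < g t}"
    show ?thesis
    proof (cases "h < g x \<and> \<not> linked g h x y")
      case True
      then obtain z where z: "x \<le> z" "z \<le> y" "g z \<le> h" using xy by (auto simp: linked_def not_less)
      have "g x - g z \<le> W z - W x" using W(2)[OF z(1)] by linarith
      also have "\<dots> \<le> W y - W x" using monoD[OF W(1) z(2)] by simp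
      finally have "h \<in> J" using True z(3) by (simp add: J_def)
      have "left_end g h ` {t\<in>set (x # y # xs). h < g t} = insert (left_end g h x) ?T" using True by auto
      moreover have "card (insert (left_end g h x) ?T) \<le> Suc (card ?T)"
        by (rule card_insert_le_m1) simp_all
      ultimately have "of_nat (card (left_end g h ` {t\<in>set (x # y # xs). h < g t})) \<le> (of_nat (Suc (card ?T)) :: ennreal)"
        by (simp only: of_nat_le_iff)
      also have "\<dots> = 1 + of_nat (card ?T)" by simp
      also have "\<dots> \<le> c h" using b(2)[OF h] \<open>h \<in> J\<close> by (simp add: c_def add_left_mono)
      finally show ?thesis .
    next
      case False
      have "left_end g h ` {t\<in>set (x # y # xs). h < g t} = ?T"
      proof (cases "h < g x")
        case True
        then have s: "linked g h x y" using False by simp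
        have "left_end g h x \<in> ?T" using linked_ends_eq(1)[OF s] sameD(2)[OF s] by auto
        moreover have "left_end g h ` {t\<in>set (x # y # xs). h < g t} = insert (left_end g h x) ?T" using True by auto
        ultimately show ?thesis by (simp only: insert_absorb)
      next
        case False
        then have "{t\<in>set (x # y # xs). h < g t} = {t\<in>set (y # xs). h < g t}" by auto
        then show ?thesis by (simp only:)
      qed
      then show ?thesis using b(2)[OF h] by (simp only: c_def) (metis add.commute add_increasing2 zero_le)
    qed
  qed
  moreover have "c \<in> borel_measurable lborel" unfolding c_def[abs_def] J_def using b(1) by measurable
  moreover have "(\<integral>\<^sup>+h. c h \<partial>lborel) \<le> ennreal (G + W (last (x # y # xs)) - W (hd (x # y # xs)))"
  proof -
    have "(\<integral>\<^sup>+h. c h \<partial>lborel) = (\<integral>\<^sup>+h. indicator J h \<partial>lborel) + (\<integral>\<^sup>+h. b h \<partial>lborel)"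
      unfolding c_def using b(1) by (intro nn_integral_add) (auto simp: J_def)
    also have "(\<integral>\<^sup>+h. indicator J h \<partial>lborel) = ennreal (W y - W x)" using Wxy by (simp add: J_def)
    also have "ennreal (W y - W x) + (\<integral>\<^sup>+h. b h \<partial>lborel)
        \<le> ennreal (W y - W x) + ennreal (G + W (last (y # xs)) - W y)"
      using b(3) by (intro add_left_mono) simp
    also have "\<dots> = ennreal ((W y - W x) + (G + W (last (y # xs)) - W y))"
    proof (rule ennreal_plus[symmetric])
      have "y \<le> last (y # xs)" using sorted by (cases "xs = []") (auto intro: less_imp_le)
      then have "W y \<le> W (last (y # xs))" by (rule monoD[OF W(1)])
      moreover have "0 \<le> G" using nonneg[of 0] G[of 0] by linarith
      ultimately show "0 \<le> G + W (last (y # xs)) - W y" by linarith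
    qed (rule Wxy)
    finally show ?thesis by (simp add: algebra_simps)
  qed
  ultimately show ?case by blast
qed simp

lemma emeasure_chords_finite: "emeasure lam_measure chords < \<infinity>"
proof -
  obtain W where W: "mono W" "bounded (range W)" "\<And>x y. x \<le> y \<Longrightarrow> \<bar>g y - g x\<bar> \<le> W y - W x"
    using height_function unfolding height_function_def bv_def by metis
  obtain C where C: "\<And>x. \<bar>W x\<bar> \<le> C" using W(2) unfolding bounded_range_real_iff by metis
  define G where "G = g 0 + 2 * C"
  have G: "g x \<le> G" for x
    using W(3)[of 0 x] W(3)[of x 0] C[of x] C[of 0] unfolding G_def by (cases "0 \<le> x") auto
  define F where "F n = {h. (n, h) \<in> fresh}" for n
  have F: "F n \<in> sets borel" for n unfolding F_def by (rule fresh_section)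
  have partial: "(\<Sum>n<N. emeasure lborel (F n)) \<le> ennreal (G + 2 * C)" for N
  proof (cases "N = 0")
    case False
    define xs where "xs = sorted_list_of_set (rat_point ` {..<N})"
    have xs: "sorted_wrt (<) xs" "set xs = rat_point ` {..<N}" "xs \<noteq> []"
      using False by (auto simp: xs_def strict_sorted_list_of_set)
    obtain b where b: "b \<in> borel_measurable lborel"
      "\<And>h. 0 < h \<Longrightarrow> of_nat (card (left_end g h ` {t\<in>set xs. h < g t})) \<le> b h"
      "(\<integral>\<^sup>+h. b h \<partial>lborel) \<le> ennreal (G + W (last xs) - W (hd xs))"
      using component_count_bound[OF W(1,3) G xs(1,3)] by blast
    have pt: "(\<Sum>n<N. indicator (F n) h) \<le> b h" for h
    proof (cases "0 < h")
      case True
      let ?I = "{n. n < N \<and> (n, h) \<in> fresh}"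
      have sum: "(\<Sum>n<N. indicator (F n) h) = (of_nat (card ?I) :: ennreal)"
      proof -
        have "(\<Sum>n<N. indicator (F n) h) = (\<Sum>n\<in>{..<N}. if n \<in> ?I then 1 else 0 :: ennreal)"
          by (intro sum.cong) (auto simp: F_def indicator_def)
        also have "\<dots> = (\<Sum>n\<in>{..<N} \<inter> ?I. 1)" by (subst sum.inter_restrict) auto
        also have "{..<N} \<inter> ?I = ?I" by auto
        finally show ?thesis by simp
      qed
      have "card ?I \<le> card (left_end g h ` {t\<in>set xs. h < g t})"
      proof (rule card_inj_on_le[of "\<lambda>n. left_end g h (rat_point n)"])
        show "inj_on (\<lambda>n. left_end g h (rat_point n)) ?I"
        proof (rule linorder_inj_onI')
          fix m n assume "m \<in> ?I" "n \<in> ?I" "m < n"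
          then show "left_end g h (rat_point m) \<noteq> left_end g h (rat_point n)"
            using left_end_inj[of h "rat_point n" "rat_point m"] by (auto simp: fresh_def)
        qed
        show "(\<lambda>n. left_end g h (rat_point n)) ` ?I \<subseteq> left_end g h ` {t\<in>set xs. h < g t}"
          using xs(2) by (auto simp: fresh_def)
      qed simp
      then have "(of_nat (card ?I) :: ennreal) \<le> of_nat (card (left_end g h ` {t\<in>set xs. h < g t}))"
        by (simp only: of_nat_le_iff)
      also have "\<dots> \<le> b h" by (rule b(2)[OF True])
      finally show ?thesis unfolding sum .
    next
      case False
      then have "(\<Sum>n<N. indicator (F n) h :: ennreal) = 0" by (auto simp: F_def fresh_def)
      then show ?thesis by simp
    qed
    have "(\<Sum>n<N. emeasure lborel (F n)) = (\<Sum>n<N. \<integral>\<^sup>+h. indicator (F n) h \<partial>lborel)"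
      using F by (intro sum.cong) auto
    also have "\<dots> = (\<integral>\<^sup>+h. (\<Sum>n<N. indicator (F n) h) \<partial>lborel)"
      using F by (intro nn_integral_sum[symmetric]) auto
    also have "\<dots> \<le> (\<integral>\<^sup>+h. b h \<partial>lborel)" by (intro nn_integral_mono pt)
    also have "\<dots> \<le> ennreal (G + W (last xs) - W (hd xs))" by (rule b(3))
    also have "\<dots> \<le> ennreal (G + 2 * C)"
      using C[of "last xs"] C[of "hd xs"] by (intro ennreal_leI) linarith
    finally show ?thesis .
  qed simp
  have top: "chords \<in> sets lam_measure" unfolding sets_lam_measure by (rule sigma_sets_top)
  have all: "{nh\<in>fresh. component nh \<in> chords} = fresh" using component_in_chords by auto
  have "emeasure lam_measure chords = emeasure (count_space UNIV \<Otimes>\<^sub>M lborel) fresh"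
    using emeasure_lam_measure[OF top] unfolding all .
  also have "\<dots> = (\<integral>\<^sup>+n. emeasure lborel (F n) \<partial>count_space UNIV)"
    using lborel.emeasure_pair_measure_alt[OF fresh_sets] by (simp add: F_def vimage_def)
  also have "\<dots> = (\<Sum>n. emeasure lborel (F n))" by (rule nn_integral_count_space_nat)
  also have "\<dots> \<le> ennreal (G + 2 * C)" by (rule suminf_le_const[OF summableI partial])
  also have "\<dots> < \<infinity>" by simp
  finally show ?thesis .
qed

text \<open>
  An interval of heights at which the component of a fixed point \<open>z\<close> yields a chord in \<open>E\<close>
  contributes at least its length.
\<close>

lemma emeasure_pos:
  assumes E: "E \<in> sets lam_measure" and h: "0 \<le> k" "k < l"
    and comp: "\<And>h. k < h \<Longrightarrow> h < l \<Longrightarrow> h < g z \<and> chord (left_end g h z) (right_end g h z) \<in> E"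
  shows "0 < emeasure lam_measure E"
proof -
  let ?X = "{nh\<in>fresh. component nh \<in> E}"
  have le: "indicator {k<..<l} h \<le> emeasure (count_space UNIV) {n. (n, h) \<in> ?X}" for h
  proof (cases "k < h \<and> h < l")
    case True
    then have kh: "k < h" "h < l" by simp_all
    have hz: "h < g z" "0 < h" "chord (left_end g h z) (right_end g h z) \<in> E"
      using comp[OF kh] kh(1) assms(2) by simp_all
    obtain n where n: "(n, h) \<in> fresh" "linked g h (rat_point n) z" using fresh_ex1[OF hz(2,1)] by blast
    have "component (n, h) \<in> E" using hz(3) unfolding component_def by (simp add: linked_ends_eq[OF n(2)])
    then have "n \<in> {n. (n, h) \<in> ?X}" using n(1) by simp
    then have "emeasure (count_space UNIV) {n} \<le> emeasure (count_space UNIV) {n. (n, h) \<in> ?X}"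
      by (intro emeasure_mono) auto
    moreover have "indicator {k<..<l} h = emeasure (count_space UNIV) {n}" using True by simp
    ultimately show ?thesis by (simp only:)
  qed simp
  have "(\<integral>\<^sup>+h. indicator {k<..<l} h \<partial>lborel) \<le> emeasure lam_measure E"
    unfolding emeasure_lam_measure[OF E] emeasure_by_height[OF preimage_sets[OF E]]
    by (rule nn_integral_mono) (rule le)
  moreover have "0 < (\<integral>\<^sup>+h. indicator {k<..<l} h \<partial>lborel)" using h by simp
  ultimately show ?thesis by (rule less_le_trans[rotated])
qed

end

section \<open>Positivity of the measure\<close>

context excursion
begin

lemma limit_point_le:
  assumes "s \<in> closure T" "\<And>t. t \<in> T \<Longrightarrow> g t \<le> k" shows "g s \<le> k"
proof -
  have "T \<subseteq> {x. g x \<le> k}" using assms(2) by blast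
  then have "closure T \<subseteq> {x. g x \<le> k}" by (rule closure_minimal[OF _ closed_sublevel])
  then show ?thesis using assms(1) by blast
qed

text \<open>
  If the chord from \<open>a\<close> to \<open>b\<close> touches the graph at an interior point \<open>z\<close>, then \<open>g\<close> is below \<open>k\<close> at
  \<open>a\<close> or at points arbitrarily close to \<open>a\<close> on the left: otherwise the chord could be extended to
  the left, and the extended chord would meet the graph in four points.
\<close>

lemma touched_left:
  assumes c: "fits g a b k" and z: "a < ereal z" "ereal z < b" "b < \<infinity>" "g z \<le> k" "ext0 g b \<le> k"
    and k: "0 \<le> k" and a: "a = ereal a'" and l: "l < a'"
  shows "\<exists>y. l < y \<and> y \<le> a' \<and> g y < k"
proof (rule ccontr)
  assume none: "\<not> ?thesis"
  have above: "k \<le> g y" if "l < y" "y \<le> a'" for y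
  proof (rule ccontr)
    assume "\<not> k \<le> g y"
    then have "l < y \<and> y \<le> a' \<and> g y < k" using that by simp
    then show False using none by blast
  qed
  define T where "T = {y. y < a' \<and> g y < k}"
  define s where "s = (if T = {} then -\<infinity> else ereal (Sup T))"
  have T: "t \<le> l" if "t \<in> T" for t
  proof (rule ccontr)
    assume "\<not> t \<le> l"
    then show False using above[of t] that by (simp add: T_def)
  qed
  have bdd: "bdd_above T" using T by (rule bdd_aboveI)
  have sl: "s \<le> ereal l" using cSup_least[of T l] T by (auto simp: s_def)
  have s: "s < a" by (rule le_less_trans[OF sl]) (simp add: a l)
  have "ext0 g s \<le> k"
  proof (cases "T = {}")
    case False
    have "g (Sup T) \<le> k"
      by (rule limit_point_le[OF closure_contains_Sup[OF False bdd]]) (auto simp: T_def)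
    then show ?thesis using False by (simp add: s_def)
  qed (use k in \<open>simp add: s_def\<close>)
  moreover have "k \<le> g x" if x: "s < ereal x" "ereal x < b" for x
  proof -
    consider "x < a'" | "x = a'" | "a' < x" by linarith
    then show ?thesis
    proof cases
      case 1
      have "x \<notin> T"
      proof
        assume "x \<in> T"
        then show False using x(1) cSup_upper[OF _ bdd, of x] by (auto simp: s_def split: if_splits)
      qed
      then show ?thesis using 1 by (simp add: T_def)
    next
      case 2 then show ?thesis using above[of a'] l by simp
    next
      case 3 then show ?thesis using c x(2) a by (simp add: fits_def)
    qed
  qed
  ultimately have "fits g s b k" using z(5) by (simp add: fits_def)
  then have "\<not> (ext0 g a \<le> k \<and> ext0 g (ereal z) \<le> k)"
    using at_most_three s z unfolding at_most_three_def by blast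
  moreover have "ext0 g a \<le> k" using c by (simp add: fits_def)
  ultimately show False using z(4) by simp
qed

text \<open>
  In the mirror image of \<open>touched_left\<close> the extended chord must not run to \<open>\<infinity>\<close>. This is where \<open>0 <
  k\<close> enters, as \<open>g\<close> tends to 0 there.
\<close>

lemma touched_right:
  assumes c: "fits g a b k" and z: "a < ereal z" "ereal z < b" "g z \<le> k" "ext0 g a \<le> k"
    and k: "0 < k" and b: "b = ereal b'" and r: "b' < r"
  shows "\<exists>y. b' \<le> y \<and> y < r \<and> g y < k"
proof (rule ccontr)
  assume none: "\<not> ?thesis"
  have above: "k \<le> g y" if "b' \<le> y" "y < r" for y
  proof (rule ccontr)
    assume "\<not> k \<le> g y"
    then have "b' \<le> y \<and> y < r \<and> g y < k" using that by simp
    then show False using none by blast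
  qed
  define T where "T = {y. b' < y \<and> g y < k}"
  define s where "s = Inf T"
  obtain y0 where "b' < y0" "g y0 < k" using exists_below[OF k] .
  then have ne: "T \<noteq> {}" by (auto simp: T_def)
  have T: "r \<le> t" if "t \<in> T" for t
  proof (rule ccontr)
    assume "\<not> r \<le> t"
    then show False using above[of t] that by (simp add: T_def)
  qed
  have bdd: "bdd_below T" using T by (rule bdd_belowI)
  have rs: "r \<le> s" unfolding s_def using ne T by (rule cInf_greatest)
  have "g s \<le> k" unfolding s_def
    by (rule limit_point_le[OF closure_contains_Inf[OF ne bdd]]) (auto simp: T_def)
  moreover have "k \<le> g x" if x: "a < ereal x" "ereal x < ereal s" for x
  proof -
    consider "x < b'" | "x = b'" | "b' < x" by linarith
    then show ?thesis
    proof cases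
      case 1 then show ?thesis using c x(1) b by (simp add: fits_def)
    next
      case 2 then show ?thesis using above[of b'] r by simp
    next
      case 3
      have "x \<notin> T" using x(2) cInf_lower[OF _ bdd, of x] by (auto simp: s_def)
      then show ?thesis using 3 by (simp add: T_def)
    qed
  qed
  ultimately have "fits g a (ereal s) k" using z(4) by (simp add: fits_def)
  moreover have "ext0 g b \<le> k" using c by (simp add: fits_def)
  moreover have "b < ereal s" using b r rs by simp
  moreover have "ereal s < \<infinity>" by simp
  ultimately have "\<not> (ext0 g (ereal z) \<le> k \<and> ext0 g b \<le> k)" "ext0 g b \<le> k"
    using at_most_three z unfolding at_most_three_def by blast+
  then show False using z(3) by simp
qed

text \<open>
  A leaf is approximated by components of \<open>{g > h}\<close>, in one of three ways. Let \<open>k\<close> be the larger one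
  of the values of \<open>g\<close> at the ends. If \<open>g > k\<close> on \<open>(a, b)\<close>, the components of an interior point at
  heights slightly above \<open>k\<close> are close to \<open>(a, b)\<close>. If \<open>g\<close> takes the value \<open>k > 0\<close> at an interior
  point \<open>z\<close>, components of \<open>z\<close> at heights slightly below \<open>k\<close> are used; they enclose \<open>(a, b)\<close> and are
  close to it by \<open>touched_left\<close> and \<open>touched_right\<close>. If this happens with \<open>k = 0\<close>, there is nothing
  below; but then \<open>a = -\<infinity>\<close>, and since \<open>-\<infinity>\<close> and \<open>\<infinity>\<close> are the same boundary point, the leaf is
  approximated from the side of \<open>(b, \<infinity>)\<close>.
\<close>

lemma emeasure_O_set_pos_oriented:
  assumes arcs: "open_arc A" "open_arc B" and ab: "a < b" "b < \<infinity>" and leaf: "chord a b \<in> chords"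
    and ends: "bdry_pt a \<in> A" "bdry_pt b \<in> B"
  shows "0 < emeasure lam_measure (O_set chords A B)"
proof -
  let ?E = "O_set chords A B"
  have E: "?E \<in> sets lam_measure" using O_set_sets_lam_measure[OF arcs] .
  have hit: "h < g z \<and> chord (left_end g h z) (right_end g h z) \<in> ?E"
    if "0 < h" "h < g z" and "bdry_pt (left_end g h z) \<in> A \<and> bdry_pt (right_end g h z) \<in> B
      \<or> bdry_pt (right_end g h z) \<in> A \<and> bdry_pt (left_end g h z) \<in> B" for h z
    using component_in_excursion_chords[OF that(1,2)] that by (simp add: chord_in_O_set)
  have an: "a \<noteq> \<infinity>" and bn: "b \<noteq> \<infinity>" "b \<noteq> -\<infinity>" using ab by auto
  obtain b' where b: "b = ereal b'" using bn by (cases b) auto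
  define k where "k = max (ext0 g a) (ext0 g b)"
  have k0: "0 \<le> k" using ext0_nonneg[of a] by (simp add: k_def)
  have ka: "ext0 g a \<le> k" "g b' \<le> k" by (simp_all add: k_def b)
  obtain k' where "fits g a b k'" using leaf chord_in_excursion_chords[OF ab] by blast
  then have ck: "fits g a b k" by (auto simp: fits_def k_def intro: order_trans)
  have left_end_a: "a \<le> left_end g h x" if "k \<le> h" "a < ereal x" for h x
  proof (cases a)
    case (real a')
    then have "g a' \<le> h" "a' < x" using ka that by auto
    then show ?thesis unfolding real by (rule left_end_ge)
  qed (use an in auto)
  have right_end_b: "right_end g h x \<le> b" if "k \<le> h" "ereal x < b" for h x
  proof -
    have "g b' \<le> h" "x < b'" using ka that b by auto
    then show ?thesis unfolding b by (rule right_end_le)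
  qed
  obtain r where r: "a < ereal r" "\<And>x. a \<le> x \<Longrightarrow> x < ereal r \<Longrightarrow> bdry_pt x \<in> A"
    using arc_right_nbhd[OF arcs(1) ends(1) an] by blast
  obtain l where l: "l < b'" "\<And>x. ereal l < x \<Longrightarrow> x \<le> ereal b' \<Longrightarrow> bdry_pt x \<in> B"
    using arc_left_nbhd[OF arcs(2) ends(2)[unfolded b]] by blast
  show ?thesis
  proof (cases "\<forall>x. a < ereal x \<and> ereal x < b \<longrightarrow> k < g x")
    case True
    obtain x where x: "a < ereal x" "ereal x < min (ereal r) b"
      using ereal_dense2[of a "min (ereal r) b"] r(1) ab(1) by auto
    have xb: "x < b'" "ereal x < ereal r" using x(2) b by auto
    obtain y where y: "max x l < y" "y < b'" using dense[of "max x l" b'] xb l(1) by auto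
    have gap: "k < g z" if "x \<le> z" "z \<le> y" for z
    proof -
      have "a < ereal z" by (rule less_le_trans[OF x(1)]) (simp add: that)
      moreover have "ereal z < b" using that y b by simp
      ultimately show ?thesis using True by blast
    qed
    obtain k2 where k2: "k < k2" "\<And>z. x \<le> z \<Longrightarrow> z \<le> y \<Longrightarrow> k2 < g z" using uniform_gap[OF gap] by blast
    show ?thesis
    proof (rule emeasure_pos[OF E k0 k2(1)])
      fix h assume h: "k < h" "h < k2"
      have hx: "h < g x" using k2(2)[of x] h y(1) by simp
      have "linked g h x y" unfolding linked_def using less_trans[OF h(2) k2(2)] y(1) by (simp add: min_absorb1 max_absorb2)
      then have yr: "ereal y < right_end g h x" using linked_iff[OF hx] by simp
      have "bdry_pt (left_end g h x) \<in> A"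
        using left_end_a[OF less_imp_le[OF h(1)] x(1)] less_trans[OF left_end_attained(1)[OF hx] xb(2)] by (rule r(2))
      moreover have "bdry_pt (right_end g h x) \<in> B"
      proof (rule l(2))
        show "ereal l < right_end g h x" by (rule less_trans[OF _ yr]) (use y in simp)
        show "right_end g h x \<le> ereal b'" using right_end_b[of h x] h(1) xb(1) b by simp
      qed
      ultimately show "h < g x \<and> chord (left_end g h x) (right_end g h x) \<in> ?E" using hit[of h x] h k0 hx by simp
    qed
  next
    case False
    then obtain z where z: "a < ereal z" "ereal z < b" "g z \<le> k" by (auto simp: not_less)
    have gz: "g z = k" using ck z by (intro antisym) (auto simp: fits_def)
    show ?thesis
    proof (cases "0 < k")
      case True
      \<comment> \<open>\<open>k1\<close> controls the left end and \<open>g y\<close> the right end\<close>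
      obtain k1 where k1: "k1 < k" "\<And>h. k1 \<le> h \<Longrightarrow> h < k \<Longrightarrow> bdry_pt (left_end g h z) \<in> A"
      proof (cases a)
        case (real a')
        obtain l' where l': "l' < a'" "\<And>x. ereal l' < x \<Longrightarrow> x \<le> ereal a' \<Longrightarrow> bdry_pt x \<in> A"
          using arc_left_nbhd[OF arcs(1) ends(1)[unfolded real]] by blast
        obtain y where y: "l' < y" "y \<le> a'" "g y < k"
          using touched_left[OF ck z(1,2) ab(2) z(3) _ k0 real l'(1)] ka b by auto
        show ?thesis
        proof (rule that[OF y(3)])
          fix h assume h: "g y \<le> h" "h < k"
          show "bdry_pt (left_end g h z) \<in> A"
          proof (rule l'(2))
            have "ereal y \<le> left_end g h z" using h y z(1) real by (intro left_end_ge) auto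
            then show "ereal l' < left_end g h z" using y(1) less_le_trans[of "ereal l'" "ereal y"] by simp
            show "left_end g h z \<le> ereal a'" unfolding left_end_def
            proof (rule Sup_least)
              fix t assume "t \<in> ereal ` {y. y < z \<and> g y \<le> h}"
              then obtain u where u: "t = ereal u" "u < z" "g u \<le> h" by blast
              have "\<not> a' < u"
              proof
                assume "a' < u"
                then have "k \<le> g u" using ck real u(2) less_trans[of "ereal u" "ereal z" b] z(2) by (simp add: fits_def)
                then show False using u(3) h by simp
              qed
              then show "t \<le> ereal a'" using u by simp
            qed
          qed
        qed
      next
        case MInf
        show ?thesis
        proof (rule that[OF True])
          fix h assume h: "0 \<le> h" "h < k"
          have "{y. y < z \<and> g y \<le> h} = {}"
          proof -
            have "k \<le> g y" if "y < z" for y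
              using ck MInf less_trans[of "ereal y" "ereal z" b] z(2) that by (simp add: fits_def)
            then have "\<not> (y < z \<and> g y \<le> h)" for y using h(2) by (meson less_le_trans not_le)
            then show ?thesis by blast
          qed
          then have "left_end g h z = -\<infinity>" by (simp only: left_end_def) (simp add: bot_ereal_def)
          then show "bdry_pt (left_end g h z) \<in> A" using ends(1) MInf by simp
        qed
      qed (use an in simp)
      obtain r' where r': "b < ereal r'" "\<And>x. b \<le> x \<Longrightarrow> x < ereal r' \<Longrightarrow> bdry_pt x \<in> B"
        using arc_right_nbhd[OF arcs(2) ends(2) bn(1)] by blast
      have br: "b' < r'" using r'(1) b by simp
      obtain y where y: "b' \<le> y" "y < r'" "g y < k"
        using touched_right[OF ck z ka(1) True b br] by blast
      have rendB: "bdry_pt (right_end g h z) \<in> B" if h: "g y \<le> h" "h < k" for h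
      proof (rule r'(2))
        have "right_end g h z \<le> ereal y" using h y z(2) b by (intro right_end_le) auto
        then show "right_end g h z < ereal r'" using y(2) le_less_trans[of _ "ereal y" "ereal r'"] by simp
        show "b \<le> right_end g h z" unfolding right_end_def
        proof (rule Inf_greatest)
          fix t assume "t \<in> ereal ` {y. z < y \<and> g y \<le> h}"
          then obtain u where u: "t = ereal u" "z < u" "g u \<le> h" by blast
          have "\<not> u < b'"
          proof
            assume "u < b'"
            then have "k \<le> g u" using ck b u(2) less_trans[of a "ereal z" "ereal u"] z(1) by (simp add: fits_def)
            then show False using u(3) h by simp
          qed
          then show "b \<le> t" using u b by simp
        qed
      qed
      define k2 where "k2 = max 0 (max k1 (g y))"
      have k2: "0 \<le> k2" "k2 < k" using True k1(1) y(3) by (auto simp: k2_def)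
      show ?thesis
      proof (rule emeasure_pos[OF E k2])
        fix h assume h: "k2 < h" "h < k"
        then have "0 < h" "k1 \<le> h" "g y \<le> h" by (auto simp: k2_def)
        then show "h < g z \<and> chord (left_end g h z) (right_end g h z) \<in> ?E"
          using hit[of h z] k1(2) rendB h gz by simp
      qed
    next
      case zero: False
      then have kz: "k = 0" using k0 by simp
      have cap0: "fits g (-\<infinity>) (ereal x) 0" if "g x \<le> 0" for x using that nonneg by (simp add: fits_def)
      have am: "a = -\<infinity>"
      proof (rule ccontr)
        assume "a \<noteq> -\<infinity>"
        then have "-\<infinity> < a" by (cases a) (use an in auto)
        moreover have "fits g (-\<infinity>) b 0" using cap0[of b'] ka kz b by simp
        ultimately have "\<not> (ext0 g a \<le> 0 \<and> ext0 g (ereal z) \<le> 0)"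
          using at_most_three z ab unfolding at_most_three_def by blast
        then show False using ka z(3) kz by simp
      qed
      \<comment> \<open>a further zero \<open>w\<close> would be a fourth point at level 0, after \<open>-\<infinity>\<close>, \<open>z\<close> and \<open>b\<close>\<close>
      have pos: "0 < g w" if w: "b' < w" for w
      proof (rule ccontr)
        assume "\<not> 0 < g w"
        then have "fits g (-\<infinity>) (ereal w) 0" using cap0[of w] by simp
        moreover have "-\<infinity> < ereal z" "ereal z < ereal b'" "ereal b' < ereal w" "ereal w < \<infinity>" using z b w by auto
        ultimately have "\<not> (ext0 g (ereal z) \<le> 0 \<and> ext0 g (ereal b') \<le> 0)"
          using at_most_three unfolding at_most_three_def by blast
        then show False using ka z(3) kz by simp
      qed
      obtain r' where r': "b < ereal r'" "\<And>x. b \<le> x \<Longrightarrow> x < ereal r' \<Longrightarrow> bdry_pt x \<in> B"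
        using arc_right_nbhd[OF arcs(2) ends(2) bn(1)] by blast
      obtain l0 N where N: "\<And>x. N < x \<Longrightarrow> bdry_pt (ereal x) \<in> A"
        using arc_infinity_nbhd[OF arcs(1) ends(1)[unfolded am]] by blast
      have "b' < r'" using r'(1) b by simp
      then obtain x where x: "b' < x" "x < r'" using dense by blast
      define y where "y = max x N + 1"
      have gap: "0 < g t" if "x \<le> t" "t \<le> y" for t using pos that x by simp
      obtain k2 where k2: "0 < k2" "\<And>t. x \<le> t \<Longrightarrow> t \<le> y \<Longrightarrow> k2 < g t" using uniform_gap[OF gap] by blast
      show ?thesis
      proof (rule emeasure_pos[OF E order_refl k2(1)])
        fix h assume h: "0 < h" "h < k2"
        have xy: "x < y" "N < y" by (auto simp: y_def)
        have hx: "h < g x" using k2(2)[of x] h xy by simp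
        have "linked g h x y" unfolding linked_def
          using less_trans[OF h(2) k2(2)] xy by (simp add: min_absorb1 max_absorb2)
        then have yr: "ereal y < right_end g h x" using linked_iff[OF hx] by simp
        obtain s where s: "right_end g h x = ereal s"
          using right_end_attained(2)[OF hx] right_end_less_infinity[OF h(1), of x] by auto
        have "N < s" using yr s xy(2) by simp
        then have "bdry_pt (right_end g h x) \<in> A" unfolding s by (rule N)
        moreover have "bdry_pt (left_end g h x) \<in> B"
        proof (rule r'(2))
          have "ereal b' \<le> left_end g h x" using ka kz h x by (intro left_end_ge) auto
          then show "b \<le> left_end g h x" by (simp add: b)
          show "left_end g h x < ereal r'" by (rule less_trans[OF left_end_attained(1)[OF hx]]) (simp add: x)
        qed
        ultimately show "h < g x \<and> chord (left_end g h x) (right_end g h x) \<in> ?E" using hit[OF h(1) hx] by blast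
      qed
    qed
  qed
qed

lemma emeasure_O_set_pos:
  assumes arcs: "open_arc A" "open_arc B" and ne: "O_set chords A B \<noteq> {}"
  shows "0 < emeasure lam_measure (O_set chords A B)"
proof -
  obtain \<gamma> where \<gamma>: "\<gamma> \<in> O_set chords A B" using ne by blast
  then have "\<gamma> \<in> chords" by (simp add: O_set_def)
  then have "\<gamma> \<in> geodesics" using excursion_chords_geodesics by blast
  then obtain a b where ab: "a < b" "b < \<infinity>" "\<gamma> = chord a b" by (rule geodesic_cases)
  have leaf: "chord a b \<in> chords" using \<open>\<gamma> \<in> chords\<close> ab(3) by simp
  have "O_set chords A B = O_set chords B A" unfolding O_set_def by (metis insert_commute)
  moreover have "bdry_pt a \<in> A \<and> bdry_pt b \<in> B \<or> bdry_pt b \<in> A \<and> bdry_pt a \<in> B"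
    using \<gamma> unfolding ab(3) chord_in_O_set by blast
  ultimately show ?thesis
    using emeasure_O_set_pos_oriented[OF arcs ab(1,2) leaf] emeasure_O_set_pos_oriented[OF arcs(2,1) ab(1,2) leaf]
    by auto
qed

lemma measured_lamination_excursion: "(chords, lam_measure) \<in> measured_laminations"
proof -
  have "emeasure lam_measure (O_set chords A B) < \<infinity>" for A B
  proof -
    have "chords \<in> sets lam_measure" unfolding sets_lam_measure by (rule sigma_sets_top)
    then have "emeasure lam_measure (O_set chords A B) \<le> emeasure lam_measure chords"
      by (intro emeasure_mono) (auto simp: O_set_def)
    then show ?thesis using emeasure_chords_finite by (rule le_less_trans)
  qed
  then show ?thesis
    using lamination_excursion_chords space_lam_measure sets_lam_measure emeasure_O_set_pos
    by (simp add: measured_laminations_def)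
qed

end

section \<open>The correspondence\<close>

text \<open>
  The lamination built from the height function has that function as its mass of leaves over \<open>x\<close>,
  and the height function determines the class.
\<close>

lemma stability_fpc_subset_Phi_image: "stability_fpc \<subseteq> Phi ` measured_laminations"
proof
  fix \<sigma> assume "\<sigma> \<in> stability_fpc"
  then have "\<sigma> \<in> {p. red_blue_pair p} // rb_rel" and fpc: "four_point_condition \<sigma>"
    by (simp_all add: stability_fpc_def stability_conditions_def)
  from this(1) obtain p where "p \<in> {p. red_blue_pair p}" and \<sigma>: "\<sigma> = rb_rel `` {p}" by (rule quotientE)
  then have p: "red_blue_pair p" by simp
  interpret excursion "height p"
    using height_function_height[OF p] four_point_condition_imp_at_most_three[OF p] fpc \<sigma>
    by unfold_locales auto
  interpret X: measured_lamination chords lam_measure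
    by unfold_locales (rule measured_lamination_excursion)
  have "X.straddle = height p"
    using emeasure_straddle nonneg by (simp add: fun_eq_iff X.straddle_def measure_def)
  then have "q \<in> Phi (chords, lam_measure) \<longleftrightarrow> q \<in> \<sigma>" for q
    unfolding X.Phi_iff \<sigma> Image_singleton_iff rb_rel_iff using p by metis
  then have "Phi (chords, lam_measure) = \<sigma>" by blast
  then show "\<sigma> \<in> Phi ` measured_laminations" using measured_lamination_excursion by blast
qed

theorem theorem4p12:
  shows "bij_betw Phi measured_laminations stability_fpc \<and>
    (\<forall>(L, M) \<in> measured_laminations.
       \<exists>\<phi> :: complex set \<Rightarrow> 'k::field qmod. bij_betw \<phi> L (semistable_modules (Phi (L, M))))"
proof (intro conjI ballI)
  have "Phi l \<in> stability_fpc" if "l \<in> measured_laminations" for l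
  proof -
    obtain L M where l: "l = (L, M)" by (cases l)
    interpret measured_lamination L M by unfold_locales (use that l in simp)
    show ?thesis unfolding l by (rule Phi_in_stability_fpc)
  qed
  then show "bij_betw Phi measured_laminations stability_fpc"
    unfolding bij_betw_def using inj_on_Phi stability_fpc_subset_Phi_image by blast
next
  fix l assume "l \<in> measured_laminations"
  then obtain L M where l: "l = (L, M)" "(L, M) \<in> measured_laminations" by (cases l) auto
  interpret measured_lamination L M by unfold_locales (rule l(2))
  show "case l of (L, M) \<Rightarrow> \<exists>\<phi> :: complex set \<Rightarrow> 'k qmod. bij_betw \<phi> L (semistable_modules (Phi (L, M)))"
    unfolding l(1) using bij_betw_leaves_semistable_modules by auto
qed

end
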